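(* Assume the following. (A1) There is a decreasing $\Phi:\mathbb N_0\to[0,\infty)$ and constants $c_1,c_2>0$ independent of $\ell$ with $c_1\|P_\ell x\|_H\le\Phi(\ell)\|x\|_2\le c_2\|P_\ell x\|_H$ for all $x\in\mathbb R^{n_\ell}$ and all $\ell$. (A2) There is a subspace $W\subset V$ with norm $\|\cdot\|_W$ such that: (a) there is $C_{\mathcal A}>0$ such that for every $f\in H$ the solution $u\in V$ of $a(u,\varphi)=\langle f,\varphi\rangle_H$ for all $\varphi\in V$ belongs to $W$ and $\|u\|_W\le C_{\mathcal A}\|f\|_H$; (b) $\inf_{w_\ell\in V_\ell}\|w-w_\ell\|_V\le\sqrt{\Psi(\ell)}\,\|w\|_W$ for all $w\in W$, with a decreasing function $\Psi:\mathbb N_0\to[0,\infty)$, $\Psi(\ell)\to0$. (A3) There is $C_\Psi>1$ with $\Psi(\ell-1)\le C_\Psi\Psi(\ell)$ for all $\ell\ge1$, and $\|\varphi_\ell\|_V\le\|\varphi_\ell\|_H/\sqrt{\Psi(\ell)}$ for all $\varphi_\ell\in V_\ell$. (A4) $\|M_\ell^{(\mathrm{SGS})}\|_2\le C_M\|A_\ell\|_2$ for all $\ell$ with $C_M$ independent of $\ell$, where $M_\ell^{(\mathrm{SGS})}=(D_\ell+L_\ell)D_\ell^{-1}(D_\ell+L_\ell^\top)$. Let $y\in\mathbb R^\beta$ and consider the MGMC update for $\mathcal N(\widetilde\mu_L,\widetilde A_L^{-1})$ with $\widetilde\mu_L=A_L^{-1}B_L(\Gamma+B_L^\top A_L^{-1}B_L)^{-1}y$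 and $\widetilde A_L^{-1}=(A_L+B_L\Gamma^{-1}B_L^\top)^{-1}$, i.e. $\theta_L^{(m+1)}=\mathrm{MGMC}_L(\widetilde A_L,f_L,\theta_L^{(m)})$ with $f_L=B_L\Gamma^{-1}y$, as a V-cycle ($\gamma_\ell=1$) with $\nu_1=\nu_2=\nu/2$ for an even integer $\nu>0$, an exact sampler on level $0$, and the symmetric splitting matrix $$\widetilde M_\ell^{(\mathrm{SGS})}=(D_\ell+B_\ell\Gamma^{-1}B_\ell^\top+L_\ell)(D_\ell+B_\ell\Gamma^{-1}B_\ell^\top)^{-1}(D_\ell+B_\ell\Gamma^{-1}B_\ell^\top+L_\ell^\top)$$ used for pre- and post-smoothing on every level $\ell>0$. Assume that the initial sample $\theta_L^{(0)}$ satisfies $$\max\{\|\widetilde A_L^{1/2}\mathbb E[\theta_L^{(0)}]\|_2,\ \|\widetilde A_L^{1/2}\mathrm{Cov}(\theta_L^{(0)})\widetilde A_L^{1/2}\|_2\}<C_0$$ for a constant $C_0$ independent of $L$. Then $$\tau^{(\infty)}_{\mathrm{int},F_L}\le\frac{1+\|\widetilde X_L\|_{\widetilde A_L}}{1-\|\widetilde X_L\|_{\widetilde A_L}},\qquad\bigl|\tau^{(m)}_{\mathrm{int},F_L}-\tau^{(\infty)}_{\mathrm{int},F_L}\bigr|\le C\frac{\|\widetilde X_L\|_{\widetilde A_L}^{2m+1}}{(1-\|\widetilde X_L\|_{\widetilde A_L})(1-\|\widetilde X_L\|_{\widetilde A_L}^{2m})}\quad\text{for all }m\ge1,$$ with a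 constant $C$ independent of $L$. Moreover, with $\theta_L\sim\mathcal N(\widetilde\mu_L,\widetilde A_L^{-1})$, $$\sqrt{\mathbb E\Bigl[\bigl|\mathbb E[F_L^\top\theta_L]-\tfrac1M\textstyle\sum_{m=1}^MF_L^\top\theta_L^{(m)}\bigr|^2\Bigr]}\le\frac{C'}{\sqrt M}\qquad\text{for all }M\ge1,$$ with a constant $C'>0$ that depends on $\|y\|_2$ (and on $\mathcal F$) but is independent of $M$ and $L$.
   Context: Setting: $H$ is a real separable Hilbert space; $\mathcal A$ is a self-adjoint positive definite (possibly unbounded) operator on $H$ with compact inverse $\mathcal A^{-1}:H\to H$; $V:=D(\mathcal A^{1/2})$, $a(\zeta,\varphi)=\langle\mathcal A^{1/2}\zeta,\mathcal A^{1/2}\varphi\rangle_H$, $\|v\|_V=a(v,v)^{1/2}$. $V_0\subset V_1\subset\dots\subset V$ are nested finite-dimensional subspaces, $\dim V_\ell=n_\ell$, with bases $\{\phi_j^\ell\}_{j=1}^{n_\ell}$; $P_\ell:\mathbb R^{n_\ell}\to V_\ell$, $P_\ell x=\sum_jx^j\phi_j^\ell$. $(A_\ell)_{jk}=a(\phi_j^\ell,\phi_k^\ell)$, with splitting $A_\ell=D_\ell+L_\ell+L_\ell^\top$ into diagonal $D_\ell$ and strictly lower/upper triangular parts. $I_{\ell-1}^\ell$ is the matrix of $P_\ell^{-1}P_{\ell-1}$, $I_\ell^{\ell-1}=(I_{\ell-1}^\ell)^\top$. $\mathcal B:H\to\mathbb R^\beta$ is bounded linear, $\Gamma\in\mathbb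 R^{\beta\times\beta}$ is symmetric positive definite, $(B_\ell)_{jk}=(\mathcal B\phi_j^\ell)_k$ ($B_\ell\in\mathbb R^{n_\ell\times\beta}$), $\widetilde A_\ell=A_\ell+B_\ell\Gamma^{-1}B_\ell^\top$ (so $\widetilde A_{\ell-1}=I_\ell^{\ell-1}\widetilde A_\ell I_{\ell-1}^\ell$). $\mathcal F(\phi)=\langle\phi,\chi\rangle_H$ for fixed $\chi\in H$, $(F_L)_j=\mathcal F(\phi_j^L)$, and $F_L\ne0$ is assumed where it appears in denominators. Random smoother: $\mathrm{RandomSmoother}(A,M,f,\theta):=\theta+M^{-1}(f+\xi-A\theta)$ with a fresh $\xi\sim\mathcal N(0,M+M^\top-A)$, independent of everything else. MGMC update $\mathrm{MGMC}_\ell(\widetilde A_\ell,f_\ell,\theta_\ell)$ (V-cycle, exact coarse sampler, smoother matrices $\widetilde M_\ell$): if $\ell=0$, return a fresh sample from $\mathcal N(\widetilde A_0^{-1}f_0,\widetilde A_0^{-1})$. If $\ell\ge1$: (1) starting from $\theta_\ell$ apply $\nu_1$ times $\theta\mapsto\mathrm{RandomSmoother}(\widetilde A_\ell,\widetilde M_\ell,f_\ell,\theta)$, giving $\theta_{\ell,\nu_1}$; (2) set $f_{\ell-1}:=I_\ell^{\ell-1}(f_\ell-\widetilde A_\ell\theta_{\ell,\nu_1})$, $\psi_{\ell-1}:=\mathrm{MGMC}_{\ell-1}(\widetilde A_{\ell-1},f_{\ell-1},0)$, $\theta_{\ell,\nu_1+1}:=\theta_{\ell,\nu_1}+I_{\ell-1}^\ell\psi_{\ell-1}$;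 (3) starting from $\theta_{\ell,\nu_1+1}$ apply $\nu_2$ times the same random smoother and return the result. All random variables drawn are mutually independent and independent of the initial state, which is multivariate normal (possibly degenerate). Iteration matrix: with $\widetilde S_\ell=I-\widetilde M_\ell^{-1}\widetilde A_\ell$ ($I$ the identity), $\widetilde X_0:=0$ and, for $\ell\ge1$, $\widetilde X_\ell:=\widetilde S_\ell^{\nu_2}\bigl(I-I_{\ell-1}^\ell\widetilde A_{\ell-1}^{-1}I_\ell^{\ell-1}\widetilde A_\ell+I_{\ell-1}^\ell\widetilde X_{\ell-1}\widetilde A_{\ell-1}^{-1}I_\ell^{\ell-1}\widetilde A_\ell\bigr)\widetilde S_\ell^{\nu_1}$. $\|X\|_A:=\|A^{1/2}XA^{-1/2}\|_2$. Integrated autocorrelation times: $$\tau^{(m)}_{\mathrm{int},F_L}:=1+2\sum_{s=1}^\infty\frac{\mathrm{Cov}(F_L^\top\theta_L^{(m+s)},F_L^\top\theta_L^{(m)})}{\mathrm{Cov}(F_L^\top\theta_L^{(m)},F_L^\top\theta_L^{(m)})},\qquad \tau^{(\infty)}_{\mathrm{int},F_L}:=1+2\sum_{s=1}^\infty\frac{F_L^\top\widetilde X_L^s\widetilde A_L^{-1}F_L}{F_L^\top\widetilde A_L^{-1}F_L}.$$ *)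

theory Defs
  imports
    "HOL-Probability.Probability"
    "Jordan_Normal_Form.Gauss_Jordan_Elimination"
begin

unbundle no vec_syntax and no inner_syntax

text \<open>
  Coefficient vectors and matrices live in dimensions depending on the level, so they are
  the explicit-dimension vectors and matrices of \<^theory>\<open>Jordan_Normal_Form.Matrix\<close>.
  From here on \<open>\<bullet>\<close> is their scalar product; the inner product of the
  Hilbert space is always written \<^const>\<open>inner\<close>.
\<close>

type_synonym rvec = "real Matrix.vec"
type_synonym rmat = "real Matrix.mat"


section \<open>Unbounded operators on a real Hilbert space\<close>

text \<open>An operator is a pair of a domain \<open>D\<close> and a function that is only looked at on \<open>D\<close>.\<close>

definition linear_op_on :: "'h::real_inner set \<Rightarrow> ('h \<Rightarrow> 'h) \<Rightarrow> bool" where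
  "linear_op_on D T \<longleftrightarrow> subspace D
     \<and> (\<forall>x\<in>D. \<forall>y\<in>D. T (x + y) = T x + T y)
     \<and> (\<forall>c. \<forall>x\<in>D. T (c *\<^sub>R x) = c *\<^sub>R T x)"

text \<open>The last conjunct says that the graph of \<open>T\<close> equals the graph of its adjoint, domains included.\<close>

definition self_adjoint_op :: "'h::real_inner set \<Rightarrow> ('h \<Rightarrow> 'h) \<Rightarrow> bool" where
  "self_adjoint_op D T \<longleftrightarrow> linear_op_on D T \<and> closure D = UNIV
     \<and> (\<forall>y z. (y \<in> D \<and> z = T y) \<longleftrightarrow> (\<forall>x\<in>D. inner (T x) y = inner x z))"

definition positive_definite_op :: "'h::real_inner set \<Rightarrow> ('h \<Rightarrow> 'h) \<Rightarrow> bool" where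
  "positive_definite_op D T \<longleftrightarrow> (\<forall>x\<in>D. x \<noteq> 0 \<longrightarrow> 0 < inner (T x) x)"

definition compact_op :: "('h::real_inner \<Rightarrow> 'h) \<Rightarrow> bool" where
  "compact_op K \<longleftrightarrow> linear K \<and> (\<forall>U. bounded U \<longrightarrow> compact (closure (K ` U)))"

definition has_compact_inverse :: "'h::real_inner set \<Rightarrow> ('h \<Rightarrow> 'h) \<Rightarrow> bool" where
  "has_compact_inverse D T \<longleftrightarrow> bij_betw T D UNIV \<and> compact_op (inv_into D T)"

text \<open>\<open>(V, S)\<close> is the square root of \<open>(D, T)\<close>: the nonnegative self-adjoint operator with
  \<open>S \<circ> S = T\<close>, where \<open>S \<circ> S\<close> carries its natural domain.\<close>

definition is_sqrt_op ::
    "'h::real_inner set \<Rightarrow> ('h \<Rightarrow> 'h) \<Rightarrow> 'h set \<Rightarrow> ('h \<Rightarrow> 'h) \<Rightarrow> bool" where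
  "is_sqrt_op V S D T \<longleftrightarrow> self_adjoint_op V S
     \<and> (\<forall>x\<in>V. 0 \<le> inner (S x) x)
     \<and> D = {x \<in> V. S x \<in> V} \<and> (\<forall>x\<in>D. T x = S (S x))"

text \<open>In the next two definitions \<open>S\<close> is the square root of the operator.\<close>

definition energy :: "('h::real_inner \<Rightarrow> 'h) \<Rightarrow> 'h \<Rightarrow> 'h \<Rightarrow> real" where
  "energy S u v = inner (S u) (S v)"

definition energy_norm :: "('h::real_inner \<Rightarrow> 'h) \<Rightarrow> 'h \<Rightarrow> real" where
  "energy_norm S v = sqrt (energy S v v)"

definition norm_on :: "'h::real_vector set \<Rightarrow> ('h \<Rightarrow> real) \<Rightarrow> bool" where
  "norm_on W N \<longleftrightarrow> (\<forall>w\<in>W. 0 \<le> N w \<and> (N w = 0 \<longleftrightarrow> w = 0))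
     \<and> (\<forall>c. \<forall>w\<in>W. N (c *\<^sub>R w) = \<bar>c\<bar> * N w)
     \<and> (\<forall>v\<in>W. \<forall>w\<in>W. N (v + w) \<le> N v + N w)"


section \<open>Matrices\<close>

definition vnorm :: "rvec \<Rightarrow> real" where
  "vnorm x = sqrt (x \<bullet> x)"

definition mnorm :: "rmat \<Rightarrow> real" where
  "mnorm X = Sup {vnorm (X *\<^sub>v x) | x. x \<in> carrier_vec (dim_col X) \<and> vnorm x \<le> 1}"

definition minv :: "rmat \<Rightarrow> rmat" where
  "minv X = the (mat_inverse X)"

definition pos_semidef :: "nat \<Rightarrow> rmat \<Rightarrow> bool" where
  "pos_semidef n X \<longleftrightarrow> X \<in> carrier_mat n n \<and> transpose_mat X = X
     \<and> (\<forall>x\<in>carrier_vec n. 0 \<le> x \<bullet> (X *\<^sub>v x))"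

definition pos_def :: "nat \<Rightarrow> rmat \<Rightarrow> bool" where
  "pos_def n X \<longleftrightarrow> X \<in> carrier_mat n n \<and> transpose_mat X = X
     \<and> (\<forall>x\<in>carrier_vec n. x \<noteq> 0\<^sub>v n \<longrightarrow> 0 < x \<bullet> (X *\<^sub>v x))"

definition msqrt :: "rmat \<Rightarrow> rmat" where
  "msqrt X = (THE R. pos_semidef (dim_row X) R \<and> R * R = X)"

definition energy_mnorm :: "rmat \<Rightarrow> rmat \<Rightarrow> real" where
  "energy_mnorm A X = mnorm (msqrt A * X * minv (msqrt A))"

definition diag_part :: "rmat \<Rightarrow> rmat" where
  "diag_part A = Matrix.mat (dim_row A) (dim_col A) (\<lambda>(i, j). if i = j then A $$ (i, j) else 0)"

definition lower_part :: "rmat \<Rightarrow> rmat" where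
  "lower_part A = Matrix.mat (dim_row A) (dim_col A) (\<lambda>(i, j). if j < i then A $$ (i, j) else 0)"

definition sgs :: "rmat \<Rightarrow> rmat" where
  "sgs A = (diag_part A + lower_part A) * minv (diag_part A)
             * (diag_part A + transpose_mat (lower_part A))"

text \<open>Splitting matrix for \<open>A + K\<close>, where \<open>K\<close> is the (low-rank) data update. The whole of
  \<open>K\<close> is added to the diagonal, so this is not \<open>sgs (A + K)\<close>.\<close>

definition sgs_update :: "rmat \<Rightarrow> rmat \<Rightarrow> rmat" where
  "sgs_update A K = (diag_part A + K + lower_part A) * minv (diag_part A + K)
             * (diag_part A + K + transpose_mat (lower_part A))"


section \<open>Discretisation\<close>

text \<open>\<open>\<phi> l j\<close> for \<open>j < n l\<close> is the basis of the level-\<open>l\<close> space; indices start at 0.\<close>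

definition level_space :: "(nat \<Rightarrow> nat \<Rightarrow> 'h::real_vector) \<Rightarrow> (nat \<Rightarrow> nat) \<Rightarrow> nat \<Rightarrow> 'h set" where
  "level_space \<phi> n l = span (\<phi> l ` {..<n l})"

definition is_level_basis :: "(nat \<Rightarrow> nat \<Rightarrow> 'h::real_vector) \<Rightarrow> (nat \<Rightarrow> nat) \<Rightarrow> nat \<Rightarrow> bool" where
  "is_level_basis \<phi> n l \<longleftrightarrow> inj_on (\<phi> l) {..<n l} \<and> independent (\<phi> l ` {..<n l})"

definition recon ::
    "(nat \<Rightarrow> nat \<Rightarrow> 'h::real_vector) \<Rightarrow> (nat \<Rightarrow> nat) \<Rightarrow> nat \<Rightarrow> rvec \<Rightarrow> 'h" where
  "recon \<phi> n l x = (\<Sum>j<n l. vec_index x j *\<^sub>R \<phi> l j)"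

text \<open>Matrix of \<open>P\<^sub>l\<^sup>-\<^sup>1 P\<^sub>l\<^sub>-\<^sub>1\<close> from level \<open>l - 1\<close> to level \<open>l\<close>; used for \<open>l \<ge> 1\<close> only.\<close>

definition prolongation ::
    "(nat \<Rightarrow> nat \<Rightarrow> 'h::real_vector) \<Rightarrow> (nat \<Rightarrow> nat) \<Rightarrow> nat \<Rightarrow> rmat" where
  "prolongation \<phi> n l = mat_of_cols (n l)
     (map (\<lambda>j. inv_into (carrier_vec (n l)) (recon \<phi> n l)
                  (recon \<phi> n (l - 1) (unit_vec (n (l - 1)) j))) [0..<n (l - 1)])"

definition stiffness_mat ::
    "('h::real_inner \<Rightarrow> 'h) \<Rightarrow> (nat \<Rightarrow> nat \<Rightarrow> 'h) \<Rightarrow> (nat \<Rightarrow> nat) \<Rightarrow> nat \<Rightarrow> rmat" where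
  "stiffness_mat S \<phi> n l = Matrix.mat (n l) (n l) (\<lambda>(j, k). energy S (\<phi> l j) (\<phi> l k))"

definition load_vec ::
    "'h::real_inner \<Rightarrow> (nat \<Rightarrow> nat \<Rightarrow> 'h) \<Rightarrow> (nat \<Rightarrow> nat) \<Rightarrow> nat \<Rightarrow> rvec" where
  "load_vec \<chi> \<phi> n l = Matrix.vec (n l) (\<lambda>j. inner (\<phi> l j) \<chi>)"

definition bounded_linear_obs :: "nat \<Rightarrow> ('h::real_normed_vector \<Rightarrow> rvec) \<Rightarrow> bool" where
  "bounded_linear_obs \<beta> Obs \<longleftrightarrow> (\<forall>u. Obs u \<in> carrier_vec \<beta>)
     \<and> (\<forall>u v. Obs (u + v) = Obs u + Obs v)
     \<and> (\<forall>c u. Obs (c *\<^sub>R u) = c \<cdot>\<^sub>v Obs u)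
     \<and> (\<exists>K. \<forall>u. vnorm (Obs u) \<le> K * norm u)"

definition obs_mat ::
    "nat \<Rightarrow> ('h \<Rightarrow> rvec) \<Rightarrow> (nat \<Rightarrow> nat \<Rightarrow> 'h) \<Rightarrow> (nat \<Rightarrow> nat) \<Rightarrow> nat \<Rightarrow> rmat" where
  "obs_mat \<beta> Obs \<phi> n l = Matrix.mat (n l) \<beta> (\<lambda>(j, k). vec_index (Obs (\<phi> l j)) k)"


section \<open>Gaussian random vectors\<close>

text \<open>Variance 0 gives the Dirac measure at \<open>m\<close>.\<close>

definition normal_dist :: "real \<Rightarrow> real \<Rightarrow> real measure" where
  "normal_dist m s = (if s = 0 then return borel m else density lborel (normal_density m (sqrt s)))"

text \<open>Multivariate normal law, possibly degenerate: every linear functional of \<open>X\<close> is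
  univariate normal with the matching mean and variance.\<close>

definition gaussian_rv ::
    "'w measure \<Rightarrow> nat \<Rightarrow> ('w \<Rightarrow> rvec) \<Rightarrow> rvec \<Rightarrow> rmat \<Rightarrow> bool" where
  "gaussian_rv Pr n X \<mu> \<Sigma> \<longleftrightarrow> \<mu> \<in> carrier_vec n \<and> pos_semidef n \<Sigma>
     \<and> (\<forall>\<omega>\<in>space Pr. X \<omega> \<in> carrier_vec n)
     \<and> (\<forall>i<n. (\<lambda>\<omega>. vec_index (X \<omega>) i) \<in> borel_measurable Pr)
     \<and> (\<forall>v\<in>carrier_vec n.
          distr Pr borel (\<lambda>\<omega>. v \<bullet> X \<omega>) = normal_dist (v \<bullet> \<mu>) (v \<bullet> (\<Sigma> *\<^sub>v v)))"

definition cov :: "'w measure \<Rightarrow> ('w \<Rightarrow> real) \<Rightarrow> ('w \<Rightarrow> real) \<Rightarrow> real" where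
  "cov Pr X Y = integral\<^sup>L Pr (\<lambda>\<omega>. (X \<omega> - integral\<^sup>L Pr X) * (Y \<omega> - integral\<^sup>L Pr Y))"

definition mean_vec :: "'w measure \<Rightarrow> nat \<Rightarrow> ('w \<Rightarrow> rvec) \<Rightarrow> rvec" where
  "mean_vec Pr n X = Matrix.vec n (\<lambda>i. integral\<^sup>L Pr (\<lambda>\<omega>. vec_index (X \<omega>) i))"

definition cov_mat :: "'w measure \<Rightarrow> nat \<Rightarrow> ('w \<Rightarrow> rvec) \<Rightarrow> rmat" where
  "cov_mat Pr n X = Matrix.mat n n
     (\<lambda>(i, j). cov Pr (\<lambda>\<omega>. vec_index (X \<omega>) i) (\<lambda>\<omega>. vec_index (X \<omega>) j))"


section \<open>Multigrid Monte Carlo\<close>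

text \<open>Throughout, \<open>A\<close>, \<open>M\<close>, \<open>I\<close> are the level-indexed precision matrices, smoother matrices and
  prolongations; restriction is the transpose of \<open>I\<close>. The argument \<open>\<xi>\<close> is the realised noise.\<close>

definition random_smoother :: "rmat \<Rightarrow> rmat \<Rightarrow> rvec \<Rightarrow> rvec \<Rightarrow> rvec \<Rightarrow> rvec" where
  "random_smoother A M f \<xi> \<theta> = \<theta> + minv M *\<^sub>v (f + \<xi> - A *\<^sub>v \<theta>)"

primrec smooth_steps ::
    "rmat \<Rightarrow> rmat \<Rightarrow> rvec \<Rightarrow> (nat \<Rightarrow> rvec) \<Rightarrow> nat \<Rightarrow> rvec \<Rightarrow> rvec" where
  "smooth_steps A M f \<xi> 0 \<theta> = \<theta>"
| "smooth_steps A M f \<xi> (Suc k) \<theta> = random_smoother A M f (\<xi> k) (smooth_steps A M f \<xi> k \<theta>)"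

text \<open>One V-cycle update. A V-cycle visits every level once, so the noise of one update is
  \<open>\<xi> l k\<close> for smoothing step \<open>k\<close> (pre-smoothing first) on level \<open>l\<close>. On level 0 the fresh sample from
  \<open>N(A\<^sub>0\<^sup>-\<^sup>1 f\<^sub>0, A\<^sub>0\<^sup>-\<^sup>1)\<close> is its mean plus a fresh \<open>\<eta> \<sim> N(0, A\<^sub>0\<^sup>-\<^sup>1)\<close>.\<close>

primrec mgmc ::
    "(nat \<Rightarrow> rmat) \<Rightarrow> (nat \<Rightarrow> rmat) \<Rightarrow> (nat \<Rightarrow> rmat) \<Rightarrow> nat \<Rightarrow> nat
      \<Rightarrow> rvec \<Rightarrow> (nat \<Rightarrow> nat \<Rightarrow> rvec) \<Rightarrow> nat \<Rightarrow> rvec \<Rightarrow> rvec \<Rightarrow> rvec" where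
  "mgmc A M I \<nu>1 \<nu>2 \<eta> \<xi> 0 f \<theta> = minv (A 0) *\<^sub>v f + \<eta>"
| "mgmc A M I \<nu>1 \<nu>2 \<eta> \<xi> (Suc l) f \<theta> =
     (let \<theta>1 = smooth_steps (A (Suc l)) (M (Suc l)) f (\<xi> (Suc l)) \<nu>1 \<theta>;
          g = transpose_mat (I (Suc l)) *\<^sub>v (f - A (Suc l) *\<^sub>v \<theta>1);
          \<psi> = mgmc A M I \<nu>1 \<nu>2 \<eta> \<xi> l g (0\<^sub>v (dim_col (I (Suc l))));
          \<theta>2 = \<theta>1 + I (Suc l) *\<^sub>v \<psi>
      in smooth_steps (A (Suc l)) (M (Suc l)) f (\<lambda>k. \<xi> (Suc l) (\<nu>1 + k)) \<nu>2 \<theta>2)"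

primrec mg_iteration_mat ::
    "(nat \<Rightarrow> rmat) \<Rightarrow> (nat \<Rightarrow> rmat) \<Rightarrow> (nat \<Rightarrow> rmat) \<Rightarrow> nat \<Rightarrow> nat \<Rightarrow> nat \<Rightarrow> rmat" where
  "mg_iteration_mat A M I \<nu>1 \<nu>2 0 = 0\<^sub>m (dim_row (A 0)) (dim_row (A 0))"
| "mg_iteration_mat A M I \<nu>1 \<nu>2 (Suc l) =
     (let A1 = A (Suc l); I1 = I (Suc l); Id = 1\<^sub>m (dim_row A1);
          S = Id - minv (M (Suc l)) * A1
      in S ^\<^sub>m \<nu>2
           * (Id - I1 * minv (A l) * transpose_mat I1 * A1
                + I1 * mg_iteration_mat A M I \<nu>1 \<nu>2 l * minv (A l) * transpose_mat I1 * A1)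
           * S ^\<^sub>m \<nu>1)"

text \<open>Labels of the independent random inputs: the initial state, and in update \<open>m\<close> the
  coarse sample and the noise of smoothing step \<open>k\<close> on level \<open>l\<close>.\<close>

datatype source = Initial | Coarse nat | Smooth nat nat nat

definition sources :: "nat \<Rightarrow> nat \<Rightarrow> source set" where
  "sources L \<nu> = insert Initial (range Coarse \<union> {Smooth m l k | m l k. 1 \<le> l \<and> l \<le> L \<and> k < \<nu>})"

primrec source_dim :: "(nat \<Rightarrow> nat) \<Rightarrow> nat \<Rightarrow> source \<Rightarrow> nat" where
  "source_dim n L Initial = n L"
| "source_dim n L (Coarse m) = n 0"
| "source_dim n L (Smooth m l k) = n l"

definition mgmc_chain ::
    "'w measure \<Rightarrow> (nat \<Rightarrow> nat) \<Rightarrow> (nat \<Rightarrow> rmat) \<Rightarrow> (nat \<Rightarrow> rmat) \<Rightarrow> (nat \<Rightarrow> rmat)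
      \<Rightarrow> nat \<Rightarrow> nat \<Rightarrow> nat \<Rightarrow> rvec \<Rightarrow> (nat \<Rightarrow> 'w \<Rightarrow> rvec) \<Rightarrow> bool" where
  "mgmc_chain Pr n A M I \<nu>1 \<nu>2 L f \<theta> \<longleftrightarrow> prob_space Pr \<and>
     (\<exists>Z :: source \<Rightarrow> 'w \<Rightarrow> rvec.
        Z Initial = \<theta> 0
      \<and> (\<exists>\<mu> \<Sigma>. gaussian_rv Pr (n L) (Z Initial) \<mu> \<Sigma>)
      \<and> (\<forall>m. gaussian_rv Pr (n 0) (Z (Coarse m)) (0\<^sub>v (n 0)) (minv (A 0)))
      \<and> (\<forall>m l k. 1 \<le> l \<and> l \<le> L \<and> k < \<nu>1 + \<nu>2 \<longrightarrow>
           gaussian_rv Pr (n l) (Z (Smooth m l k)) (0\<^sub>v (n l)) (M l + transpose_mat (M l) - A l))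
      \<and> prob_space.indep_vars Pr
           (\<lambda>s. Pi\<^sub>M {..<source_dim n L s} (\<lambda>_. borel))
           (\<lambda>s \<omega>. restrict (vec_index (Z s \<omega>)) {..<source_dim n L s})
           (sources L (\<nu>1 + \<nu>2))
      \<and> (\<forall>m. \<forall>\<omega>\<in>space Pr. \<theta> (Suc m) \<omega> =
           mgmc A M I \<nu>1 \<nu>2 (Z (Coarse m) \<omega>) (\<lambda>l k. Z (Smooth m l k) \<omega>) L f (\<theta> m \<omega>)))"


section \<open>Integrated autocorrelation times\<close>

text \<open>The \<open>s\<close>-th summand, \<open>s \<ge> 0\<close>, is the autocorrelation at lag \<open>s + 1\<close>.\<close>

definition autocorr :: "'w measure \<Rightarrow> rvec \<Rightarrow> (nat \<Rightarrow> 'w \<Rightarrow> rvec) \<Rightarrow> nat \<Rightarrow> nat \<Rightarrow> real" where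
  "autocorr Pr F \<theta> m s =
     cov Pr (\<lambda>\<omega>. F \<bullet> \<theta> (m + s) \<omega>) (\<lambda>\<omega>. F \<bullet> \<theta> m \<omega>)
       / cov Pr (\<lambda>\<omega>. F \<bullet> \<theta> m \<omega>) (\<lambda>\<omega>. F \<bullet> \<theta> m \<omega>)"

definition iact :: "'w measure \<Rightarrow> rvec \<Rightarrow> (nat \<Rightarrow> 'w \<Rightarrow> rvec) \<Rightarrow> nat \<Rightarrow> real" where
  "iact Pr F \<theta> m = 1 + 2 * (\<Sum>s. autocorr Pr F \<theta> m (Suc s))"

definition limit_autocorr :: "rmat \<Rightarrow> rmat \<Rightarrow> rvec \<Rightarrow> nat \<Rightarrow> real" where
  "limit_autocorr A X F s = (F \<bullet> (X ^\<^sub>m s *\<^sub>v (minv A *\<^sub>v F))) / (F \<bullet> (minv A *\<^sub>v F))"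

definition limit_iact :: "rmat \<Rightarrow> rmat \<Rightarrow> rvec \<Rightarrow> real" where
  "limit_iact A X F = 1 + 2 * (\<Sum>s. limit_autocorr A X F (Suc s))"

end

theory Submission
  imports Defs "Jordan_Normal_Form.Determinant"
begin

text \<open>
  Let \<open>A' = A + K\<close> with \<open>K = B \<Gamma>\<inverse> B\<^sup>T\<close>. The splitting matrix is \<open>M = A' + L (D + K)\<inverse> L\<^sup>T \<ge> A'\<close>, so the smoother \<open>S = 1 - M\<inverse> A'\<close> is energy-self-adjoint
  with \<open>0 \<le> S \<le> 1\<close>. The data update is bounded on the Hilbert space, hence elliptic regularity survives the perturbation,
  and duality together with the inverse estimate and the bound on the unperturbed smoother gives
  \<open>\<langle>e, M e\<rangle> \<le> C \<langle>e, A' e\<rangle>\<close>, uniformly in the level, for all \<open>e\<close> that are energy-orthogonal to the coarse space.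
  The induction of Braess and Hackbusch turns this into \<open>0 \<le> X \<le> C / (C + 1)\<close> on every level.

  One update maps \<open>\<theta> - \<mu>\<close> to \<open>X (\<theta> - \<mu>)\<close> plus independent noise with covariance \<open>A'\<inverse> - X A'\<inverse> X\<^sup>T\<close>. Therefore the
  deviation of the covariance of the state from \<open>A'\<inverse>\<close> is conjugated by \<open>X\<close> in each step, and a lag multiplies by a
  power of \<open>X\<close>. All estimates are made in the dual energy norm \<open>v \<mapsto> sqrt \<langle>v, A'\<inverse> v\<rangle>\<close>, in which the
  transpose of \<open>X\<close> has at most the energy norm of \<open>X\<close>. There the functional has norm bounded in \<open>L\<close>, by the Poincare inequality.
\<close>

text \<open>(A4) concerns the splitting of \<open>A\<close>, while the cycle smooths
  \<open>A + K\<close>. Since all of \<open>K\<close> sits in the diagonal block, antitonicity of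
  inversion gives \<open>M \<le> sgs A + K\<close> as forms, and \<open>K\<close> is bounded by the
  energy through the Poincare inequality. When \<open>sgs A\<close> is estimated on the complement
  of the coarse space, \<open>\<Phi>\<close> cancels between the two halves of the norm equivalence,
  and the inverse estimate cancels against the duality estimate up to the ratio of neighbouring
  values of \<open>\<Psi>\<close>. This makes \<open>C\<close> independent of the level.

  The delicate point for the autocorrelations is the denominator, since a degenerate initial state
  may have variance 0. A covariance is nonnegative, so the initial deviation from
  \<open>A'\<inverse>\<close> is at least \<open>- A'\<inverse>\<close>, and after \<open>m\<close>
  updates it removes at most the fraction \<open>\<rho> ^ (2 * m)\<close> of the limit variance.
  Hence the factor \<open>1 - \<rho> ^ (2 * m)\<close> and the restriction to
  \<open>m \<ge> 1\<close>. The dependence of the last bound on \<open>y\<close> comes from the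
  bias: the energy norm of the posterior mean is the dual norm of the right-hand side, which is
  bounded by a multiple of the norm of \<open>y\<close>.\<close>

section \<open>Real vectors and matrices\<close>

text \<open>The library states these rules with carrier sets whose dimensions occur only in the premises; with
  dimension equations as premises they work as conditional rewrite rules.\<close>

lemma mv_mult: "dim_col A = dim_row B \<Longrightarrow> dim_col B = dim_vec x \<Longrightarrow>
    (A * B) *\<^sub>v x = A *\<^sub>v (B *\<^sub>v (x :: rvec))"
  by (rule assoc_mult_mat_vec[of A "dim_row A" "dim_row B" B "dim_vec x"]) (auto intro: carrier_matI carrier_vecI)

lemma mv_add: "dim_row A = dim_row B \<Longrightarrow> dim_col A = dim_vec x \<Longrightarrow> dim_col B = dim_vec x \<Longrightarrow>
    (A + B) *\<^sub>v x = A *\<^sub>v x + B *\<^sub>v (x :: rvec)"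
  by (rule add_mult_distrib_mat_vec[of A "dim_row A" "dim_vec x"]) (auto intro: carrier_matI carrier_vecI)

lemma mv_minus: "dim_row A = dim_row B \<Longrightarrow> dim_col A = dim_vec x \<Longrightarrow> dim_col B = dim_vec x \<Longrightarrow>
    (A - B) *\<^sub>v x = A *\<^sub>v x - B *\<^sub>v (x :: rvec)"
  by (rule minus_mult_distrib_mat_vec[of A "dim_row A" "dim_vec x"]) (auto intro: carrier_matI carrier_vecI)

lemma mv_vadd: "dim_vec x = dim_col A \<Longrightarrow> dim_vec y = dim_col A \<Longrightarrow>
    A *\<^sub>v (x + y) = A *\<^sub>v x + A *\<^sub>v (y :: rvec)"
  by (rule mult_add_distrib_mat_vec[of A "dim_row A" "dim_col A"]) (auto intro: carrier_matI carrier_vecI)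

lemma mv_vminus: "dim_vec x = dim_col A \<Longrightarrow> dim_vec y = dim_col A \<Longrightarrow>
    A *\<^sub>v (x - y) = A *\<^sub>v x - A *\<^sub>v (y :: rvec)"
  by (rule mult_minus_distrib_mat_vec[of A "dim_row A" "dim_col A"]) (auto intro: carrier_matI carrier_vecI)

lemma mv_smult: "dim_vec x = dim_col A \<Longrightarrow>
    A *\<^sub>v (c \<cdot>\<^sub>v x) = c \<cdot>\<^sub>v (A *\<^sub>v (x :: rvec))"
  by (rule mult_mat_vec[of A "dim_row A" "dim_col A"]) (auto intro: carrier_matI carrier_vecI)

lemma mv_one: "dim_vec x = n \<Longrightarrow> 1\<^sub>m n *\<^sub>v x = (x :: rvec)"
  by (rule one_mult_mat_vec) (auto intro: carrier_vecI)

lemma mv_zero: "dim_vec x = n \<Longrightarrow> 0\<^sub>m m n *\<^sub>v x = (0\<^sub>v m :: rvec)"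
  by (rule eq_vecI) (auto simp: scalar_prod_def)

lemma mv_vzero: "dim_col A = n \<Longrightarrow> A *\<^sub>v 0\<^sub>v n = (0\<^sub>v (dim_row A) :: rvec)"
  by (rule eq_vecI) (auto simp: scalar_prod_def)

lemmas mv = mv_mult mv_add mv_minus mv_vadd mv_vminus mv_smult mv_one mv_zero mv_vzero

lemma sp_addl: "dim_vec x = dim_vec z \<Longrightarrow> dim_vec y = dim_vec z \<Longrightarrow> (x + y) \<bullet> z = x \<bullet> z + y \<bullet> (z :: rvec)"
  by (simp add: scalar_prod_def algebra_simps sum.distrib)
lemma sp_addr: "dim_vec x = dim_vec y \<Longrightarrow> z \<bullet> (x + y) = z \<bullet> x + z \<bullet> (y :: rvec)"
  by (simp add: scalar_prod_def algebra_simps sum.distrib)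
lemma sp_minusl: "dim_vec x = dim_vec z \<Longrightarrow> dim_vec y = dim_vec z \<Longrightarrow> (x - y) \<bullet> z = x \<bullet> z - y \<bullet> (z :: rvec)"
  by (simp add: scalar_prod_def algebra_simps sum_subtractf)
lemma sp_minusr: "dim_vec x = dim_vec y \<Longrightarrow> z \<bullet> (x - y) = z \<bullet> x - z \<bullet> (y :: rvec)"
  by (simp add: scalar_prod_def algebra_simps sum_subtractf)
lemma sp_smultl: "dim_vec x = dim_vec z \<Longrightarrow> (c \<cdot>\<^sub>v x) \<bullet> z = c * (x \<bullet> (z :: rvec))"
  by (simp add: scalar_prod_def algebra_simps sum_distrib_left)
lemma sp_smultr: "z \<bullet> (c \<cdot>\<^sub>v x) = c * (z \<bullet> (x :: rvec))"
  by (simp add: scalar_prod_def algebra_simps sum_distrib_left)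
lemma sp_zerol: "dim_vec z = n \<Longrightarrow> 0\<^sub>v n \<bullet> (z :: rvec) = 0"
  by (simp add: scalar_prod_def)
lemma sp_zeror: "z \<bullet> (0\<^sub>v n :: rvec) = 0"
  by (simp add: scalar_prod_def)

lemmas sp = sp_addl sp_addr sp_minusl sp_minusr sp_smultl sp_smultr sp_zerol sp_zeror

lemma sp_comm: "dim_vec x = dim_vec y \<Longrightarrow> x \<bullet> y = y \<bullet> (x :: rvec)"
  by (simp add: scalar_prod_def mult.commute)

lemma sp_transpose: "dim_vec x = dim_row A \<Longrightarrow> dim_vec y = dim_col A \<Longrightarrow>
    x \<bullet> (A *\<^sub>v y) = (transpose_mat A *\<^sub>v x) \<bullet> (y :: rvec)"
  by (rule transpose_vec_mult_scalar[symmetric, of A "dim_row A" "dim_col A"]) (auto intro: carrier_matI carrier_vecI)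

lemma vec_eq_sp:
  assumes "x \<in> carrier_vec n" "y \<in> carrier_vec n" "\<And>g. g \<in> carrier_vec n \<Longrightarrow> g \<bullet> x = g \<bullet> (y :: rvec)"
  shows "x = y"
proof (rule eq_vecI)
  fix i assume "i < dim_vec y"
  then have i: "i < n" using assms by auto
  have "unit_vec n i \<bullet> x = unit_vec n i \<bullet> y" by (rule assms) simp
  then show "vec_index x i = vec_index y i"
    by (simp add: scalar_prod_left_unit[OF assms(1) i] scalar_prod_left_unit[OF assms(2) i])
qed (use assms in auto)

lemma mat_eq_mv:
  assumes "A \<in> carrier_mat m n" "B \<in> carrier_mat m n"
    "\<And>x. x \<in> carrier_vec n \<Longrightarrow> A *\<^sub>v x = B *\<^sub>v (x :: rvec)"
  shows "A = B"
proof (rule eq_matI)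
  fix i j assume "i < dim_row B" "j < dim_col B"
  then have ij: "i < m" "j < n" using assms by auto
  have "vec_index (A *\<^sub>v unit_vec n j) i = vec_index (B *\<^sub>v unit_vec n j) i"
    by (simp add: assms(3))
  then show "A $$ (i, j) = B $$ (i, j)" using assms(1,2) ij by simp
qed (use assms in auto)

lemma sp_self_nonneg: "0 \<le> x \<bullet> (x :: rvec)"
  by (simp add: scalar_prod_def sum_nonneg)

lemma sp_self_eq_0: "x \<in> carrier_vec n \<Longrightarrow> x \<bullet> (x :: rvec) = 0 \<longleftrightarrow> x = 0\<^sub>v n"
  by (auto simp: scalar_prod_def sum_nonneg_eq_0_iff intro!: eq_vecI)

lemma vnorm_sq: "vnorm x * vnorm x = x \<bullet> x"
  by (simp add: vnorm_def sp_self_nonneg)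

lemma vnorm_power2: "(vnorm x)\<^sup>2 = x \<bullet> x"
  by (simp add: vnorm_def sp_self_nonneg)

lemma vnorm_nonneg [simp]: "0 \<le> vnorm x"
  by (simp add: vnorm_def sp_self_nonneg)

lemma vnorm_eq_0: "x \<in> carrier_vec n \<Longrightarrow> vnorm x = 0 \<longleftrightarrow> x = 0\<^sub>v n"
  using sp_self_eq_0[of x n] by (simp add: vnorm_def)

lemma vnorm_smult: "vnorm (c \<cdot>\<^sub>v x) = \<bar>c\<bar> * vnorm x"
  by (simp add: vnorm_def sp real_sqrt_mult flip: mult.assoc)

text \<open>The common engine of the Cauchy-Schwarz inequality for semidefinite matrices and of the
  residual estimate for minimising sequences. If the leading coefficient vanishes, nonnegativity for
  all \<open>t\<close> forces the linear coefficient to vanish too.\<close>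

lemma quadratic_nonneg_discriminant:
  fixes a b c :: real
  assumes "\<And>t. 0 \<le> a + 2 * b * t + c * t\<^sup>2"
  shows "b\<^sup>2 \<le> a * c"
proof (cases "c = 0")
  case True
  have "b = 0"
  proof (rule ccontr)
    assume "b \<noteq> 0"
    then show False using assms[of "-(a + 1) / (2 * b)"] True by simp
  qed
  then show ?thesis using True by simp
next
  case False
  have "0 \<le> c"
  proof (rule ccontr)
    assume c: "\<not> 0 \<le> c"
    \<comment> \<open>The sign makes \<open>b * t \<le> 0\<close>, and the size makes
      \<open>c * t\<^sup>2 \<le> c - \<bar>a\<bar>\<close>, so the quadratic would be negative for
      \<open>c < 0\<close>.\<close>
    define t where "t = (if b \<ge> 0 then -1 else 1) * (1 + \<bar>a\<bar> / (-c))"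
    have t2: "t\<^sup>2 \<ge> 1 + \<bar>a\<bar> / (-c)"
    proof -
      have "1 \<le> 1 + \<bar>a\<bar> / (-c)" using c by (simp add: divide_nonneg_neg)
      then have "1 + \<bar>a\<bar> / (-c) \<le> (1 + \<bar>a\<bar> / (-c))\<^sup>2" by (rule self_le_power) simp
      then show ?thesis by (simp add: t_def power_mult_distrib)
    qed
    have "b * t \<le> 0" using c unfolding t_def
      by (auto simp: mult_nonneg_nonpos mult_nonpos_nonneg divide_nonneg_neg intro!: mult_nonpos_nonneg mult_nonneg_nonneg)
    moreover have "c * t\<^sup>2 \<le> c * (1 + \<bar>a\<bar> / (-c))" using t2 c by simp
    moreover have "c * (1 + \<bar>a\<bar> / (-c)) = c - \<bar>a\<bar>" using c by (simp add: field_simps)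
    ultimately show False using assms[of t] c abs_ge_self[of a] mult.assoc[of 2 b t] by linarith
  qed
  with False have "c > 0" by simp
  then show ?thesis using assms[of "- b / c"] by (simp add: field_simps power2_eq_square)
qed

section \<open>Positive semidefinite and positive definite forms\<close>

lemma pos_semidefD:
  assumes "pos_semidef n M"
  shows "M \<in> carrier_mat n n" "transpose_mat M = M" "dim_row M = n" "dim_col M = n"
    "x \<in> carrier_vec n \<Longrightarrow> 0 \<le> x \<bullet> (M *\<^sub>v x)"
  using assms by (auto simp: pos_semidef_def)

lemma pos_defD:
  assumes "pos_def n M"
  shows "M \<in> carrier_mat n n" "transpose_mat M = M" "dim_row M = n" "dim_col M = n"
    "x \<in> carrier_vec n \<Longrightarrow> x \<noteq> 0\<^sub>v n \<Longrightarrow> 0 < x \<bullet> (M *\<^sub>v x)"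
  using assms by (auto simp: pos_def_def)

lemma pos_def_imp_semidef: "pos_def n M \<Longrightarrow> pos_semidef n M"
  unfolding pos_def_def pos_semidef_def
  by (metis less_eq_real_def mult_mat_vec_carrier scalar_prod_left_zero)

lemma sp_sym:
  assumes "transpose_mat M = M" "dim_vec x = dim_row M" "dim_vec y = dim_row M"
  shows "x \<bullet> (M *\<^sub>v y) = y \<bullet> (M *\<^sub>v (x :: rvec))"
proof -
  have "dim_col M = dim_row M" using assms(1) by (metis index_transpose_mat(2))
  then show ?thesis using assms sp_transpose[of x M y] by (simp add: sp_comm)
qed

lemma psd_cauchy_schwarz:
  assumes M: "pos_semidef n M" and x: "x \<in> carrier_vec n" and y: "y \<in> carrier_vec n"
  shows "(x \<bullet> (M *\<^sub>v y))\<^sup>2 \<le> (x \<bullet> (M *\<^sub>v x)) * (y \<bullet> (M *\<^sub>v y))"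
proof (rule quadratic_nonneg_discriminant)
  fix t :: real
  note [simp] = pos_semidefD(3,4)[OF M] carrier_vecD[OF x] carrier_vecD[OF y]
  have "0 \<le> (x + t \<cdot>\<^sub>v y) \<bullet> (M *\<^sub>v (x + t \<cdot>\<^sub>v y))" using x y by (intro pos_semidefD(5)[OF M]) auto
  also have "\<dots> = x \<bullet> (M *\<^sub>v x) + 2 * (x \<bullet> (M *\<^sub>v y)) * t + y \<bullet> (M *\<^sub>v y) * t\<^sup>2"
    using sp_sym[OF pos_semidefD(2)[OF M], of x y]
    by (simp add: mv sp algebra_simps power2_eq_square)
  finally show "0 \<le> x \<bullet> (M *\<^sub>v x) + 2 * (x \<bullet> (M *\<^sub>v y)) * t + y \<bullet> (M *\<^sub>v y) * t\<^sup>2" .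
qed

lemma pos_semidef_one: "pos_semidef n (1\<^sub>m n)"
  by (auto simp: pos_semidef_def sp_self_nonneg)

lemma sp_cauchy_schwarz:
  assumes "dim_vec x = dim_vec y"
  shows "\<bar>x \<bullet> y\<bar> \<le> vnorm x * vnorm (y :: rvec)"
proof -
  have "(x \<bullet> (1\<^sub>m (dim_vec y) *\<^sub>v y))\<^sup>2 \<le> (x \<bullet> (1\<^sub>m (dim_vec y) *\<^sub>v x)) * (y \<bullet> (1\<^sub>m (dim_vec y) *\<^sub>v y))"
    using assms by (intro psd_cauchy_schwarz[OF pos_semidef_one]) (auto intro: carrier_vecI)
  then have "(x \<bullet> y)\<^sup>2 \<le> (vnorm x * vnorm y)\<^sup>2"
    using assms by (simp add: mv power_mult_distrib vnorm_power2)
  then show ?thesis by (simp add: power2_le_iff_abs_le)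
qed

lemma psd_cauchy_schwarz_bound:
  assumes M: "pos_semidef n M" and x: "x \<in> carrier_vec n" and y: "y \<in> carrier_vec n"
    and "x \<bullet> (M *\<^sub>v x) \<le> a\<^sup>2" "y \<bullet> (M *\<^sub>v y) \<le> b\<^sup>2" "0 \<le> a" "0 \<le> b"
  shows "\<bar>x \<bullet> (M *\<^sub>v y)\<bar> \<le> a * b"
proof -
  have "(x \<bullet> (M *\<^sub>v y))\<^sup>2 \<le> a\<^sup>2 * b\<^sup>2"
    using psd_cauchy_schwarz[OF M x y] assms pos_semidefD(5)[OF M]
    by (meson mult_mono order_trans zero_le_power2)
  then show ?thesis using assms(6,7) by (simp add: power2_le_iff_abs_le flip: power_mult_distrib)
qed

lemma vnorm_add_le:
  assumes "dim_vec x = dim_vec y"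
  shows "vnorm (x + y) \<le> vnorm x + vnorm (y :: rvec)"
proof (rule power2_le_imp_le)
  have "(vnorm (x + y))\<^sup>2 = x \<bullet> x + 2 * (x \<bullet> y) + y \<bullet> y"
    using assms sp_comm[of x y] by (simp add: vnorm_power2 sp)
  also have "\<dots> \<le> (vnorm x + vnorm y)\<^sup>2"
    using sp_cauchy_schwarz[OF assms] by (simp add: power2_sum vnorm_power2)
  finally show "(vnorm (x + y))\<^sup>2 \<le> (vnorm x + vnorm y)\<^sup>2" .
qed simp

text \<open>Absorbs one factor of the norm; the hypothesis has the shape in which a duality estimate
  of \<open>x \<bullet> x\<close> arrives.\<close>

lemma vnorm_le_of_sq:
  assumes "x \<bullet> x \<le> a * vnorm x" "0 \<le> a" shows "vnorm x \<le> a"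
proof (cases "vnorm x = 0")
  case False
  then have "0 < vnorm x" using vnorm_nonneg[of x] by linarith
  then show ?thesis using assms(1) unfolding vnorm_sq[symmetric] by simp
qed (use assms in simp)

section \<open>Inverses of positive definite matrices\<close>

text \<open>\<open>minv\<close> is a bare \<open>the\<close> of an optional result. A trivial kernel
  gives a nonzero determinant, hence a unit of the matrix ring, and this shows that the option is
  \<open>Some\<close>.\<close>

lemma minv_of_kernel:
  assumes M: "M \<in> carrier_mat n n" and ker: "\<And>x. x \<in> carrier_vec n \<Longrightarrow> M *\<^sub>v x = 0\<^sub>v n \<Longrightarrow> x = 0\<^sub>v n"
  shows "minv M \<in> carrier_mat n n" "M * minv M = 1\<^sub>m n" "minv M * M = 1\<^sub>m n"
proof -
  have "Determinant.det M \<noteq> 0" using det_0_iff_vec_prod_zero_field[OF M] ker by blast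
  then have "M \<in> Units (ring_mat TYPE(real) n undefined)" by (rule det_non_zero_imp_unit[OF M])
  then obtain N where N: "mat_inverse M = Some N"
    using mat_inverse(1)[OF M, where b = undefined] by (cases "mat_inverse M") auto
  from mat_inverse(2)[OF M N] show "minv M \<in> carrier_mat n n" "M * minv M = 1\<^sub>m n" "minv M * M = 1\<^sub>m n"
    by (auto simp: minv_def N)
qed

lemma pos_def_kernel:
  assumes "pos_def n M" "x \<in> carrier_vec n" "M *\<^sub>v x = 0\<^sub>v n" shows "x = 0\<^sub>v n"
  using pos_defD(5)[OF assms(1,2)] assms(2,3) by (cases "x = 0\<^sub>v n") (auto simp: sp)

lemma pos_def_minv:
  assumes "pos_def n M"
  shows "minv M \<in> carrier_mat n n" "M * minv M = 1\<^sub>m n" "minv M * M = 1\<^sub>m n"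
  using minv_of_kernel[OF pos_defD(1)[OF assms] pos_def_kernel[OF assms]] by auto

lemma mv_minv:
  assumes "pos_def n M" "dim_vec x = n"
  shows "M *\<^sub>v (minv M *\<^sub>v x) = x" "minv M *\<^sub>v (M *\<^sub>v x) = x"
proof -
  note I = pos_def_minv[OF assms(1)]
  have d: "dim_row M = n" "dim_col M = n" "dim_row (minv M) = n" "dim_col (minv M) = n"
    using pos_defD(1)[OF assms(1)] I(1) by auto
  show "M *\<^sub>v (minv M *\<^sub>v x) = x" using assms(2) d I by (metis mv_mult mv_one)
  show "minv M *\<^sub>v (M *\<^sub>v x) = x" using assms(2) d I by (metis mv_mult mv_one)
qed

lemma inverse_sym:
  assumes M: "(M :: rmat) \<in> carrier_mat n n" and N: "N \<in> carrier_mat n n" and S: "transpose_mat M = M"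
    and I: "M * N = 1\<^sub>m n" "N * M = 1\<^sub>m n"
  shows "transpose_mat N = N"
proof -
  have "transpose_mat N = transpose_mat N * (M * N)" unfolding I(1) using right_mult_one_mat[of "transpose_mat N" n n] N by simp
  also have "\<dots> = transpose_mat N * transpose_mat M * N" using M N S
    by (simp add: assoc_mult_mat[of _ n n _ n _ n])
  also have "transpose_mat N * transpose_mat M = transpose_mat (M * N)" 
    using transpose_mult[OF M N] by simp
  finally show ?thesis using N I by simp
qed

lemma pos_def_minv_pos_def:
  assumes M: "pos_def n M" shows "pos_def n (minv M)"
proof -
  note I = pos_def_minv[OF M]
  show ?thesis unfolding pos_def_def
  proof (intro conjI ballI impI)
    show "transpose_mat (minv M) = minv M" by (rule inverse_sym[OF pos_defD(1)[OF M] I(1) pos_defD(2)[OF M] I(2,3)])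
    fix x :: rvec assume x: "x \<in> carrier_vec n" "x \<noteq> 0\<^sub>v n"
    define y where "y = minv M *\<^sub>v x"
    have y: "y \<in> carrier_vec n" "M *\<^sub>v y = x" using I(1) x mv_minv[OF M, of x] by (auto simp: y_def)
    have "y \<noteq> 0\<^sub>v n" using y(2) x mv_vzero[of M n] pos_defD(3,4)[OF M] by auto
    then have "0 < y \<bullet> (M *\<^sub>v y)" using pos_defD(5)[OF M y(1)] by simp
    then have "0 < x \<bullet> y" unfolding y(2) using x y(1) by (simp add: sp_comm)
    then show "0 < x \<bullet> (minv M *\<^sub>v x)" unfolding y_def .
  qed (fact I(1))
qed

text \<open>Transports positive definiteness to the modified matrices: the splitting matrix,
  \<open>D + K\<close>, the posterior precision and the corrected noise covariance are each
  symmetric and bounded below by a positive definite matrix.\<close>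

lemma pos_def_ge:
  assumes A: "pos_def n A" and M: "M \<in> carrier_mat n n" "transpose_mat M = M"
    and ge: "\<And>x. x \<in> carrier_vec n \<Longrightarrow> x \<bullet> (A *\<^sub>v x) \<le> x \<bullet> (M *\<^sub>v x)"
  shows "pos_def n M"
  using assms pos_defD(5)[OF A] unfolding pos_def_def by (auto intro: less_le_trans)

section \<open>The operator norm\<close>

text \<open>The constant is the Frobenius norm. Its purpose is finiteness: the supremum defining
  \<open>mnorm\<close> is then one over a bounded set.\<close>

lemma mat_vnorm_bound:
  fixes M :: rmat
  shows "\<exists>K\<ge>0. \<forall>x. dim_vec x = dim_col M \<longrightarrow> vnorm (M *\<^sub>v x) \<le> K * vnorm x"
proof (intro exI conjI allI impI)
  let ?K = "sqrt (\<Sum>i<dim_row M. (vnorm (row M i))\<^sup>2)"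
  show "0 \<le> ?K" by (simp add: sum_nonneg)
  fix x :: rvec assume x: "dim_vec x = dim_col M"
  have "(vnorm (M *\<^sub>v x))\<^sup>2 = (\<Sum>i<dim_row M. (row M i \<bullet> x)\<^sup>2)"
    unfolding vnorm_power2 scalar_prod_def[of "M *\<^sub>v x"] by (simp add: power2_eq_square atLeast0LessThan)
  also have "\<dots> \<le> (\<Sum>i<dim_row M. (vnorm (row M i) * vnorm x)\<^sup>2)"
    by (intro sum_mono) (use sp_cauchy_schwarz[of "row M _" x] x in \<open>simp add: power2_le_iff_abs_le\<close>)
  also have "\<dots> = (?K * vnorm x)\<^sup>2"
    by (simp add: power_mult_distrib sum_nonneg sum_distrib_right)
  finally show "vnorm (M *\<^sub>v x) \<le> ?K * vnorm x"
    by (rule power2_le_imp_le) (simp add: sum_nonneg)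
qed

lemma mnorm_bdd: "bdd_above {vnorm (M *\<^sub>v x) | x. x \<in> carrier_vec (dim_col M) \<and> vnorm x \<le> 1}"
proof -
  obtain K where K: "K \<ge> 0" "\<And>x. dim_vec x = dim_col M \<Longrightarrow> vnorm (M *\<^sub>v x) \<le> K * vnorm x"
    using mat_vnorm_bound[of M] by blast
  have "vnorm (M *\<^sub>v x) \<le> K" if "x \<in> carrier_vec (dim_col M)" "vnorm x \<le> 1" for x
    using K(2)[of x] mult_left_le[OF that(2) K(1)] that by auto
  then show ?thesis by (intro bdd_aboveI[of _ K]) auto
qed

lemma mnorm_nonneg: "0 \<le> mnorm M"
proof -
  have "vnorm (M *\<^sub>v 0\<^sub>v (dim_col M)) \<le> mnorm M"
    unfolding mnorm_def by (rule cSup_upper[OF _ mnorm_bdd]) (auto intro!: exI[of _ "0\<^sub>v (dim_col M)"] simp: vnorm_def)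
  then show ?thesis using vnorm_nonneg order_trans by blast
qed

lemma vnorm_mult_le: 
  assumes "dim_vec x = dim_col M" shows "vnorm (M *\<^sub>v x) \<le> mnorm M * vnorm x"
proof (cases "vnorm x = 0")
  case True
  then have "x = 0\<^sub>v (dim_col M)" using vnorm_eq_0[of x "dim_col M"] assms by (auto intro: carrier_vecI)
  then show ?thesis by (simp add: mv vnorm_def)
next
  case False
  then have p: "0 < vnorm x" using vnorm_nonneg[of x] by linarith
  let ?y = "(1 / vnorm x) \<cdot>\<^sub>v x"
  have "vnorm (M *\<^sub>v ?y) \<le> mnorm M"
    unfolding mnorm_def using p assms
    by (intro cSup_upper[OF _ mnorm_bdd]) (auto intro!: exI[of _ ?y] carrier_vecI simp: vnorm_smult)
  then show ?thesis using p assms by (simp add: mv vnorm_smult field_simps)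
qed

lemma mnorm_le:
  assumes "\<And>x. x \<in> carrier_vec (dim_col M) \<Longrightarrow> vnorm (M *\<^sub>v x) \<le> K * vnorm x" "0 \<le> K"
  shows "mnorm M \<le> K"
  unfolding mnorm_def
proof (rule cSup_least)
  show "{vnorm (M *\<^sub>v x) |x. x \<in> carrier_vec (dim_col M) \<and> vnorm x \<le> 1} \<noteq> {}"
    by (auto intro!: exI[of _ "0\<^sub>v (dim_col M)"] simp: vnorm_def)
  fix y assume "y \<in> {vnorm (M *\<^sub>v x) |x. x \<in> carrier_vec (dim_col M) \<and> vnorm x \<le> 1}"
  then obtain x where x: "x \<in> carrier_vec (dim_col M)" "vnorm x \<le> 1" "y = vnorm (M *\<^sub>v x)" by blast
  show "y \<le> K" using assms(1)[OF x(1)] mult_left_le[OF x(2) assms(2)] x(3) by linarith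
qed

text \<open>Cauchy-Schwarz in the form of \<open>M\<close>, applied to \<open>M x\<close> and
  \<open>x\<close>, replaces diagonalisation: for a semidefinite matrix a bound on the quadratic
  form is already a bound on the operator norm.\<close>

lemma psd_vnorm_le:
  assumes M: "pos_semidef n M" and le: "\<And>x. x \<in> carrier_vec n \<Longrightarrow> x \<bullet> (M *\<^sub>v x) \<le> d * (x \<bullet> x)"
    and "0 \<le> d" and x: "x \<in> carrier_vec n"
  shows "vnorm (M *\<^sub>v x) \<le> d * vnorm x"
proof (rule vnorm_le_of_sq)
  let ?y = "M *\<^sub>v x"
  have y: "?y \<in> carrier_vec n" using pos_semidefD(1)[OF M] x by auto
  have *: "\<bar>?y \<bullet> (M *\<^sub>v x)\<bar> \<le> (sqrt d * vnorm ?y) * (sqrt d * vnorm x)"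
    using assms le[OF y] le[OF x] y
    by (intro psd_cauchy_schwarz_bound[OF M y x]) (auto simp: power_mult_distrib vnorm_power2)
  show "?y \<bullet> ?y \<le> d * vnorm x * vnorm ?y"
  proof -
    have "sqrt d * vnorm ?y * (sqrt d * vnorm x) = (sqrt d * sqrt d) * vnorm x * vnorm ?y" by (simp only: mult_ac)
    also have "\<dots> = d * vnorm x * vnorm ?y" using \<open>0 \<le> d\<close> by simp
    finally show ?thesis using * by linarith
  qed
qed (use assms in simp)

lemma psd_mnorm_le:
  assumes "pos_semidef n M" "\<And>x. x \<in> carrier_vec n \<Longrightarrow> x \<bullet> (M *\<^sub>v x) \<le> d * (x \<bullet> x)" "0 \<le> d"
  shows "mnorm M \<le> d"
  by (rule mnorm_le) (use psd_vnorm_le[OF assms] pos_semidefD(4)[OF assms(1)] assms(3) in auto)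

lemma form_le_mnorm:
  assumes M: "M \<in> carrier_mat n n" and x: "x \<in> carrier_vec n"
  shows "x \<bullet> (M *\<^sub>v x) \<le> mnorm M * (x \<bullet> x)"
proof -
  have "x \<bullet> (M *\<^sub>v x) \<le> vnorm x * vnorm (M *\<^sub>v x)"
    using sp_cauchy_schwarz[of x "M *\<^sub>v x"] M x by auto
  also have "\<dots> \<le> vnorm x * (mnorm M * vnorm x)"
    using M x by (intro mult_left_mono vnorm_mult_le) auto
  finally show ?thesis by (simp add: algebra_simps flip: vnorm_sq)
qed

section \<open>Square roots of positive definite matrices\<close>

text \<open>A bound with a named constant rather than \<open>mnorm\<close>, so that bounds for
  products and differences of the iterates compose without handling suprema.\<close>

definition op_bound :: "nat \<Rightarrow> real \<Rightarrow> rmat \<Rightarrow> bool" where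
  "op_bound n K M \<longleftrightarrow> (\<forall>x\<in>carrier_vec n. vnorm (M *\<^sub>v x) \<le> K * vnorm x)"

lemma vnorm_zero [simp]: "vnorm (0\<^sub>v n) = 0"
  by (simp add: vnorm_def)

lemma transpose_smult: "transpose_mat (c \<cdot>\<^sub>m A) = c \<cdot>\<^sub>m transpose_mat A"
  by (rule eq_matI) auto

lemma smult_smult_assoc_mat: "(a :: real) \<cdot>\<^sub>m (b \<cdot>\<^sub>m A) = (a * b) \<cdot>\<^sub>m A"
  by (rule eq_matI) auto

lemma abs_index_le_vnorm: "i < dim_vec v \<Longrightarrow> \<bar>vec_index v i\<bar> \<le> vnorm v"
proof -
  assume i: "i < dim_vec v"
  have "(vec_index v i)\<^sup>2 \<le> v \<bullet> v"
    unfolding scalar_prod_def power2_eq_square by (rule member_le_sum) (use i in auto)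
  then show ?thesis unfolding vnorm_def by (simp add: real_le_rsqrt)
qed

text \<open>Turns operator estimates into entrywise ones, since the limit of the iterates is taken
  entry by entry.\<close>

lemma op_bound_entry:
  assumes M: "M \<in> carrier_mat n n" and b: "op_bound n K M" and ij: "i < n" "j < n"
  shows "\<bar>M $$ (i, j)\<bar> \<le> K"
proof -
  have "M $$ (i, j) = vec_index (M *\<^sub>v unit_vec n j) i" using M ij by simp
  also have "\<bar>\<dots>\<bar> \<le> vnorm (M *\<^sub>v unit_vec n j)" using M ij by (intro abs_index_le_vnorm) auto
  also have "\<dots> \<le> K * vnorm (unit_vec n j)" using b by (auto simp: op_bound_def)
  also have "vnorm (unit_vec n j :: rvec) = 1" using ij by (simp add: vnorm_def)
  finally show ?thesis by simp
qed

text \<open>The square root of \<open>1 - Z\<close> is \<open>1 - Y\<close>, where \<open>Y\<close> is the fixed point of \<open>Y \<mapsto> (Z + Y\<^sup>2) / 2\<close>. If \<open>Z\<close> has norm at most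
  \<open>q < 1\<close>, all iterates stay below the scalar fixed point \<open>t < 1\<close>, on which ball the map contracts by \<open>t\<close>.\<close>

context
  fixes n :: nat and Z :: rmat and q t :: real
  assumes Z: "pos_semidef n Z" and Zq: "\<And>x. x \<in> carrier_vec n \<Longrightarrow> x \<bullet> (Z *\<^sub>v x) \<le> q * (x \<bullet> x)"
    and t: "0 \<le> t" "t < 1" "q + t * t = 2 * t" and q0: "0 \<le> q"
begin

primrec sqrt_iter :: "nat \<Rightarrow> rmat" where
  "sqrt_iter 0 = 0\<^sub>m n n"
| "sqrt_iter (Suc k) = (1/2) \<cdot>\<^sub>m (Z + sqrt_iter k * sqrt_iter k)"

lemma sqrt_iter_carrier: "sqrt_iter k \<in> carrier_mat n n"
  using pos_semidefD(1)[OF Z] by (induction k) auto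

lemma sqrt_iter_sym: "transpose_mat (sqrt_iter k) = sqrt_iter k"
proof (induction k)
  case (Suc k)
  have "transpose_mat (Z + sqrt_iter k * sqrt_iter k) = Z + sqrt_iter k * sqrt_iter k"
    using sqrt_iter_carrier[of k] pos_semidefD(1,2)[OF Z] Suc
    by (simp add: transpose_add[of _ n n] transpose_mult[of _ n n _ n])
  then show ?case by (simp add: transpose_smult)
qed auto

lemma sqrt_iter_mv: "x \<in> carrier_vec n \<Longrightarrow>
    sqrt_iter (Suc k) *\<^sub>v x = (1/2) \<cdot>\<^sub>v (Z *\<^sub>v x + sqrt_iter k *\<^sub>v (sqrt_iter k *\<^sub>v x))"
proof -
  assume x: "x \<in> carrier_vec n"
  have "sqrt_iter (Suc k) *\<^sub>v x = (1/2) \<cdot>\<^sub>v ((Z + sqrt_iter k * sqrt_iter k) *\<^sub>v x)"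
    using x sqrt_iter_carrier[of k] pos_semidefD(1)[OF Z] by (auto intro!: eq_vecI)
  then show ?thesis using x sqrt_iter_carrier[of k] pos_semidefD(1)[OF Z] by (simp add: mv)
qed

lemma Z_bound: "x \<in> carrier_vec n \<Longrightarrow> vnorm (Z *\<^sub>v x) \<le> q * vnorm x"
  by (rule psd_vnorm_le[OF Z Zq q0])

text \<open>Invariance of the ball of radius \<open>t\<close>: one step yields at most
  \<open>(q + t * t) / 2\<close>, which is \<open>t\<close> by the choice of
  \<open>t\<close>.\<close>

lemma sqrt_iter_bound: "op_bound n t (sqrt_iter k)"
proof (induction k)
  case 0
  then show ?case using t by (auto simp: op_bound_def mv)
next
  case (Suc k)
  show ?case unfolding op_bound_def
  proof
    fix x :: rvec assume x: "x \<in> carrier_vec n"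
    have Yx: "sqrt_iter k *\<^sub>v x \<in> carrier_vec n" using sqrt_iter_carrier[of k] x by auto
    have "vnorm (sqrt_iter k *\<^sub>v (sqrt_iter k *\<^sub>v x)) \<le> t * (t * vnorm x)"
      using Suc x Yx t(1) unfolding op_bound_def by (meson mult_left_mono order_trans)
    moreover have "vnorm (Z *\<^sub>v x + sqrt_iter k *\<^sub>v (sqrt_iter k *\<^sub>v x)) \<le>
        vnorm (Z *\<^sub>v x) + vnorm (sqrt_iter k *\<^sub>v (sqrt_iter k *\<^sub>v x))"
      using pos_semidefD(1)[OF Z] sqrt_iter_carrier[of k] by (intro vnorm_add_le) auto
    ultimately have "vnorm (sqrt_iter (Suc k) *\<^sub>v x) \<le> (1/2) * (q * vnorm x + t * (t * vnorm x))"
      using Z_bound[OF x] unfolding sqrt_iter_mv[OF x] by (simp add: vnorm_smult)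
    also have "\<dots> = (1/2) * (q + t * t) * vnorm x" by (simp add: algebra_simps)
    finally show "vnorm (sqrt_iter (Suc k) *\<^sub>v x) \<le> t * vnorm x" unfolding t(3) by simp
  qed
qed

text \<open>With \<open>D = Y' - Y\<close> the squares differ by \<open>Y' D + D Y\<close>, an
  identity that holds without commutation. \<open>Y\<close> and \<open>Y'\<close> are bounded by
  \<open>t\<close>, and the factor 1/2 of the iteration leaves the rate \<open>t\<close>.\<close>

lemma sqrt_iter_diff: "op_bound n (t ^ k) (sqrt_iter (Suc k) - sqrt_iter k)"
proof (induction k)
  case 0
  \<comment> \<open>From \<open>q = 2 * t - t * t\<close>; it bounds the first increment
    \<open>Z / 2\<close> by \<open>1 = t ^ 0\<close>.\<close>
  have "q \<le> 2" using t by (smt (verit) mult_nonneg_nonneg)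
  then have 2: "q * vnorm x \<le> 2 * vnorm x" for x by (simp add: mult_right_mono)
  show ?case unfolding op_bound_def
  proof
    fix x :: rvec assume x: "x \<in> carrier_vec n"
    have "(sqrt_iter (Suc 0) - sqrt_iter 0) *\<^sub>v x = (1/2) \<cdot>\<^sub>v (Z *\<^sub>v x)"
      using x pos_semidefD(3,4)[OF Z] by (intro eq_vecI) (auto simp: scalar_prod_def sum_divide_distrib)
    then show "vnorm ((sqrt_iter (Suc 0) - sqrt_iter 0) *\<^sub>v x) \<le> t ^ 0 * vnorm x"
      using Z_bound[OF x] 2[of x] by (simp add: vnorm_smult del: sqrt_iter.simps)
  qed
next
  case (Suc k)
  let ?Y = "sqrt_iter k" and ?Y1 = "sqrt_iter (Suc k)"
  have c [simp]: "?Y \<in> carrier_mat n n" "?Y1 \<in> carrier_mat n n" "Z \<in> carrier_mat n n" "sqrt_iter (Suc (Suc k)) \<in> carrier_mat n n"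
    using sqrt_iter_carrier pos_semidefD(1)[OF Z] by blast+
  note d [simp] = c[THEN carrier_matD(1)] c[THEN carrier_matD(2)]
  show ?case unfolding op_bound_def
  proof
    fix x :: rvec assume x: "x \<in> carrier_vec n"
    note [simp] = carrier_vecD[OF x]
    let ?D = "?Y1 - ?Y"
    have D: "?D *\<^sub>v x \<in> carrier_vec n" "?Y *\<^sub>v x \<in> carrier_vec n" using d x by (auto intro!: carrier_vecI simp del: sqrt_iter.simps)
    have "(sqrt_iter (Suc (Suc k)) - ?Y1) *\<^sub>v x = sqrt_iter (Suc (Suc k)) *\<^sub>v x - ?Y1 *\<^sub>v x"
      by (simp add: mv del: sqrt_iter.simps)
    also have "\<dots> = (1/2) \<cdot>\<^sub>v (Z *\<^sub>v x + ?Y1 *\<^sub>v (?Y1 *\<^sub>v x)) - (1/2) \<cdot>\<^sub>v (Z *\<^sub>v x + ?Y *\<^sub>v (?Y *\<^sub>v x))"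
      unfolding sqrt_iter_mv[OF x] by (rule refl)
    also have "\<dots> = (1/2) \<cdot>\<^sub>v (?Y1 *\<^sub>v (?D *\<^sub>v x) + ?D *\<^sub>v (?Y *\<^sub>v x))"
      by (rule eq_vecI) (simp_all add: mv field_simps del: sqrt_iter.simps index_mult_mat_vec)
    finally have e: "(sqrt_iter (Suc (Suc k)) - ?Y1) *\<^sub>v x = (1/2) \<cdot>\<^sub>v (?Y1 *\<^sub>v (?D *\<^sub>v x) + ?D *\<^sub>v (?Y *\<^sub>v x))" .
    have 1: "vnorm (?Y1 *\<^sub>v (?D *\<^sub>v x)) \<le> t * (t ^ k * vnorm x)"
      using Suc x D t(1) sqrt_iter_bound[of "Suc k"] unfolding op_bound_def by (meson mult_left_mono order_trans)
    have 2: "vnorm (?D *\<^sub>v (?Y *\<^sub>v x)) \<le> t ^ k * (t * vnorm x)"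
      using Suc x D t(1) sqrt_iter_bound[of k] unfolding op_bound_def by (meson mult_left_mono order_trans zero_le_power)
    have "vnorm (?Y1 *\<^sub>v (?D *\<^sub>v x) + ?D *\<^sub>v (?Y *\<^sub>v x)) \<le> vnorm (?Y1 *\<^sub>v (?D *\<^sub>v x)) + vnorm (?D *\<^sub>v (?Y *\<^sub>v x))"
      by (rule vnorm_add_le) (simp del: sqrt_iter.simps)
    with 1 2 show "vnorm ((sqrt_iter (Suc (Suc k)) - ?Y1) *\<^sub>v x) \<le> t ^ Suc k * vnorm x"
      unfolding e vnorm_smult power_Suc by (simp only: mult_ac abs_divide)
  qed
qed

definition sqrt_lim :: rmat where
  "sqrt_lim = Matrix.mat n n (\<lambda>(i, j). lim (\<lambda>k. sqrt_iter k $$ (i, j)))"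

lemma sqrt_lim_carrier: "sqrt_lim \<in> carrier_mat n n"
  by (simp add: sqrt_lim_def)

lemma sqrt_lim_entry:
  assumes ij: "i < n" "j < n"
  shows "(\<lambda>k. sqrt_iter k $$ (i, j)) \<longlonglongrightarrow> sqrt_lim $$ (i, j)"
proof -
  let ?y = "\<lambda>k. sqrt_iter k $$ (i, j)"
  have b: "norm (?y (Suc k) - ?y k) \<le> t ^ k" for k
    using op_bound_entry[OF _ sqrt_iter_diff[of k] ij] sqrt_iter_carrier[of k] sqrt_iter_carrier[of "Suc k"] ij
    by (simp add: minus_carrier_mat del: sqrt_iter.simps)
  have "summable (\<lambda>k. ?y (Suc k) - ?y k)"
    by (rule summable_comparison_test'[of "\<lambda>k. t ^ k" 0]) (use b t in \<open>auto simp: summable_geometric\<close>)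
  then have "(\<lambda>m. \<Sum>k<m. ?y (Suc k) - ?y k) \<longlonglongrightarrow> (\<Sum>k. ?y (Suc k) - ?y k)" by (rule summable_LIMSEQ)
  then have "(\<lambda>m. (?y m - ?y 0) + ?y 0) \<longlonglongrightarrow> (\<Sum>k. ?y (Suc k) - ?y k) + ?y 0"
    unfolding sum_lessThan_telescope[of ?y] by (intro tendsto_add tendsto_const)
  then have "convergent ?y" by (auto simp: convergent_def simp del: sqrt_iter.simps)
  then show ?thesis using ij by (simp add: sqrt_lim_def convergent_LIMSEQ_iff)
qed

lemma sqrt_lim_form:
  assumes "x \<in> carrier_vec n" "y \<in> carrier_vec n"
  shows "(\<lambda>k. x \<bullet> (sqrt_iter k *\<^sub>v y)) \<longlonglongrightarrow> x \<bullet> (sqrt_lim *\<^sub>v y)"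
proof -
  have e: "x \<bullet> (M *\<^sub>v y) = (\<Sum>i<n. vec_index x i * (\<Sum>j<n. M $$ (i, j) * vec_index y j))"
    if "M \<in> carrier_mat n n" for M
    using that assms by (auto simp: scalar_prod_def atLeast0LessThan)
  show ?thesis unfolding e[OF sqrt_iter_carrier] e[OF sqrt_lim_carrier]
    by (intro tendsto_sum tendsto_mult tendsto_const sqrt_lim_entry) auto
qed

lemma sqrt_lim_fixed: "2 \<cdot>\<^sub>m sqrt_lim = Z + sqrt_lim * sqrt_lim"
proof (rule eq_matI)
  fix i j assume "i < dim_row (Z + sqrt_lim * sqrt_lim)" "j < dim_col (Z + sqrt_lim * sqrt_lim)"
  then have ij: "i < n" "j < n" by (auto simp: sqrt_lim_def)
  have e: "(M * M) $$ (i, j) = (\<Sum>k<n. M $$ (i, k) * M $$ (k, j))" if "M \<in> carrier_mat n n" for M :: rmat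
    using that ij by (auto simp: scalar_prod_def atLeast0LessThan)
  have "(\<lambda>k. (sqrt_iter k * sqrt_iter k) $$ (i, j)) \<longlonglongrightarrow> (sqrt_lim * sqrt_lim) $$ (i, j)"
    unfolding e[OF sqrt_iter_carrier] e[OF sqrt_lim_carrier]
    by (intro tendsto_sum tendsto_mult tendsto_const sqrt_lim_entry ij) auto
  then have lim: "(\<lambda>k. (1/2) * (Z $$ (i, j) + (sqrt_iter k * sqrt_iter k) $$ (i, j))) \<longlonglongrightarrow>
      (1/2) * (Z $$ (i, j) + (sqrt_lim * sqrt_lim) $$ (i, j))" by (intro tendsto_intros)
  have step: "sqrt_iter (Suc k) $$ (i, j) = (1/2) * (Z $$ (i, j) + (sqrt_iter k * sqrt_iter k) $$ (i, j))" for k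
    using ij sqrt_iter_carrier[of k] pos_semidefD(1)[OF Z] by simp
  have "(\<lambda>k. sqrt_iter (Suc k) $$ (i, j)) \<longlonglongrightarrow> sqrt_lim $$ (i, j)"
    by (rule LIMSEQ_Suc[OF sqrt_lim_entry[OF ij]])
  then have "sqrt_lim $$ (i, j) = (1/2) * (Z $$ (i, j) + (sqrt_lim * sqrt_lim) $$ (i, j))"
    unfolding step by (rule LIMSEQ_unique[OF _ lim])
  then show "(2 \<cdot>\<^sub>m sqrt_lim) $$ (i, j) = (Z + sqrt_lim * sqrt_lim) $$ (i, j)"
    using ij sqrt_lim_carrier pos_semidefD(1)[OF Z] by simp
qed (use sqrt_lim_carrier pos_semidefD(1)[OF Z] in auto)

text \<open>\<open>(1 - Y)\<^sup>2 = 1 - 2 Y + Y\<^sup>2\<close> equals \<open>1 - Z\<close> by the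
  fixed point equation. Nonnegativity of \<open>1 - Y\<close> comes from \<open>t < 1\<close>,
  passed to the limit in the quadratic form.\<close>

lemma sqrt_one_minus: "\<exists>R. pos_semidef n R \<and> R * R = 1\<^sub>m n - Z"
proof (intro exI[of _ "1\<^sub>m n - sqrt_lim"] conjI)
  note c [simp] = sqrt_lim_carrier[THEN carrier_matD(1)] sqrt_lim_carrier[THEN carrier_matD(2)]
    pos_semidefD(3,4)[OF Z]
  show "pos_semidef n (1\<^sub>m n - sqrt_lim)" unfolding pos_semidef_def
  proof (intro conjI ballI)
    show "1\<^sub>m n - sqrt_lim \<in> carrier_mat n n" by (simp add: carrier_matI)
    have "sqrt_lim $$ (i, j) = sqrt_lim $$ (j, i)" if ij: "i < n" "j < n" for i j
    proof (rule LIMSEQ_unique[OF sqrt_lim_entry[OF ij]])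
      have "sqrt_iter k $$ (j, i) = sqrt_iter k $$ (i, j)" for k
        using sqrt_iter_sym[of k] sqrt_iter_carrier[of k] ij by (metis carrier_matD index_transpose_mat(1))
      then show "(\<lambda>k. sqrt_iter k $$ (i, j)) \<longlonglongrightarrow> sqrt_lim $$ (j, i)"
        using sqrt_lim_entry[OF ij(2,1)] by simp
    qed
    then show "transpose_mat (1\<^sub>m n - sqrt_lim) = 1\<^sub>m n - sqrt_lim" by (intro eq_matI) auto
    fix x :: rvec assume x: "x \<in> carrier_vec n"
    have "x \<bullet> (sqrt_lim *\<^sub>v x) \<le> x \<bullet> x"
    proof (rule LIMSEQ_le_const2[OF sqrt_lim_form[OF x x]], intro exI allI impI)
      fix k
      have d: "dim_vec x = dim_vec (sqrt_iter k *\<^sub>v x)" using x sqrt_iter_carrier[of k] by auto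
      have "x \<bullet> (sqrt_iter k *\<^sub>v x) \<le> vnorm x * vnorm (sqrt_iter k *\<^sub>v x)"
        using sp_cauchy_schwarz[OF d] by linarith
      also have "\<dots> \<le> vnorm x * (t * vnorm x)"
        using sqrt_iter_bound[of k] x by (auto simp: op_bound_def intro!: mult_left_mono)
      also have "\<dots> \<le> vnorm x * (1 * vnorm x)" using t by (intro mult_left_mono mult_right_mono) auto
      finally show "x \<bullet> (sqrt_iter k *\<^sub>v x) \<le> x \<bullet> x" by (simp add: vnorm_sq)
    qed
    then show "0 \<le> x \<bullet> ((1\<^sub>m n - sqrt_lim) *\<^sub>v x)" using x by (simp add: mv sp)
  qed
  show "(1\<^sub>m n - sqrt_lim) * (1\<^sub>m n - sqrt_lim) = 1\<^sub>m n - Z"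
  proof (rule mat_eq_mv[of _ n n])
    fix x :: rvec assume x: "x \<in> carrier_vec n"
    note [simp] = carrier_vecD[OF x]
    have "(2 \<cdot>\<^sub>m sqrt_lim) *\<^sub>v x = 2 \<cdot>\<^sub>v (sqrt_lim *\<^sub>v x)" using x by (auto intro!: eq_vecI)
    then have "Z *\<^sub>v x + sqrt_lim *\<^sub>v (sqrt_lim *\<^sub>v x) = 2 \<cdot>\<^sub>v (sqrt_lim *\<^sub>v x)"
      unfolding sqrt_lim_fixed using x by (simp add: mv)
    then have "vec_index (Z *\<^sub>v x + sqrt_lim *\<^sub>v (sqrt_lim *\<^sub>v x)) i = vec_index (2 \<cdot>\<^sub>v (sqrt_lim *\<^sub>v x)) i" for i by simp
    then have "i < n \<Longrightarrow> vec_index (Z *\<^sub>v x) i + vec_index (sqrt_lim *\<^sub>v (sqrt_lim *\<^sub>v x)) i = 2 * vec_index (sqrt_lim *\<^sub>v x) i" for i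
      by (metis c(1) c(3) dim_mult_mat_vec index_add_vec(1) index_smult_vec(1))
    note e = this
    show "((1\<^sub>m n - sqrt_lim) * (1\<^sub>m n - sqrt_lim)) *\<^sub>v x = (1\<^sub>m n - Z) *\<^sub>v x"
    proof (rule eq_vecI)
      fix i assume "i < dim_vec ((1\<^sub>m n - Z) *\<^sub>v x)"
      then have i: "i < n" by simp
      show "vec_index (((1\<^sub>m n - sqrt_lim) * (1\<^sub>m n - sqrt_lim)) *\<^sub>v x) i = vec_index ((1\<^sub>m n - Z) *\<^sub>v x) i"
        using e[OF i] i by (simp add: mv del: index_mult_mat_vec)
    qed simp
  qed (auto intro!: carrier_matI)
qed

end

text \<open>A lower bound for the spectrum without spectral theory: with \<open>y = X x\<close>,
  Cauchy-Schwarz in the form of the inverse bounds \<open>(x \<bullet> x)\<^sup>2\<close> by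
  \<open>(x \<bullet> minv X x) * (y \<bullet> x)\<close>, and one factor
  \<open>x \<bullet> x\<close> cancels.\<close>

lemma pos_def_coercive:
  assumes X: "pos_def n X" and x: "x \<in> carrier_vec n"
  shows "x \<bullet> x \<le> mnorm (minv X) * (x \<bullet> (X *\<^sub>v x))"
proof -
  note I = pos_def_minv[OF X] and N = pos_def_imp_semidef[OF pos_def_minv_pos_def[OF X]]
  let ?y = "X *\<^sub>v x"
  have y: "?y \<in> carrier_vec n" using x pos_defD(1)[OF X] by auto
  have yx: "minv X *\<^sub>v ?y = x" using mv_minv(2)[OF X] x by auto
  have "vnorm (minv X *\<^sub>v ?y) * vnorm (minv X *\<^sub>v ?y) \<le> mnorm (minv X) * (?y \<bullet> (minv X *\<^sub>v ?y))"
  proof -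
    let ?z = "minv X *\<^sub>v ?y"
    have z: "?z \<in> carrier_vec n" using yx x by simp
    have "(?z \<bullet> (minv X *\<^sub>v ?y))\<^sup>2 \<le> (?z \<bullet> (minv X *\<^sub>v ?z)) * (?y \<bullet> (minv X *\<^sub>v ?y))"
      by (rule psd_cauchy_schwarz[OF N z y])
    also have "\<dots> \<le> (mnorm (minv X) * (?z \<bullet> ?z)) * (?y \<bullet> (minv X *\<^sub>v ?y))"
      by (rule mult_right_mono[OF form_le_mnorm[OF I(1) z]]) (rule pos_semidefD(5)[OF N y])
    finally have le: "(?z \<bullet> ?z) * (?z \<bullet> ?z) \<le> (?z \<bullet> ?z) * (mnorm (minv X) * (?y \<bullet> (minv X *\<^sub>v ?y)))"
      by (simp add: power2_eq_square algebra_simps)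
    have p: "0 \<le> mnorm (minv X) * (?y \<bullet> (minv X *\<^sub>v ?y))"
      using pos_semidefD(5)[OF N y] mnorm_nonneg by simp
    show ?thesis unfolding vnorm_sq
    proof (cases "?z \<bullet> ?z = 0")
      case False
      then have "0 < ?z \<bullet> ?z" using sp_self_nonneg[of ?z] by linarith
      with le show "?z \<bullet> ?z \<le> mnorm (minv X) * (?y \<bullet> (minv X *\<^sub>v ?y))"
        by (simp only: mult_le_cancel_left_pos)
    qed (use p in linarith)
  qed
  moreover have "?y \<bullet> x = x \<bullet> ?y" using x carrier_vecD[OF y] by (intro sp_comm) auto
  ultimately show ?thesis unfolding yx vnorm_sq by simp
qed

text \<open>Division by \<open>c\<close>, which exceeds the norm, brings \<open>X\<close> into the
  form \<open>1 - Z\<close> with \<open>0 \<le> Z \<le> q < 1\<close>; coercivity supplies the gap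
  \<open>1 / (c * k)\<close>. The root of the scaled matrix is then multiplied by
  \<open>sqrt c\<close>.\<close>

lemma pos_def_has_sqrt:
  assumes X: "pos_def n X"
  shows "\<exists>R. pos_semidef n R \<and> R * R = X"
proof -
  define c where "c = mnorm X + 1"
  define k where "k = mnorm (minv X) + 1"
  have ck: "0 < c" "0 < k" using mnorm_nonneg by (auto simp: c_def k_def add_nonneg_pos)
  define q where "q = max 0 (1 - 1 / (c * k))"
  define Z where "Z = 1\<^sub>m n - (1 / c) \<cdot>\<^sub>m X"
  have q: "0 \<le> q" "q < 1" using ck by (auto simp: q_def)
  note [simp] = pos_defD(3,4)[OF X]
  have Zx: "x \<bullet> (Z *\<^sub>v x) = x \<bullet> x - (1 / c) * (x \<bullet> (X *\<^sub>v x))" if "x \<in> carrier_vec n" for x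
  proof -
    have "((1 / c) \<cdot>\<^sub>m X) *\<^sub>v x = (1 / c) \<cdot>\<^sub>v (X *\<^sub>v x)" using that by (auto intro!: eq_vecI)
    then show ?thesis using that by (simp add: Z_def mv sp)
  qed
  have Z: "pos_semidef n Z" unfolding pos_semidef_def
  proof (intro conjI ballI)
    show "Z \<in> carrier_mat n n" by (simp add: Z_def carrier_matI)
    show "transpose_mat Z = Z" unfolding Z_def
      using pos_defD(1,2)[OF X] by (simp add: transpose_minus[of _ n n] transpose_smult)
    fix x :: rvec assume x: "x \<in> carrier_vec n"
    have "x \<bullet> (X *\<^sub>v x) \<le> c * (x \<bullet> x)"
      using form_le_mnorm[OF pos_defD(1)[OF X] x] sp_self_nonneg[of x] by (simp add: c_def algebra_simps)
    then show "0 \<le> x \<bullet> (Z *\<^sub>v x)" unfolding Zx[OF x] using ck by (simp add: field_simps)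
  qed
  have Zq: "x \<bullet> (Z *\<^sub>v x) \<le> q * (x \<bullet> x)" if x: "x \<in> carrier_vec n" for x
  proof -
    have p: "0 \<le> x \<bullet> (X *\<^sub>v x)" by (rule pos_semidefD(5)[OF pos_def_imp_semidef[OF X] x])
    have "x \<bullet> x \<le> k * (x \<bullet> (X *\<^sub>v x))"
      using pos_def_coercive[OF X x] p by (simp add: k_def algebra_simps)
    then have "x \<bullet> x / (c * k) \<le> (1 / c) * (x \<bullet> (X *\<^sub>v x))" using ck by (simp add: field_simps)
    then have "x \<bullet> (Z *\<^sub>v x) \<le> (1 - 1 / (c * k)) * (x \<bullet> x)" unfolding Zx[OF x] by (simp add: algebra_simps)
    also have "\<dots> \<le> q * (x \<bullet> x)" by (rule mult_right_mono) (auto simp: q_def sp_self_nonneg)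
    finally show ?thesis .
  qed
  \<comment> \<open>The smaller root of \<open>t\<^sup>2 - 2 t + q = 0\<close>, that is, the scalar
    fixed point below 1.\<close>
  define t where "t = 1 - sqrt (1 - q)"
  have "sqrt (1 - q) \<le> 1" using q by simp
  then have t: "0 \<le> t" "t < 1" "q + t * t = 2 * t" using q by (auto simp: t_def algebra_simps)
  from sqrt_one_minus[OF Z Zq t q(1)] obtain R where R: "pos_semidef n R" "R * R = 1\<^sub>m n - Z" by blast
  have RR: "R * R = (1 / c) \<cdot>\<^sub>m X" unfolding R(2) Z_def using pos_defD(1)[OF X] by (intro eq_matI) auto
  have Rx: "(sqrt c \<cdot>\<^sub>m R) *\<^sub>v x = sqrt c \<cdot>\<^sub>v (R *\<^sub>v x)" if "x \<in> carrier_vec n" for x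
    using that pos_semidefD(3,4)[OF R(1)] by (auto intro!: eq_vecI)
  show ?thesis
  proof (intro exI conjI)
    show "pos_semidef n (sqrt c \<cdot>\<^sub>m R)" unfolding pos_semidef_def
      using pos_semidefD[OF R(1)] ck Rx by (auto simp: transpose_smult sp)
    have "(sqrt c \<cdot>\<^sub>m R) * (sqrt c \<cdot>\<^sub>m R) = c \<cdot>\<^sub>m (R * R)"
      using pos_semidefD(1)[OF R(1)] ck
      by (simp add: mult_smult_assoc_mat[of _ n n _ n] mult_smult_distrib[of _ n n _ n] smult_smult_assoc_mat)
    also have "\<dots> = X" unfolding RR using ck by (intro eq_matI) auto
    finally show "(sqrt c \<cdot>\<^sub>m R) * (sqrt c \<cdot>\<^sub>m R) = X" .
  qed
qed

text \<open>Cyclicity of the trace, written as a sum of forms at the unit vectors so that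
  semidefiniteness can be applied term by term.\<close>

lemma trace_form_comm:
  fixes M N :: rmat
  assumes M: "M \<in> carrier_mat n n" and N: "N \<in> carrier_mat n n"
  shows "(\<Sum>i<n. unit_vec n i \<bullet> (M *\<^sub>v (N *\<^sub>v unit_vec n i))) = (\<Sum>i<n. unit_vec n i \<bullet> (N *\<^sub>v (M *\<^sub>v unit_vec n i)))"
proof -
  have e: "unit_vec n i \<bullet> (P *\<^sub>v (Q *\<^sub>v unit_vec n i)) = (\<Sum>j<n. P $$ (i, j) * Q $$ (j, i))"
    if "P \<in> carrier_mat n n" "Q \<in> carrier_mat n n" "i < n" for P Q :: rmat and i
  proof -
    have "Q *\<^sub>v unit_vec n i = col Q i"
      using that by (intro eq_vecI) auto
    then show ?thesis using that
      by (simp add: scalar_prod_left_unit[of _ n]) (simp add: scalar_prod_def atLeast0LessThan)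
  qed
  have "(\<Sum>i<n. unit_vec n i \<bullet> (M *\<^sub>v (N *\<^sub>v unit_vec n i))) = (\<Sum>i<n. \<Sum>j<n. M $$ (i, j) * N $$ (j, i))"
    by (intro sum.cong) (auto simp: e[OF M N])
  also have "\<dots> = (\<Sum>j<n. \<Sum>i<n. N $$ (j, i) * M $$ (i, j))"
    by (subst sum.swap) (simp add: mult.commute)
  also have "\<dots> = (\<Sum>i<n. unit_vec n i \<bullet> (N *\<^sub>v (M *\<^sub>v unit_vec n i)))"
    by (intro sum.cong) (auto simp: e[OF N M])
  finally show ?thesis .
qed

lemma psd_form_eq_0:
  assumes M: "pos_semidef n M" and x: "x \<in> carrier_vec n" and 0: "x \<bullet> (M *\<^sub>v x) = 0"
  shows "M *\<^sub>v x = 0\<^sub>v n"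
proof -
  have y: "M *\<^sub>v x \<in> carrier_vec n" using pos_semidefD(1)[OF M] x by auto
  have "((M *\<^sub>v x) \<bullet> (M *\<^sub>v x))\<^sup>2 \<le> 0"
    using psd_cauchy_schwarz[OF M y x] 0 by simp
  then show ?thesis using sp_self_eq_0[OF y] by simp
qed

text \<open>\<open>E = R - T\<close> satisfies \<open>R E + E T = 0\<close>. Multiplying by \<open>E\<close> and taking traces gives two nonnegative terms with sum 0.\<close>

lemma pos_def_sqrt_unique:
  assumes X: "pos_def n X" and R: "pos_semidef n R" "R * R = X" and T: "pos_semidef n T" "T * T = X"
  shows "R = T"
proof -
  note [simp] = pos_semidefD(3,4)[OF R(1)] pos_semidefD(3,4)[OF T(1)] pos_defD(3,4)[OF X]
  define E where "E = R - T"
  have E: "E \<in> carrier_mat n n" "dim_row E = n" "dim_col E = n" by (auto simp: E_def intro!: carrier_matI)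
  have Es: "transpose_mat E = E" unfolding E_def
    using pos_semidefD(1,2)[OF R(1)] pos_semidefD(1,2)[OF T(1)] by (simp add: transpose_minus[of _ n n])
  note [simp] = E(2,3)
  have RR: "R *\<^sub>v (R *\<^sub>v x) = X *\<^sub>v x" and TT: "T *\<^sub>v (T *\<^sub>v x) = X *\<^sub>v x" if "x \<in> carrier_vec n" for x
    using that R(2) T(2) by (auto simp flip: mv_mult)
  \<comment> \<open>\<open>R E + E T = R R - T T\<close>, and both squares are
    \<open>X\<close>.\<close>
  have ET: "E *\<^sub>v (T *\<^sub>v x) = - (R *\<^sub>v (E *\<^sub>v x))" if x: "x \<in> carrier_vec n" for x
    using RR[OF x] TT[OF x] x unfolding E_def
    by (intro eq_vecI) (auto simp add: mv simp del: index_mult_mat_vec)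
  let ?u = "\<lambda>i. unit_vec n i :: rvec"
  let ?a = "\<lambda>i. (E *\<^sub>v ?u i) \<bullet> (R *\<^sub>v (E *\<^sub>v ?u i))"
  have a: "0 \<le> ?a i" for i by (rule pos_semidefD(5)[OF R(1) mult_mat_vec_carrier[OF E(1) unit_vec_carrier]])
  have "(\<Sum>i<n. ?u i \<bullet> ((E * T) *\<^sub>v (E *\<^sub>v ?u i))) = (\<Sum>i<n. ?u i \<bullet> (E *\<^sub>v ((E * T) *\<^sub>v ?u i)))"
    using trace_form_comm[of "E * T" n E] E pos_semidefD(1)[OF T(1)] by simp
  also have "\<dots> = (\<Sum>i<n. - ?a i)"
  proof (intro sum.cong refl)
    fix i
    have "?u i \<bullet> (E *\<^sub>v ((E * T) *\<^sub>v ?u i)) = (E *\<^sub>v ?u i) \<bullet> (E *\<^sub>v (T *\<^sub>v ?u i))"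
      by (subst sp_transpose) (simp_all add: Es mv)
    also have "\<dots> = - ?a i" unfolding ET[OF unit_vec_carrier] by simp
    finally show "?u i \<bullet> (E *\<^sub>v ((E * T) *\<^sub>v ?u i)) = - ?a i" .
  qed
  also have "(\<Sum>i<n. ?u i \<bullet> ((E * T) *\<^sub>v (E *\<^sub>v ?u i))) = (\<Sum>i<n. (E *\<^sub>v ?u i) \<bullet> (T *\<^sub>v (E *\<^sub>v ?u i)))"
    by (intro sum.cong refl) (simp add: mv sp_transpose[of _ E] Es)
  finally have "(\<Sum>i<n. (E *\<^sub>v ?u i) \<bullet> (T *\<^sub>v (E *\<^sub>v ?u i))) + (\<Sum>i<n. ?a i) = 0" by (simp add: sum_negf)
  moreover have "0 \<le> (\<Sum>i<n. (E *\<^sub>v ?u i) \<bullet> (T *\<^sub>v (E *\<^sub>v ?u i)))"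
    by (intro sum_nonneg pos_semidefD(5)[OF T(1)] mult_mat_vec_carrier[OF E(1)] unit_vec_carrier)
  ultimately have "(\<Sum>i<n. ?a i) = 0" using a by (meson add_nonneg_eq_0_iff sum_nonneg)
  then have a0: "?a i = 0" if "i < n" for i using a that by (simp add: sum_nonneg_eq_0_iff)
  have Eu: "E *\<^sub>v ?u i = 0\<^sub>v n" if i: "i < n" for i
  proof -
    have c: "E *\<^sub>v ?u i \<in> carrier_vec n" using E(1) by auto
    have "R *\<^sub>v (E *\<^sub>v ?u i) = 0\<^sub>v n" by (rule psd_form_eq_0[OF R(1) c a0[OF i]])
    \<comment> \<open>\<open>R\<close> is known to be semidefinite only; applying it once more gives
      \<open>X\<close>, whose kernel is trivial.\<close>
    then have "X *\<^sub>v (E *\<^sub>v ?u i) = 0\<^sub>v n" using RR[OF c] by (simp add: mv)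
    then show ?thesis by (rule pos_def_kernel[OF X c])
  qed
  have "E $$ (i, j) = 0" if "i < n" "j < n" for i j
  proof -
    have "E $$ (i, j) = vec_index (E *\<^sub>v ?u j) i" using that by simp
    then show ?thesis using Eu[OF that(2)] that by (simp del: index_mult_mat_vec)
  qed
  then have "R $$ (i, j) = T $$ (i, j)" if "i < n" "j < n" for i j
    using that unfolding E_def by auto
  then show ?thesis by (intro eq_matI) auto
qed

lemma msqrt_props:
  assumes X: "pos_def n X"
  shows "pos_semidef n (msqrt X)" "msqrt X * msqrt X = X"
proof -
  have "\<exists>!R. pos_semidef n R \<and> R * R = X"
    using pos_def_has_sqrt[OF X] pos_def_sqrt_unique[OF X] by blast
  from theI'[OF this] show "pos_semidef n (msqrt X)" "msqrt X * msqrt X = X"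
    by (auto simp: msqrt_def pos_defD(3)[OF X])
qed

lemma msqrt_pos_def:
  assumes X: "pos_def n X" shows "pos_def n (msqrt X)"
  unfolding pos_def_def
proof (intro conjI ballI impI)
  note R = msqrt_props[OF X]
  show "msqrt X \<in> carrier_mat n n" "transpose_mat (msqrt X) = msqrt X" using pos_semidefD[OF R(1)] by auto
  fix x :: rvec assume x: "x \<in> carrier_vec n" "x \<noteq> 0\<^sub>v n"
  have "x \<bullet> (msqrt X *\<^sub>v x) \<noteq> 0"
  proof
    assume "x \<bullet> (msqrt X *\<^sub>v x) = 0"
    then have "msqrt X *\<^sub>v x = 0\<^sub>v n" by (rule psd_form_eq_0[OF R(1) x(1)])
    then have "(msqrt X * msqrt X) *\<^sub>v x = 0\<^sub>v n" using x pos_semidefD(3,4)[OF R(1)] by (simp add: mv)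
    then show False using pos_def_kernel[OF X x(1)] x(2) R(2) by simp
  qed
  with pos_semidefD(5)[OF R(1) x(1)] show "0 < x \<bullet> (msqrt X *\<^sub>v x)" by linarith
qed

section \<open>Contraction of the V-cycle\<close>

lemma pow_mv_Suc: "S \<in> carrier_mat n n \<Longrightarrow> x \<in> carrier_vec n \<Longrightarrow>
    (S ^\<^sub>m Suc k) *\<^sub>v x = (S ^\<^sub>m k) *\<^sub>v (S *\<^sub>v (x :: rvec))"
  by (simp add: assoc_mult_mat_vec[of _ n n _ n])

lemma pow_mv_Suc': "S \<in> carrier_mat n n \<Longrightarrow> x \<in> carrier_vec n \<Longrightarrow>
    (S ^\<^sub>m Suc k) *\<^sub>v x = S *\<^sub>v ((S ^\<^sub>m k) *\<^sub>v (x :: rvec))"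
proof (induction k arbitrary: x)
  case (Suc k)
  have "(S ^\<^sub>m Suc (Suc k)) *\<^sub>v x = (S ^\<^sub>m Suc k) *\<^sub>v (S *\<^sub>v x)" by (rule pow_mv_Suc[OF Suc.prems])
  also have "\<dots> = S *\<^sub>v ((S ^\<^sub>m k) *\<^sub>v (S *\<^sub>v x))" using Suc.prems by (intro Suc.IH) auto
  finally show ?case unfolding pow_mv_Suc[OF Suc.prems, of k] .
qed auto

text \<open>The algebra of a Galerkin hierarchy with a symmetric smoother. \<open>M_ge\<close> makes
  the smoother a nonnegative energy contraction, and \<open>galerkin\<close> makes the prolongation
  an isometry between the energy spaces of consecutive levels.\<close>

locale mg_hierarchy =
  fixes n :: "nat \<Rightarrow> nat" and A M P :: "nat \<Rightarrow> rmat" and \<nu>1 \<nu>2 :: nat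
  assumes A_pd: "pos_def (n l) (A l)"
    and M_carrier: "M l \<in> carrier_mat (n l) (n l)"
    and M_sym: "transpose_mat (M l) = M l"
    and M_ge: "x \<in> carrier_vec (n l) \<Longrightarrow> x \<bullet> (A l *\<^sub>v x) \<le> x \<bullet> (M l *\<^sub>v x)"
    and P_carrier: "P (Suc l) \<in> carrier_mat (n (Suc l)) (n l)"
    and galerkin: "transpose_mat (P (Suc l)) * A (Suc l) * P (Suc l) = A l"
begin

abbreviation "X \<equiv> mg_iteration_mat A M P \<nu>1 \<nu>2"

lemma M_pd: "pos_def (n l) (M l)"
  by (rule pos_def_ge[OF A_pd M_carrier M_sym M_ge])

definition Ai :: "nat \<Rightarrow> rmat" where "Ai l = minv (A l)"
definition Mi :: "nat \<Rightarrow> rmat" where "Mi l = minv (M l)"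
definition Sm :: "nat \<Rightarrow> rmat" where "Sm l = 1\<^sub>m (n l) - Mi l * A l"

lemma Ai_pd: "pos_def (n l) (Ai l)" and Mi_pd: "pos_def (n l) (Mi l)"
  unfolding Ai_def Mi_def by (rule pos_def_minv_pos_def[OF A_pd] pos_def_minv_pos_def[OF M_pd])+

lemmas mg_dims [simp] = pos_defD(3,4)[OF A_pd] pos_defD(3,4)[OF M_pd] pos_defD(3,4)[OF Ai_pd]
  pos_defD(3,4)[OF Mi_pd] P_carrier[THEN carrier_matD(1)] P_carrier[THEN carrier_matD(2)]

lemmas mg_syms = pos_defD(2)[OF A_pd] pos_defD(2)[OF M_pd] pos_defD(2)[OF Ai_pd] pos_defD(2)[OF Mi_pd]

lemma Sm_carrier: "Sm l \<in> carrier_mat (n l) (n l)"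
  by (simp add: Sm_def carrier_matI)

lemma Sm_dims [simp]: "dim_row (Sm l) = n l" "dim_col (Sm l) = n l" 
  "dim_row (Sm l ^\<^sub>m k) = n l" "dim_col (Sm l ^\<^sub>m k) = n l"
  using Sm_carrier pow_carrier_mat[OF Sm_carrier] by (auto dest: carrier_matD)

lemma inverse_mv [simp]:
  assumes "dim_vec x = n l"
  shows "A l *\<^sub>v (Ai l *\<^sub>v x) = x" "Ai l *\<^sub>v (A l *\<^sub>v x) = x" "M l *\<^sub>v (Mi l *\<^sub>v x) = x" "Mi l *\<^sub>v (M l *\<^sub>v x) = x"
  using mv_minv[OF A_pd assms] mv_minv[OF M_pd assms] by (simp_all add: Ai_def Mi_def)

lemma Sm_mv: "dim_vec x = n l \<Longrightarrow> Sm l *\<^sub>v x = x - Mi l *\<^sub>v (A l *\<^sub>v x)"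
  by (simp add: Sm_def mv)

lemma Sm_pow_Suc: "dim_vec x = n l \<Longrightarrow> (Sm l ^\<^sub>m Suc k) *\<^sub>v x = Sm l *\<^sub>v ((Sm l ^\<^sub>m k) *\<^sub>v x)"
  using pow_mv_Suc'[OF Sm_carrier] by (auto intro: carrier_vecI)

lemma Sm_pow_0: "dim_vec x = n l \<Longrightarrow> (Sm l ^\<^sub>m 0) *\<^sub>v x = x"
  by (simp add: mv)

text \<open>\<open>cc l w\<close> is the coefficient vector of the energy projection of \<open>w\<close> onto level \<open>l\<close>, and \<open>Gm l\<close> is the coarse
  grid correction, exact up to \<open>X l\<close>.\<close>

definition cc :: "nat \<Rightarrow> rvec \<Rightarrow> rvec" where
  "cc l w = Ai l *\<^sub>v (transpose_mat (P (Suc l)) *\<^sub>v (A (Suc l) *\<^sub>v w))"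

definition Gm :: "nat \<Rightarrow> rmat" where
  "Gm l = 1\<^sub>m (n (Suc l)) - P (Suc l) * Ai l * transpose_mat (P (Suc l)) * A (Suc l)
     + P (Suc l) * X l * Ai l * transpose_mat (P (Suc l)) * A (Suc l)"

lemma cc_dim [simp]: "dim_vec (cc l w) = n l"
  by (simp add: cc_def)

lemma X_Suc: "X (Suc l) = Sm (Suc l) ^\<^sub>m \<nu>2 * Gm l * Sm (Suc l) ^\<^sub>m \<nu>1"
  by (simp add: Let_def Sm_def Gm_def Ai_def Mi_def)

lemma X_0: "X 0 = 0\<^sub>m (n 0) (n 0)"
  by simp

lemma X_carrier: "X l \<in> carrier_mat (n l) (n l)"
  by (cases l) (auto simp add: X_Suc simp del: mg_iteration_mat.simps(2) intro!: carrier_matI)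

lemma X_dims [simp]: "dim_row (X l) = n l" "dim_col (X l) = n l" 
  using X_carrier by (auto dest: carrier_matD)

declare mg_iteration_mat.simps [simp del]

lemma Gm_dims [simp]: "dim_row (Gm l) = n (Suc l)" "dim_col (Gm l) = n (Suc l)"
  by (simp_all add: Gm_def)

lemma Gm_mv: "dim_vec w = n (Suc l) \<Longrightarrow>
    Gm l *\<^sub>v w = w - P (Suc l) *\<^sub>v cc l w + P (Suc l) *\<^sub>v (X l *\<^sub>v cc l w)"
  by (simp add: Gm_def mv cc_def)

lemma X_Suc_mv: "dim_vec x = n (Suc l) \<Longrightarrow>
    X (Suc l) *\<^sub>v x = (Sm (Suc l) ^\<^sub>m \<nu>2) *\<^sub>v (Gm l *\<^sub>v ((Sm (Suc l) ^\<^sub>m \<nu>1) *\<^sub>v x))"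
  by (simp add: X_Suc mv)

definition ip :: "nat \<Rightarrow> rvec \<Rightarrow> rvec \<Rightarrow> real" where "ip l x y = x \<bullet> (A l *\<^sub>v y)"

lemma ip_sym: "dim_vec x = n l \<Longrightarrow> dim_vec y = n l \<Longrightarrow> ip l x y = ip l y x"
  unfolding ip_def by (rule sp_sym) (simp_all add: mg_syms)

lemma ip_lin:
  assumes "dim_vec x = n l" "dim_vec y = n l" "dim_vec z = n l"
  shows "ip l (x + y) z = ip l x z + ip l y z" "ip l (x - y) z = ip l x z - ip l y z"
    "ip l z (x + y) = ip l z x + ip l z y" "ip l z (x - y) = ip l z x - ip l z y"
  using assms by (simp_all add: ip_def mv sp)

lemma ip_nonneg: "dim_vec x = n l \<Longrightarrow> 0 \<le> ip l x x"
  unfolding ip_def by (rule pos_semidefD(5)[OF pos_def_imp_semidef[OF A_pd]]) (auto intro: carrier_vecI)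

text \<open>\<open>cc l\<close> is the adjoint of the prolongation with respect to the two energy
  forms. Together with \<open>cc_P\<close> this makes \<open>P (Suc l) *\<^sub>v cc l w\<close> the
  energy-orthogonal projection of \<open>w\<close>.\<close>

lemma ip_P_left: "dim_vec a = n l \<Longrightarrow> dim_vec y = n (Suc l) \<Longrightarrow> ip (Suc l) (P (Suc l) *\<^sub>v a) y = ip l a (cc l y)"
  unfolding ip_def cc_def by (simp add: sp_transpose[of a "transpose_mat (P (Suc l))"])

lemma cc_P: "dim_vec a = n l \<Longrightarrow> cc l (P (Suc l) *\<^sub>v a) = a"
proof -
  assume a: "dim_vec a = n l"
  have "transpose_mat (P (Suc l)) *\<^sub>v (A (Suc l) *\<^sub>v (P (Suc l) *\<^sub>v a)) = A l *\<^sub>v a"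
    using arg_cong[OF galerkin[of l], of "\<lambda>B. B *\<^sub>v a"] a by (simp add: mv)
  then show ?thesis using a by (simp add: cc_def)
qed

lemma ip_P_P: "dim_vec a = n l \<Longrightarrow> dim_vec b = n l \<Longrightarrow> ip (Suc l) (P (Suc l) *\<^sub>v a) (P (Suc l) *\<^sub>v b) = ip l a b"
  by (simp add: ip_P_left cc_P)

lemma ip_P_right: "dim_vec a = n l \<Longrightarrow> dim_vec y = n (Suc l) \<Longrightarrow> ip (Suc l) y (P (Suc l) *\<^sub>v a) = ip l (cc l y) a"
  using ip_P_left[of a l y] ip_sym[of y "Suc l" "P (Suc l) *\<^sub>v a"] ip_sym[of "cc l y" l a] by simp

lemma ip_Mi:
  assumes "dim_vec x = n l" "dim_vec y = n l"
  shows "ip l x (Mi l *\<^sub>v (A l *\<^sub>v y)) = (A l *\<^sub>v x) \<bullet> (Mi l *\<^sub>v (A l *\<^sub>v y))"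
  using assms unfolding ip_def by (simp add: sp_transpose[of x "A l"] mg_syms)

lemma ip_Sm_sym:
  assumes "dim_vec x = n l" "dim_vec y = n l"
  shows "ip l x (Sm l *\<^sub>v y) = ip l (Sm l *\<^sub>v x) y"
proof -
  have "(A l *\<^sub>v x) \<bullet> (Mi l *\<^sub>v (A l *\<^sub>v y)) = (A l *\<^sub>v y) \<bullet> (Mi l *\<^sub>v (A l *\<^sub>v x))"
    by (rule sp_sym) (simp_all add: mg_syms)
  then show ?thesis using assms ip_sym[of "Mi l *\<^sub>v (A l *\<^sub>v x)" l y]
    by (simp add: Sm_mv ip_lin ip_Mi)
qed

lemma ip_Sm_pow_sym:
  assumes "dim_vec x = n l" "dim_vec y = n l"
  shows "ip l x ((Sm l ^\<^sub>m k) *\<^sub>v y) = ip l ((Sm l ^\<^sub>m k) *\<^sub>v x) y"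
  using assms
proof (induction k arbitrary: x y)
  case (Suc k)
  have "(Sm l ^\<^sub>m Suc k) *\<^sub>v y = (Sm l ^\<^sub>m k) *\<^sub>v (Sm l *\<^sub>v y)"
    using Suc.prems by (intro pow_mv_Suc[OF Sm_carrier]) (auto intro: carrier_vecI)
  then show ?case using Suc by (simp add: Sm_pow_Suc ip_Sm_sym del: pow_mat.simps)
qed (simp add: Sm_pow_0 del: pow_mat.simps)

text \<open>With \<open>r = Mi A x\<close> one has
  \<open>ip l x r = r \<bullet> M r \<ge> r \<bullet> A r\<close>, so Cauchy-Schwarz in the energy
  gives \<open>(ip l x r)\<^sup>2 \<le> ip l x r * ip l x x\<close>.\<close>

lemma Mi_energy:
  assumes x: "dim_vec x = n l"
  shows "0 \<le> ip l x (Mi l *\<^sub>v (A l *\<^sub>v x))" "ip l x (Mi l *\<^sub>v (A l *\<^sub>v x)) \<le> ip l x x"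
proof -
  let ?r = "Mi l *\<^sub>v (A l *\<^sub>v x)"
  have r: "?r \<in> carrier_vec (n l)" "x \<in> carrier_vec (n l)" using x by (auto intro!: carrier_vecI)
  show nn: "0 \<le> ip l x ?r" unfolding ip_Mi[OF x x]
    by (rule pos_semidefD(5)[OF pos_def_imp_semidef[OF Mi_pd]]) (auto intro!: carrier_vecI)
  have e: "ip l x ?r = ?r \<bullet> (M l *\<^sub>v ?r)"
    using x unfolding ip_sym[of x l ?r, OF x, simplified] by (simp add: ip_def)
  have "(?r \<bullet> (A l *\<^sub>v x))\<^sup>2 \<le> (?r \<bullet> (A l *\<^sub>v ?r)) * (x \<bullet> (A l *\<^sub>v x))"
    by (rule psd_cauchy_schwarz[OF pos_def_imp_semidef[OF A_pd] r])
  also have "\<dots> \<le> (?r \<bullet> (M l *\<^sub>v ?r)) * ip l x x"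
    unfolding ip_def[of l x x, symmetric] by (rule mult_right_mono[OF M_ge[OF r(1)] ip_nonneg[OF x]])
  finally have "ip l x ?r * ip l x ?r \<le> ip l x ?r * ip l x x"
    unfolding e[symmetric] using ip_sym[OF x, of ?r] by (simp add: ip_def power2_eq_square)
  then show "ip l x ?r \<le> ip l x x"
    using nn ip_nonneg[OF x] by (cases "ip l x ?r = 0") (auto simp: mult_le_cancel_left)
qed

text \<open>The third bound is the smoothing property in the form that the contraction consumes:
  \<open>2 S\<^sup>2 - S\<^sup>3 \<le> S \<le> 1\<close> in the energy.\<close>

lemma Sm_energy:
  assumes x: "dim_vec x = n l"
  shows "0 \<le> ip l x (Sm l *\<^sub>v x)" "ip l x (Sm l *\<^sub>v x) \<le> ip l x x"
    "2 * ip l (Sm l *\<^sub>v x) (Sm l *\<^sub>v x) - ip l (Sm l *\<^sub>v x) (Sm l *\<^sub>v (Sm l *\<^sub>v x)) \<le> ip l x x"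
    "ip l (Sm l *\<^sub>v x) (Sm l *\<^sub>v x) \<le> ip l x x"
proof -
  have e: "ip l y (Sm l *\<^sub>v y) = ip l y y - ip l y (Mi l *\<^sub>v (A l *\<^sub>v y))" if "dim_vec y = n l" for y
    using that by (simp add: Sm_mv ip_lin)
  have a: "0 \<le> ip l y (Sm l *\<^sub>v y)" "ip l y (Sm l *\<^sub>v y) \<le> ip l y y" if "dim_vec y = n l" for y
    unfolding e[OF that] using Mi_energy[OF that] by auto
  show "0 \<le> ip l x (Sm l *\<^sub>v x)" and le: "ip l x (Sm l *\<^sub>v x) \<le> ip l x x" by (fact a[OF x])+
  \<comment> \<open>\<open>S (1 - S)\<^sup>2 \<ge> 0\<close>\<close>
  have "0 \<le> ip l (x - Sm l *\<^sub>v x) (Sm l *\<^sub>v (x - Sm l *\<^sub>v x))" using x by (intro a) simp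
  also have "\<dots> = ip l x (Sm l *\<^sub>v x) - 2 * ip l (Sm l *\<^sub>v x) (Sm l *\<^sub>v x) + ip l (Sm l *\<^sub>v x) (Sm l *\<^sub>v (Sm l *\<^sub>v x))"
    using x ip_Sm_sym[of x l "Sm l *\<^sub>v x"] by (simp add: mv ip_lin)
  finally show 3: "2 * ip l (Sm l *\<^sub>v x) (Sm l *\<^sub>v x) - ip l (Sm l *\<^sub>v x) (Sm l *\<^sub>v (Sm l *\<^sub>v x)) \<le> ip l x x"
    using le by linarith
  show "ip l (Sm l *\<^sub>v x) (Sm l *\<^sub>v x) \<le> ip l x x" using 3 a(2)[of "Sm l *\<^sub>v x"] by simp
qed

lemma Sm_pow_energy:
  assumes x: "dim_vec x = n l"
  shows "ip l ((Sm l ^\<^sub>m k) *\<^sub>v x) ((Sm l ^\<^sub>m k) *\<^sub>v x) \<le> ip l x x"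
proof (induction k)
  case (Suc k)
  then show ?case using Sm_energy(4)[of "(Sm l ^\<^sub>m k) *\<^sub>v x" l] unfolding Sm_pow_Suc[OF x] by simp
qed (simp add: Sm_pow_0[OF x] del: pow_mat.simps)

lemma ip_Gm:
  assumes "dim_vec x = n (Suc l)" "dim_vec y = n (Suc l)"
  shows "ip (Suc l) x (Gm l *\<^sub>v y) = ip (Suc l) x y - ip l (cc l x) (cc l y) + ip l (cc l x) (X l *\<^sub>v cc l y)"
  using assms by (simp add: Gm_mv ip_lin ip_P_right)

text \<open>Equal numbers of pre- and post-smoothing steps make the cycle symmetric about its coarse
  correction, which is energy-symmetric by induction.\<close>

lemma X_ip_sym:
  assumes "\<nu>1 = \<nu>2" "dim_vec x = n l" "dim_vec y = n l"
  shows "ip l x (X l *\<^sub>v y) = ip l (X l *\<^sub>v x) y"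
  using assms(2,3)
proof (induction l arbitrary: x y)
  case 0
  then show ?case by (simp add: X_0 mv ip_def sp)
next
  case (Suc l)
  have G: "ip (Suc l) u (Gm l *\<^sub>v v) = ip (Suc l) (Gm l *\<^sub>v u) v" if "dim_vec u = n (Suc l)" "dim_vec v = n (Suc l)" for u v
    using that Suc.IH[of "cc l u" "cc l v"] ip_sym[of "Gm l *\<^sub>v u" "Suc l" v] ip_sym[of u "Suc l" v]
      ip_sym[of "cc l u" l "cc l v"] ip_sym[of "X l *\<^sub>v cc l u" l "cc l v"]
    by (simp add: ip_Gm)
  have "Sm (Suc l) ^\<^sub>m \<nu>1 = Sm (Suc l) ^\<^sub>m \<nu>2" using assms(1) by (rule arg_cong)
  then show ?case unfolding X_Suc_mv[OF Suc.prems(1)] X_Suc_mv[OF Suc.prems(2)]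
    using Suc.prems by (simp add: ip_Sm_pow_sym G)
qed

text \<open>The coarse grid error \<open>e\<close> satisfies
  \<open>ip e e = ip e w = e \<bullet> M r\<close> with \<open>r = Mi A w\<close>. Cauchy-Schwarz in
  the form of \<open>M\<close> and the approximation property bound it by \<open>C\<close> times
  \<open>r \<bullet> M r\<close>, which is the energy form of \<open>1 - S\<close> at
  \<open>w\<close>.\<close>

lemma coarse_correction_energy:
  assumes w: "dim_vec w = n (Suc l)" and C: "0 \<le> C"
    and approx: "\<And>e. e \<in> carrier_vec (n (Suc l)) \<Longrightarrow> transpose_mat (P (Suc l)) *\<^sub>v (A (Suc l) *\<^sub>v e) = 0\<^sub>v (n l) \<Longrightarrow>
      e \<bullet> (M (Suc l) *\<^sub>v e) \<le> C * (e \<bullet> (A (Suc l) *\<^sub>v e))"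
  shows "ip (Suc l) w w - ip l (cc l w) (cc l w) \<le> C * (ip (Suc l) w w - ip (Suc l) w (Sm (Suc l) *\<^sub>v w))"
    "0 \<le> ip (Suc l) w w - ip l (cc l w) (cc l w)"
proof -
  let ?l = "Suc l"
  define e where "e = w - P ?l *\<^sub>v cc l w"
  have de [simp]: "dim_vec e = n ?l" using w by (simp add: e_def)
  have e: "e \<in> carrier_vec (n ?l)" by (rule carrier_vecI) simp
  have ee: "ip ?l e e = ip ?l w w - ip l (cc l w) (cc l w)"
    using w by (simp add: e_def ip_lin ip_P_left ip_P_right cc_P)
  have ew: "ip ?l e w = ip ?l e e"
    unfolding ee using w by (simp add: e_def ip_lin ip_P_left)
  have orth: "transpose_mat (P ?l) *\<^sub>v (A ?l *\<^sub>v e) = 0\<^sub>v (n l)"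
  proof -
    have "transpose_mat (P ?l) *\<^sub>v (A ?l *\<^sub>v e) = A l *\<^sub>v cc l e" by (simp add: cc_def)
    also have "cc l e = cc l w - cc l (P ?l *\<^sub>v cc l w)"
      using w by (simp add: cc_def e_def mv)
    also have "\<dots> = 0\<^sub>v (n l)" by (intro eq_vecI) (simp_all add: cc_P)
    finally show ?thesis by (simp add: mv)
  qed
  let ?r = "Mi ?l *\<^sub>v (A ?l *\<^sub>v w)"
  have r: "?r \<in> carrier_vec (n ?l)" using w by (auto intro!: carrier_vecI)
  have q: "?r \<bullet> (M ?l *\<^sub>v ?r) = ip ?l w w - ip ?l w (Sm ?l *\<^sub>v w)"
    using w ip_sym[of ?r ?l w] by (simp add: Sm_mv ip_lin) (simp add: ip_def)
  show ee0: "0 \<le> ip ?l w w - ip l (cc l w) (cc l w)" unfolding ee[symmetric] by (simp add: ip_nonneg)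
  have q0: "0 \<le> ?r \<bullet> (M ?l *\<^sub>v ?r)" by (rule pos_semidefD(5)[OF pos_def_imp_semidef[OF M_pd] r])
  have "(e \<bullet> (M ?l *\<^sub>v ?r))\<^sup>2 \<le> (e \<bullet> (M ?l *\<^sub>v e)) * (?r \<bullet> (M ?l *\<^sub>v ?r))"
    by (rule psd_cauchy_schwarz[OF pos_def_imp_semidef[OF M_pd] e r])
  also have "\<dots> \<le> (C * ip ?l e e) * (?r \<bullet> (M ?l *\<^sub>v ?r))"
    unfolding ip_def by (rule mult_right_mono[OF approx[OF e orth] q0])
  also have "e \<bullet> (M ?l *\<^sub>v ?r) = ip ?l e e" using ew w by (simp add: ip_def)
  finally have "ip ?l e e * ip ?l e e \<le> ip ?l e e * (C * (?r \<bullet> (M ?l *\<^sub>v ?r)))"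
    by (simp add: power2_eq_square mult_ac)
  then have "ip ?l e e \<le> C * (?r \<bullet> (M ?l *\<^sub>v ?r))"
    using ip_nonneg[OF de] q0 C by (cases "ip ?l e e = 0") (auto simp: mult_le_cancel_left)
  then show "ip (Suc l) w w - ip l (cc l w) (cc l w) \<le> C * (ip (Suc l) w w - ip (Suc l) w (Sm (Suc l) *\<^sub>v w))"
    unfolding ee q .
qed

text \<open>One smoothing step on each side is played against the coarse correction; the other
  \<open>k\<close> only have to be energy contractions. The coarse bound
  \<open>\<delta> = C / (C + 1)\<close> reproduces itself because
  \<open>(1 - \<delta>) * C = \<delta>\<close>.\<close>

lemma vcycle_contraction:
  assumes \<nu>: "\<nu>1 = Suc k" "\<nu>2 = Suc k" and C: "0 \<le> C"
    and approx: "\<And>l e. e \<in> carrier_vec (n (Suc l)) \<Longrightarrow> transpose_mat (P (Suc l)) *\<^sub>v (A (Suc l) *\<^sub>v e) = 0\<^sub>v (n l) \<Longrightarrow>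
      e \<bullet> (M (Suc l) *\<^sub>v e) \<le> C * (e \<bullet> (A (Suc l) *\<^sub>v e))"
    and x: "dim_vec x = n l"
  shows "0 \<le> ip l x (X l *\<^sub>v x) \<and> ip l x (X l *\<^sub>v x) \<le> C / (C + 1) * ip l x x"
  using x
proof (induction l arbitrary: x)
  case 0
  then show ?case using C ip_nonneg[OF 0] by (simp add: X_0 mv) (simp add: ip_def sp mv)
next
  case (Suc l)
  let ?l = "Suc l" and ?\<delta> = "C / (C + 1)"
  define u where "u = (Sm ?l ^\<^sub>m k) *\<^sub>v x"
  define w where "w = Sm ?l *\<^sub>v u"
  have d [simp]: "dim_vec x = n ?l" "dim_vec u = n ?l" "dim_vec w = n ?l" using Suc.prems by (auto simp: u_def w_def)
  have w: "(Sm ?l ^\<^sub>m \<nu>1) *\<^sub>v x = w" "(Sm ?l ^\<^sub>m \<nu>2) *\<^sub>v x = w"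
    unfolding \<nu> by (simp_all add: w_def u_def Sm_pow_Suc del: pow_mat.simps)
  have X: "ip ?l x (X ?l *\<^sub>v x) = ip ?l w w - ip l (cc l w) (cc l w) + ip l (cc l w) (X l *\<^sub>v cc l w)"
    by (simp add: X_Suc_mv ip_Sm_pow_sym w ip_Gm)
  let ?c = "ip l (cc l w) (cc l w)"
  note cc = coarse_correction_energy[OF d(3) C approx, simplified]
  note IH = Suc.IH[of "cc l w", simplified]
  have \<delta>: "0 \<le> ?\<delta>" "(1 - ?\<delta>) * C = ?\<delta>" "?\<delta> \<le> 1" using C by (auto simp: field_simps)
  have "ip ?l x (X ?l *\<^sub>v x) \<le> ip ?l w w - ?c + ?\<delta> * ?c" unfolding X using IH by simp
  \<comment> \<open>A convex combination: the part seen by the coarse level is damped by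
    \<open>\<delta>\<close>, the rest is left to the smoother.\<close>
  also have "\<dots> = (1 - ?\<delta>) * (ip ?l w w - ?c) + ?\<delta> * ip ?l w w" by (simp add: algebra_simps)
  also have "\<dots> \<le> (1 - ?\<delta>) * (C * (ip ?l w w - ip ?l w (Sm ?l *\<^sub>v w))) + ?\<delta> * ip ?l w w"
    using cc(1) \<delta>(3) by (intro add_right_mono mult_left_mono) auto
  also have "\<dots> = ?\<delta> * (2 * ip ?l w w - ip ?l w (Sm ?l *\<^sub>v w))"
    unfolding mult.assoc[symmetric] \<delta>(2) by (simp add: algebra_simps)
  also have "\<dots> \<le> ?\<delta> * ip ?l u u" using Sm_energy(3)[OF d(2)] \<delta>(1) unfolding w_def by (rule mult_left_mono)
  also have "\<dots> \<le> ?\<delta> * ip ?l x x" using Sm_pow_energy[OF d(1)] \<delta>(1) unfolding u_def by (rule mult_left_mono)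
  finally show ?case using cc(2) IH by (auto simp: X)
qed

end

section \<open>The perturbed energy form\<close>

text \<open>Existence by minimising \<open>J\<close>, whose parallelogram identity makes minimising
  sequences Cauchy. It is used twice: for the perturbed energy problem, and with the plain inner
  product as the Riesz representation theorem.\<close>

lemma coercive_form_representation:
  fixes q :: "'h::{real_inner, complete_space} \<Rightarrow> 'h \<Rightarrow> real" and \<phi> :: "'h \<Rightarrow> real"
  assumes add: "\<And>x y z. q (x + y) z = q x z + q y z" and scale: "\<And>r x z. q (r *\<^sub>R x) z = r * q x z"
    and sym: "\<And>x y. q x y = q y x"
    and coercive: "0 < \<alpha>" "\<And>x. \<alpha> * (norm x)\<^sup>2 \<le> q x x"
    and bounded: "\<And>x y. \<bar>q x y\<bar> \<le> \<beta> * norm x * norm y"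
    and \<phi>: "\<And>x y. \<phi> (x + y) = \<phi> x + \<phi> y" "\<And>r x. \<phi> (r *\<^sub>R x) = r * \<phi> x" "\<And>x. \<bar>\<phi> x\<bar> \<le> K * norm x"
  shows "\<exists>u. \<forall>v. q u v = \<phi> v"
proof -
  define J where "J x = q x x - 2 * \<phi> x" for x
  have addr: "q z (x + y) = q z x + q z y" and scaler: "q z (r *\<^sub>R x) = r * q z x" for x y z r
    using add[of x y z] scale[of r x z] sym by metis+
  have J_line: "J (x + t *\<^sub>R v) = J x + 2 * (q x v - \<phi> v) * t + q v v * t\<^sup>2" for x v t
    using sym[of v x] by (simp add: J_def add addr scale scaler \<phi> algebra_simps power2_eq_square)
  have J_lower: "- (K\<^sup>2 / \<alpha>) \<le> J x" for x
  proof -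
    have "0 \<le> (\<alpha> * norm x - K)\<^sup>2 / \<alpha>" using coercive(1) by simp
    also have "\<dots> = \<alpha> * (norm x)\<^sup>2 - 2 * (K * norm x) + K\<^sup>2 / \<alpha>"
      using coercive(1) by (simp add: power2_eq_square field_simps)
    finally show ?thesis using coercive(2)[of x] \<phi>(3)[of x] by (simp add: J_def)
  qed
  define m where "m = Inf (range J)"
  have bdd: "bdd_below (range J)" using J_lower by (intro bdd_belowI[of _ "- (K\<^sup>2 / \<alpha>)"]) auto
  have m_le: "m \<le> J x" for x unfolding m_def by (rule cInf_lower[OF _ bdd]) simp
  have "\<exists>x. J x < m + 1 / real (Suc k)" for k
    using cInf_lessD[of "range J" "m + 1 / real (Suc k)"] by (auto simp: m_def)
  then obtain x where x: "\<And>k. J (x k) < m + 1 / real (Suc k)" by metis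
  have close: "\<alpha> * (norm (x i - x j))\<^sup>2 \<le> 2 / real (Suc i) + 2 / real (Suc j)" for i j
  proof -
    \<comment> \<open>Half the difference, so that \<open>x i + ?y\<close> is the midpoint of
      \<open>x i\<close> and \<open>x j\<close>.\<close>
    let ?y = "(1/2) *\<^sub>R (x j - x i)"
    have e1: "x i + 1 *\<^sub>R ?y = x j + (-1) *\<^sub>R ?y" "x i + 2 *\<^sub>R ?y = x j" by (simp_all add: algebra_simps flip: scaleR_add_left)
    have "J (x i) + J (x j) = 2 * J (x i + 1 *\<^sub>R ?y) + 2 * q ?y ?y"
      using J_line[of "x i" 1 ?y] J_line[of "x i" 2 ?y] e1(2) by simp
    moreover have "q ?y ?y = q (x i - x j) (x i - x j) / 4"
    proof -
      have "?y = (-1/2) *\<^sub>R (x i - x j)" by (simp add: algebra_simps)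
      then show ?thesis by (simp only: scale scaler)
    qed
    ultimately have "q (x i - x j) (x i - x j) \<le> 2 * (J (x i) - m) + 2 * (J (x j) - m)"
      using m_le[of "x i + 1 *\<^sub>R ?y"] by argo
    then show ?thesis using coercive(2)[of "x i - x j"] x[of i] x[of j] by argo
  qed
  have "Cauchy x"
  proof (rule metric_CauchyI)
    fix e :: real assume e: "0 < e"
    then have "0 < \<alpha> * e\<^sup>2 / 4" using coercive(1) by simp
    then obtain N where N: "1 / real (Suc N) < \<alpha> * e\<^sup>2 / 4" by (metis nat_approx_posE)
    have "dist (x i) (x j) < e" if "N \<le> i" "N \<le> j" for i j
    proof -
      have "1 / real (Suc i) \<le> 1 / real (Suc N)" "1 / real (Suc j) \<le> 1 / real (Suc N)"
        using that by (auto intro!: divide_left_mono)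
      then have "\<alpha> * (norm (x i - x j))\<^sup>2 < \<alpha> * e\<^sup>2" using close[of i j] N by argo
      then have "(norm (x i - x j))\<^sup>2 < e\<^sup>2" using coercive(1) by simp
      then show ?thesis using e by (simp add: dist_norm power2_less_imp_less)
    qed
    then show "\<exists>M. \<forall>m\<ge>M. \<forall>n\<ge>M. dist (x m) (x n) < e" by blast
  qed
  then obtain u where u: "x \<longlonglongrightarrow> u" using Cauchy_convergent convergent_def by blast
  have "q u v = \<phi> v" for v
  proof -
    have lim1: "(\<lambda>k. q (x k) v) \<longlonglongrightarrow> q u v"
    proof (rule LIM_zero_cancel, rule Lim_null_comparison)
      have "q (x k) v - q u v = q (x k - u) v" for k
        using add[of "x k - u" u v] by simp
      then show "\<forall>\<^sub>F k in sequentially. norm (q (x k) v - q u v) \<le> \<beta> * norm (x k - u) * norm v"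
        using bounded by simp
      have "(\<lambda>k. \<beta> * norm (x k - u) * norm v) \<longlonglongrightarrow> \<beta> * 0 * norm v"
        by (intro tendsto_mult tendsto_const tendsto_norm_zero LIM_zero u)
      then show "(\<lambda>k. \<beta> * norm (x k - u) * norm v) \<longlonglongrightarrow> 0" by simp
    qed
    \<comment> \<open>\<open>J\<close> is at least \<open>m\<close> along the line through
      \<open>x k\<close>, and \<open>J (x k)\<close> exceeds \<open>m\<close> by less than
      \<open>1 / (k + 1)\<close>. The discriminant of this nonnegative quadratic in \<open>t\<close>
      bounds the residual of the equation at \<open>x k\<close>.\<close>
    have d: "(q (x k) v - \<phi> v)\<^sup>2 \<le> 1 / real (Suc k) * q v v" for k
    proof (rule quadratic_nonneg_discriminant)
      fix t
      show "0 \<le> 1 / real (Suc k) + 2 * (q (x k) v - \<phi> v) * t + q v v * t\<^sup>2"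
        using m_le[of "x k + t *\<^sub>R v"] x[of k] unfolding J_line by linarith
    qed
    have "(\<lambda>k. (q (x k) v - \<phi> v)\<^sup>2) \<longlonglongrightarrow> 0"
    proof (rule Lim_null_comparison)
      show "\<forall>\<^sub>F k in sequentially. norm ((q (x k) v - \<phi> v)\<^sup>2) \<le> 1 / real (Suc k) * q v v"
        using d by simp
      show "(\<lambda>k. 1 / real (Suc k) * q v v) \<longlonglongrightarrow> 0"
        by (intro tendsto_mult_left_zero) (rule LIMSEQ_Suc[OF lim_inverse_n', unfolded inverse_eq_divide])
    qed
    then have "(q u v - \<phi> v)\<^sup>2 = 0"
      by (rule LIMSEQ_unique[OF tendsto_power[OF tendsto_diff[OF lim1 tendsto_const]]])
    then show ?thesis by simp
  qed
  then show ?thesis by blast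
qed

text \<open>\<open>S\<close> is onto because \<open>S \<circ> S = \<A>\<close> is, and its symmetry gives \<open>\<parallel>u\<parallel>\<^sup>2 = \<langle>S u, \<A>\<inverse> S u\<rangle>\<close>; this replaces the spectral theorem in
  the proof of the Poincare inequality.\<close>

lemma sqrt_op_props:
  fixes V DA :: "'h::{real_inner, complete_space} set"
  assumes sq: "is_sqrt_op V S DA \<A>" and inv: "has_compact_inverse DA \<A>"
  shows "subspace V" "\<And>x y. x \<in> V \<Longrightarrow> y \<in> V \<Longrightarrow> S (x + y) = S x + S y"
    "\<And>c x. x \<in> V \<Longrightarrow> S (c *\<^sub>R x) = c *\<^sub>R S x" "\<And>h. \<exists>u\<in>V. S u = h"
    "\<exists>K>0. \<forall>u\<in>V. norm u \<le> K * norm (S u)"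
proof -
  have sa: "self_adjoint_op V S" and DA: "DA = {x \<in> V. S x \<in> V}" and SS: "\<And>x. x \<in> DA \<Longrightarrow> \<A> x = S (S x)"
    using sq by (auto simp: is_sqrt_op_def)
  show V: "subspace V" and Sadd: "\<And>x y. x \<in> V \<Longrightarrow> y \<in> V \<Longrightarrow> S (x + y) = S x + S y"
    and Sscale: "\<And>c x. x \<in> V \<Longrightarrow> S (c *\<^sub>R x) = c *\<^sub>R S x"
    using sa by (auto simp: self_adjoint_op_def linear_op_on_def)
  have Ssym: "inner (S x) y = inner x (S y)" if "x \<in> V" "y \<in> V" for x y
    using sa that by (auto simp: self_adjoint_op_def)
  have bij: "bij_betw \<A> DA UNIV" and cpt: "compact_op (inv_into DA \<A>)" using inv by (auto simp: has_compact_inverse_def)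
  define T where "T = inv_into DA \<A>"
  have T: "T f \<in> DA" "\<A> (T f) = f" for f
    using bij unfolding T_def bij_betw_def by (auto intro: inv_into_into f_inv_into_f)
  have ex: "\<exists>w\<in>DA. S (S w) = h" for h using T SS by metis
  then show "\<exists>u\<in>V. S u = h" for h using DA by blast
  \<comment> \<open>Compactness of the inverse enters as boundedness on the unit ball.\<close>
  have "linear T" "compact (closure (T ` cball 0 1))" using cpt bounded_cball by (auto simp: compact_op_def T_def)
  then have "bounded (T ` cball 0 1)" using bounded_subset closure_subset compact_imp_bounded by metis
  then obtain K where K: "\<And>x. norm x \<le> 1 \<Longrightarrow> norm (T x) \<le> K"
    unfolding bounded_iff by (metis imageI mem_cball_0)
  have K0: "0 \<le> K" using order_trans[OF norm_ge_zero K[of 0]] by simp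
  have Tb: "norm (T f) \<le> K * norm f" for f
  proof (cases "f = 0")
    case False
    have "norm (T ((1 / norm f) *\<^sub>R f)) \<le> K" using False by (intro K) simp
    then show ?thesis using False \<open>linear T\<close> by (simp add: linear_scale field_simps)
  qed (use \<open>linear T\<close> in \<open>simp add: linear_0\<close>)
  have "norm u \<le> (sqrt K + 1) * norm (S u)" if u: "u \<in> V" for u
  proof -
    obtain w where w: "w \<in> V" "S w = u"
    proof -
      obtain w' where "w' \<in> DA" "S (S w') = S u" using ex by blast
      moreover have "inj_on S V"
      proof (rule inj_onI)
        fix x y assume xy: "x \<in> V" "y \<in> V" "S x = S y"
        have z: "x - y \<in> V" using V xy subspace_diff by blast
        \<comment> \<open>A vector with \<open>S z = 0\<close> lies in the domain of
          \<open>\<A>\<close>, and there \<open>\<A> z = S 0 = \<A> 0\<close>.\<close>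
        have "S (x - y) = 0" using Sadd[OF z xy(2)] xy by simp
        then have "x - y \<in> DA" using z DA subspace_0[OF V] by simp
        then have "\<A> (x - y) = S 0" using SS \<open>S (x - y) = 0\<close> by simp
        have "S 0 = 0" using Sscale[OF subspace_0[OF V], of 0] by simp
        then have "0 \<in> DA" using DA subspace_0[OF V] by simp
        then have "\<A> 0 = S 0" using SS \<open>S 0 = 0\<close> by simp
        with \<open>\<A> (x - y) = S 0\<close> \<open>0 \<in> DA\<close> \<open>x - y \<in> DA\<close> have "x - y = 0" using bij unfolding bij_betw_def inj_on_def by metis
        then show "x = y" by simp
      qed
      ultimately have "S w' = u" using u DA by (auto simp: inj_on_def)
      then show ?thesis using that \<open>w' \<in> DA\<close> DA by blast
    qed
    have "w \<in> DA" using w u DA by simp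
    moreover have "\<A> w = S u" using SS[OF \<open>w \<in> DA\<close>] w by simp
    ultimately have "w = T (S u)" using bij T unfolding bij_betw_def inj_on_def by metis
    have "(norm u)\<^sup>2 = inner (S u) w" using Ssym[OF u w(1)] w(2) by (simp add: power2_norm_eq_inner)
    also have "\<dots> \<le> norm (S u) * norm w" by (rule norm_cauchy_schwarz)
    also have "\<dots> \<le> norm (S u) * (K * norm (S u))" unfolding \<open>w = T (S u)\<close> by (intro mult_left_mono Tb) simp
    also have "\<dots> = (sqrt K * norm (S u))\<^sup>2" using K0 by (simp add: power2_eq_square algebra_simps)
    finally have "norm u \<le> sqrt K * norm (S u)" by (rule power2_le_imp_le) (simp add: K0)
    also have "\<dots> \<le> (sqrt K + 1) * norm (S u)" by (simp add: algebra_simps)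
    finally show ?thesis .
  qed
  moreover have "0 < sqrt K + 1" using K0 by (simp add: add_nonneg_pos)
  ultimately show "\<exists>K>0. \<forall>u\<in>V. norm u \<le> K * norm (S u)" by blast
qed

section \<open>The elliptic problem with the data term\<close>

text \<open>\<open>c\<close> is bounded in the norm of the Hilbert space, so relative to the energy
  it is a perturbation of lower order; it enters the estimates through \<open>K\<close> and
  \<open>Kc\<close>.\<close>

locale perturbed_form =
  fixes V :: "'h::{real_inner, complete_space} set" and S :: "'h \<Rightarrow> 'h" and c :: "'h \<Rightarrow> 'h \<Rightarrow> real"
    and K Kc :: real
  assumes V: "subspace V"
    and S_add: "x \<in> V \<Longrightarrow> y \<in> V \<Longrightarrow> S (x + y) = S x + S y"
    and S_scale: "x \<in> V \<Longrightarrow> S (r *\<^sub>R x) = r *\<^sub>R S x"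
    and S_surj: "\<exists>u\<in>V. S u = h"
    and K: "0 < K" "u \<in> V \<Longrightarrow> norm u \<le> K * norm (S u)"
    and c_add: "c (x + y) z = c x z + c y z" and c_scale: "c (r *\<^sub>R x) z = r * c x z"
    and c_sym: "c x y = c y x" and c_nonneg: "0 \<le> c x x"
    and c_bound: "0 \<le> Kc" "\<bar>c x y\<bar> \<le> Kc * norm x * norm y"
begin

definition ta :: "'h \<Rightarrow> 'h \<Rightarrow> real" where "ta u v = inner (S u) (S v) + c u v"

lemma S_diff: "x \<in> V \<Longrightarrow> y \<in> V \<Longrightarrow> S (x - y) = S x - S y"
  using S_add[of x "(-1) *\<^sub>R y"] S_scale[of y "-1"] subspace_scale[OF V, of y "-1"] by simp

lemma S_inj: "x \<in> V \<Longrightarrow> y \<in> V \<Longrightarrow> S x = S y \<Longrightarrow> x = y"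
  using K(2)[of "x - y"] subspace_diff[OF V, of x y] by (simp add: S_diff)

text \<open>The inverse of \<open>S\<close>. Since \<open>S\<close> maps \<open>V\<close> with the
  energy norm isometrically onto the Hilbert space, \<open>R\<close> transports problems on
  \<open>V\<close> to a space already known to be complete.\<close>

definition R :: "'h \<Rightarrow> 'h" where "R h = (SOME u. u \<in> V \<and> S u = h)"

lemma R: "R h \<in> V" "S (R h) = h"
  using someI_ex[of "\<lambda>u. u \<in> V \<and> S u = h"] S_surj[of h] unfolding R_def by blast+

lemma R_S: "u \<in> V \<Longrightarrow> R (S u) = u"
  by (rule S_inj[OF R(1) _ R(2)])

lemma R_add: "R (x + y) = R x + R y"
  by (rule S_inj) (simp_all add: R S_add subspace_add[OF V])

lemma R_scale: "R (r *\<^sub>R x) = r *\<^sub>R R x"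
  by (rule S_inj) (simp_all add: R S_scale subspace_scale[OF V])

lemma R_bound: "norm (R x) \<le> K * norm x"
  using K(2)[of "R x"] R by simp

text \<open>In the unknown \<open>h = S u\<close> the form is the inner product plus a bounded
  nonnegative form, hence coercive with constant 1.\<close>

lemma perturbed_solution: "\<exists>u\<in>V. \<forall>v\<in>V. ta u v = inner f v"
proof -
  have c_bound': "\<bar>c (R x) (R y)\<bar> \<le> Kc * K * K * norm x * norm y" for x y
  proof -
    have "\<bar>c (R x) (R y)\<bar> \<le> Kc * norm (R x) * norm (R y)" by (rule c_bound)
    also have "\<dots> \<le> Kc * (K * norm x) * (K * norm y)"
      using c_bound(1) K(1) by (intro mult_mono R_bound mult_left_mono) auto
    finally show ?thesis by (simp add: mult_ac)
  qed
  have "\<exists>h. \<forall>k. inner h k + c (R h) (R k) = inner f (R k)"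
  proof (rule coercive_form_representation[where \<alpha> = 1 and \<beta> = "1 + Kc * K * K" and K = "norm f * K"])
    show "\<bar>inner x y + c (R x) (R y)\<bar> \<le> (1 + Kc * K * K) * norm x * norm y" for x y
      using c_bound'[of x y] Cauchy_Schwarz_ineq2[of x y] by (simp add: algebra_simps abs_le_iff)
    show "\<bar>inner f (R x)\<bar> \<le> norm f * K * norm x" for x
      using Cauchy_Schwarz_ineq2[of f "R x"] mult_left_mono[OF R_bound, of "norm f" x] by (simp add: mult_ac)
    show "1 * (norm x)\<^sup>2 \<le> inner x x + c (R x) (R x)" for x
      by (simp add: c_nonneg power2_norm_eq_inner)
    show "inner x y + c (R x) (R y) = inner y x + c (R y) (R x)" for x y
      by (simp add: inner_commute c_sym)
  qed (auto simp: R_add R_scale inner_add_left inner_add_right c_add c_scale algebra_simps)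
  then obtain h where h: "\<And>k. inner h k + c (R h) (R k) = inner f (R k)" by blast
  show ?thesis
  proof (intro bexI ballI)
    fix v assume v: "v \<in> V"
    show "ta (R h) v = inner f v" using h[of "S v"] R R_S[OF v] by (simp add: ta_def)
  qed (rule R)
qed

text \<open>\<open>u\<close> solves the unperturbed problem with right-hand side \<open>f - c u\<close>, which is again in the Hilbert space.\<close>

lemma perturbed_regularity:
  assumes CA: "0 < CA" and reg: "\<And>f u. u \<in> V \<Longrightarrow> (\<And>v. v \<in> V \<Longrightarrow> energy S u v = inner f v) \<Longrightarrow> u \<in> W \<and> normW u \<le> CA * norm f"
  shows "\<exists>u\<in>V. u \<in> W \<and> (\<forall>v\<in>V. ta u v = inner f v) \<and> normW u \<le> CA * (1 + Kc * K * K) * norm f"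
proof -
  obtain u where u: "u \<in> V" "\<And>v. v \<in> V \<Longrightarrow> ta u v = inner f v" using perturbed_solution by blast
  \<comment> \<open>The equation is tested with \<open>u\<close> itself; the data term is dropped by
    its sign.\<close>
  have "norm (S u) * norm (S u) \<le> ta u u" unfolding ta_def using c_nonneg[of u] by (simp flip: power2_eq_square add: power2_norm_eq_inner)
  also have "\<dots> \<le> norm f * norm u" unfolding u(2)[OF u(1)] by (rule norm_cauchy_schwarz)
  also have "\<dots> \<le> norm f * (K * norm (S u))" using K(2)[OF u(1)] by (rule mult_left_mono) simp
  finally have "norm (S u) \<le> norm f * K" using K(1)
    by (cases "S u = 0") (auto simp: mult.assoc[symmetric])
  then have nu: "norm u \<le> K * (norm f * K)" using K(2)[OF u(1)] K(1) by (meson mult_left_mono less_imp_le order_trans)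
  have "\<exists>g. \<forall>v. inner g v = inner f v - c u v"
  proof (rule coercive_form_representation[where \<alpha> = 1 and \<beta> = 1 and K = "norm f + Kc * norm u"])
    show "\<bar>inner f x - c u x\<bar> \<le> (norm f + Kc * norm u) * norm x" for x
      using Cauchy_Schwarz_ineq2[of f x] c_bound(2)[of u x] by (simp add: algebra_simps abs_le_iff)
    show "inner f (x + y) - c u (x + y) = inner f x - c u x + (inner f y - c u y)" for x y
      unfolding c_sym[of u] by (simp add: c_add inner_add_right)
    show "inner f (r *\<^sub>R x) - c u (r *\<^sub>R x) = r * (inner f x - c u x)" for r x
      unfolding c_sym[of u] by (simp add: c_scale algebra_simps)
    show "inner x y = inner y x" for x y :: 'h by (rule inner_commute)
  qed (auto simp: inner_add_left power2_norm_eq_inner Cauchy_Schwarz_ineq2)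
  then obtain g where g: "\<And>v. inner g v = inner f v - c u v" by blast
  have gn: "norm g \<le> norm f + Kc * norm u"
  proof -
    have "norm g * norm g = inner f g - c u g" using g[of g] by (simp flip: power2_eq_square add: power2_norm_eq_inner)
    also have "\<dots> \<le> (norm f + Kc * norm u) * norm g"
      using norm_cauchy_schwarz[of f g] c_bound(2)[of u g] by (simp add: algebra_simps abs_le_iff)
    finally show ?thesis using c_bound(1) by (cases "g = 0") auto
  qed
  have uW: "u \<in> W" "normW u \<le> CA * norm g"
  proof -
    have "energy S u v = inner g v" if "v \<in> V" for v
      using u(2)[OF that] g[of v] by (simp add: ta_def energy_def)
    then show "u \<in> W" "normW u \<le> CA * norm g" using reg[OF u(1), of g] by auto
  qed
  note uW(2)
  also have "CA * norm g \<le> CA * (norm f + Kc * (K * (norm f * K)))"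
    using gn CA mult_left_mono[OF nu c_bound(1)] by (intro mult_left_mono) auto
  also have "\<dots> = CA * (1 + Kc * K * K) * norm f" by (simp add: algebra_simps)
  finally show ?thesis using u uW(1) by blast
qed

text \<open>Duality: the problem is solved with \<open>e\<close> itself as right-hand side, and
  orthogonality allows any element of \<open>U\<close> to be subtracted from the solution. Of the
  two factors \<open>1 + Kc * K * K\<close>, one comes from the regularity constant and one from the
  continuity of \<open>ta\<close> in the energy norm.\<close>

lemma aubin_nitsche:
  assumes CA: "0 < CA" and reg: "\<And>f u. u \<in> V \<Longrightarrow> (\<And>v. v \<in> V \<Longrightarrow> energy S u v = inner f v) \<Longrightarrow> u \<in> W \<and> normW u \<le> CA * norm f"
    and U: "U \<subseteq> V" "0 \<in> U" and \<psi>: "0 \<le> \<psi>"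
    and approx: "\<And>w. w \<in> W \<Longrightarrow> (INF v\<in>U. energy_norm S (w - v)) \<le> sqrt \<psi> * normW w"
    and e: "e \<in> V" "\<And>v. v \<in> U \<Longrightarrow> ta e v = 0"
  shows "(norm e)\<^sup>2 \<le> (CA * (1 + Kc * K * K)\<^sup>2)\<^sup>2 * \<psi> * ta e e"
proof -
  let ?\<kappa> = "1 + Kc * K * K"
  have \<kappa>: "1 \<le> ?\<kappa>" using c_bound(1) K(1) by simp
  define E where "E = sqrt (ta e e)"
  have Se: "norm (S e) \<le> E" unfolding E_def ta_def norm_eq_sqrt_inner using c_nonneg[of e] by simp
  have E0: "0 \<le> ta e e" unfolding ta_def using c_nonneg[of e] by simp
  obtain u where u: "u \<in> V" "u \<in> W" "\<And>v. v \<in> V \<Longrightarrow> ta u v = inner e v" "normW u \<le> CA * ?\<kappa> * norm e"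
    using perturbed_regularity[OF CA reg, of e] by blast
  have "norm e \<le> CA * ?\<kappa>\<^sup>2 * sqrt \<psi> * E"
  proof (cases "E = 0")
    case True
    then have "e = 0" using Se K(2)[OF e(1)] by simp
    then show ?thesis using CA \<psi> \<kappa> True by simp
  next
    case False
    then have E: "0 < E" using Se norm_ge_zero[of "S e"] by linarith
    \<comment> \<open>A lower bound for every distance to \<open>U\<close>, so that the infimum in
      the approximation hypothesis can be used without an attained minimum.\<close>
    have "(norm e)\<^sup>2 / (?\<kappa> * E) \<le> energy_norm S (u - v)" if v: "v \<in> U" for v
    proof -
      have vV: "v \<in> V" "u - v \<in> V" using v U u(1) V subspace_diff by blast+
      have "ta (u - v) e = ta u e - ta v e"
        using vV u(1) c_add[of "u - v" v e] by (simp add: ta_def S_diff inner_diff_left)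
      also have "ta v e = 0" using e(2)[OF v] by (simp add: ta_def inner_commute c_sym)
      finally have "(norm e)\<^sup>2 = ta (u - v) e" using u(3)[OF e(1)] by (simp add: power2_norm_eq_inner)
      also have "\<dots> \<le> norm (S (u - v)) * norm (S e) + Kc * norm (u - v) * norm e"
        unfolding ta_def using norm_cauchy_schwarz[of "S (u - v)" "S e"] c_bound(2)[of "u - v" e] by linarith
      also have "\<dots> \<le> norm (S (u - v)) * norm (S e) + Kc * (K * norm (S (u - v))) * (K * norm (S e))"
        using c_bound(1) K(1) K(2)[OF vV(2)] K(2)[OF e(1)] by (intro add_left_mono mult_mono) auto
      also have "\<dots> = ?\<kappa> * norm (S (u - v)) * norm (S e)" by (simp add: algebra_simps)
      also have "\<dots> \<le> ?\<kappa> * norm (S (u - v)) * E" using \<kappa> Se by (intro mult_left_mono) auto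
      finally have "(norm e)\<^sup>2 \<le> norm (S (u - v)) * (?\<kappa> * E)" by (simp only: mult_ac)
      then show ?thesis using \<kappa> E
        by (simp add: energy_norm_def energy_def flip: norm_eq_sqrt_inner) (subst pos_divide_le_eq; simp add: mult_ac)
    qed
    then have "(norm e)\<^sup>2 / (?\<kappa> * E) \<le> (INF v\<in>U. energy_norm S (u - v))" using U(2) by (intro cINF_greatest) auto
    also have "\<dots> \<le> sqrt \<psi> * normW u" by (rule approx[OF u(2)])
    also have "\<dots> \<le> sqrt \<psi> * (CA * ?\<kappa> * norm e)" using u(4) \<psi> by (intro mult_left_mono) auto
    finally have "(norm e)\<^sup>2 / (?\<kappa> * E) \<le> sqrt \<psi> * (CA * ?\<kappa> * norm e)" .
    moreover have "0 < ?\<kappa> * E" using \<kappa> E by (intro mult_pos_pos) auto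
    ultimately have "(norm e)\<^sup>2 \<le> sqrt \<psi> * (CA * ?\<kappa> * norm e) * (?\<kappa> * E)"
      by (simp only: pos_divide_le_eq)
    then have "norm e * norm e \<le> norm e * (CA * ?\<kappa>\<^sup>2 * sqrt \<psi> * E)"
      by (simp only: power2_eq_square mult_ac)
    then show ?thesis using CA \<psi> \<kappa> E by (cases "e = 0") auto
  qed
  then have "(norm e)\<^sup>2 \<le> (CA * ?\<kappa>\<^sup>2 * sqrt \<psi> * E)\<^sup>2" by (rule power_mono) simp
  also have "\<dots> = (CA * ?\<kappa>\<^sup>2)\<^sup>2 * \<psi> * ta e e" using \<psi> E0 by (simp add: power_mult_distrib E_def)
  finally show ?thesis .
qed

end

section \<open>Random vectors spanned by independent Gaussian sources\<close>

context prob_space begin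

definition sq_int :: "('a \<Rightarrow> real) \<Rightarrow> bool" where
  "sq_int X \<longleftrightarrow> X \<in> borel_measurable M \<and> integrable M (\<lambda>\<omega>. (X \<omega>)\<^sup>2)"

lemma sq_int_integrable: "sq_int X \<Longrightarrow> integrable M X"
  unfolding sq_int_def using square_integrable_imp_integrable by blast

lemma sq_int_mult:
  assumes "sq_int X" "sq_int Y" shows "integrable M (\<lambda>\<omega>. X \<omega> * Y \<omega>)"
proof (rule Bochner_Integration.integrable_bound)
  show "integrable M (\<lambda>\<omega>. (X \<omega>)\<^sup>2 + (Y \<omega>)\<^sup>2)" using assms by (simp add: sq_int_def)
  have "\<bar>x * y\<bar> \<le> x\<^sup>2 + y\<^sup>2" for x y :: real
    using sum_squares_bound[of "\<bar>x\<bar>" "\<bar>y\<bar>"] abs_ge_zero[of "x * y"]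
    unfolding mult.assoc abs_mult[symmetric] power2_abs by linarith
  then show "AE \<omega> in M. norm (X \<omega> * Y \<omega>) \<le> norm ((X \<omega>)\<^sup>2 + (Y \<omega>)\<^sup>2)" by (intro AE_I2) auto
qed (use assms in \<open>auto simp: sq_int_def\<close>)

lemma sq_int_const: "sq_int (\<lambda>_. c)"
  by (simp add: sq_int_def)

lemma sq_int_add:
  assumes "sq_int X" "sq_int Y" shows "sq_int (\<lambda>\<omega>. X \<omega> + Y \<omega>)"
  using assms sq_int_mult[OF assms]
  by (auto simp: sq_int_def power2_sum mult.assoc intro!: Bochner_Integration.integrable_add)

lemma sq_int_cmult: "sq_int X \<Longrightarrow> sq_int (\<lambda>\<omega>. c * X \<omega>)"
  by (auto simp: sq_int_def power_mult_distrib)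

lemma sq_int_cong: "sq_int X \<Longrightarrow> (\<And>\<omega>. \<omega> \<in> space M \<Longrightarrow> X \<omega> = Y \<omega>) \<Longrightarrow> sq_int Y"
  unfolding sq_int_def by (auto cong: measurable_cong Bochner_Integration.integrable_cong)

lemma cov_cong:
  assumes "\<And>\<omega>. \<omega> \<in> space M \<Longrightarrow> X \<omega> = X' \<omega>" "\<And>\<omega>. \<omega> \<in> space M \<Longrightarrow> Y \<omega> = Y' \<omega>"
  shows "cov M X Y = cov M X' Y'"
proof -
  have "expectation X = expectation X'" "expectation Y = expectation Y'"
    using assms by (auto intro!: Bochner_Integration.integral_cong)
  then show ?thesis using assms unfolding cov_def by (auto intro!: Bochner_Integration.integral_cong)
qed

lemma cov_eq:
  assumes "sq_int X" "sq_int Y"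
  shows "cov M X Y = expectation (\<lambda>\<omega>. X \<omega> * Y \<omega>) - expectation X * expectation Y"
proof -
  have "cov M X Y = expectation (\<lambda>\<omega>. X \<omega> * Y \<omega> - expectation X * Y \<omega> - X \<omega> * expectation Y + expectation X * expectation Y)"
    unfolding cov_def by (rule arg_cong[where f = expectation]) (auto simp: algebra_simps)
  also have "\<dots> = expectation (\<lambda>\<omega>. X \<omega> * Y \<omega>) - expectation X * expectation Y"
    using sq_int_mult[OF assms] assms[THEN sq_int_integrable] by (simp add: prob_space)
  finally show ?thesis .
qed

lemma cov_sym: "cov M X Y = cov M Y X"
  by (simp add: cov_def mult.commute)

lemma cov_const: "cov M (\<lambda>_. c) Y = 0" "cov M Y (\<lambda>_. c) = 0"
  by (simp_all add: cov_def prob_space)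

lemma cov_add_left:
  assumes "sq_int X" "sq_int Y" "sq_int Z"
  shows "cov M (\<lambda>\<omega>. X \<omega> + Y \<omega>) Z = cov M X Z + cov M Y Z"
  using assms assms[THEN sq_int_integrable] sq_int_mult[of X Z] sq_int_mult[of Y Z]
  by (simp add: cov_eq sq_int_add distrib_right)

lemma cov_add_right:
  assumes "sq_int X" "sq_int Y" "sq_int Z"
  shows "cov M Z (\<lambda>\<omega>. X \<omega> + Y \<omega>) = cov M Z X + cov M Z Y"
  using cov_add_left[OF assms] by (simp add: cov_sym)

lemma cov_cmult_left: "cov M (\<lambda>\<omega>. c * X \<omega>) Y = c * cov M X Y"
proof -
  have "(c * x - c * e) * z = c * ((x - e) * z)" for x e z :: real
    by (simp add: algebra_simps)
  then show ?thesis by (simp only: cov_def integral_mult_right_zero)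
qed

end

lemma normal_dist_moments:
  assumes "0 \<le> v"
  shows "integrable (normal_dist m v) (\<lambda>x. x)" "integrable (normal_dist m v) (\<lambda>x. x\<^sup>2)"
    "(\<integral>x. x \<partial>normal_dist m v) = m" "(\<integral>x. (x - m)\<^sup>2 \<partial>normal_dist m v) = v"
proof -
  have "integrable (normal_dist m v) (\<lambda>x. x) \<and> integrable (normal_dist m v) (\<lambda>x. (x - m)\<^sup>2) \<and>
    (\<integral>x. x \<partial>normal_dist m v) = m \<and> (\<integral>x. (x - m)\<^sup>2 \<partial>normal_dist m v) = v"
  proof (cases "v = 0")
    case True
    have "integrable (return borel m) f" if "f \<in> borel_measurable borel" for f :: "real \<Rightarrow> real"
      using that by (simp add: integrable_iff_bounded nn_integral_return)
    note i = this
    have "integrable (return borel m) (\<lambda>x. x)" "integrable (return borel m) (\<lambda>x. (x - m)\<^sup>2)"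
      by (rule i, measurable)+
    moreover have "(\<integral>x. x \<partial>return borel m) = m" "(\<integral>x. (x - m)\<^sup>2 \<partial>return borel m) = 0"
      by (subst integral_return; simp)+
    ultimately show ?thesis using True by (simp only: normal_dist_def if_True simp_thms)
  next
    case False
    then have s: "0 < sqrt v" using assms by simp
    have "(\<integral>x. normal_density m (sqrt v) x * (x - m)\<^sup>2 \<partial>lborel) = v"
      using integral_normal_moment_even[OF s, of m 1] assms by (simp add: fact_numeral)
    then show ?thesis
      using False integrable_normal_moment[OF s, of m 2] integrable_normal_moment_nz_1[OF s, of m] integral_normal_moment_nz_1[OF s, of m]
      by (simp add: normal_dist_def integrable_density integral_density)
  qed
  then have *: "integrable (normal_dist m v) (\<lambda>x. x)" "integrable (normal_dist m v) (\<lambda>x. (x - m)\<^sup>2)"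
    "(\<integral>x. x \<partial>normal_dist m v) = m" "(\<integral>x. (x - m)\<^sup>2 \<partial>normal_dist m v) = v" by auto
  have "prob_space (normal_dist m v)"
    using assms by (auto simp: normal_dist_def intro: prob_space_return prob_space_normal_density)
  then interpret N: prob_space "normal_dist m v" .
  have "integrable (normal_dist m v) (\<lambda>x. (x - m)\<^sup>2 + (2 * m) * x - m\<^sup>2)"
    using * by (intro Bochner_Integration.integrable_diff Bochner_Integration.integrable_add integrable_mult_right N.integrable_const)
  moreover have "(x - m)\<^sup>2 + (2 * m) * x - m\<^sup>2 = x\<^sup>2" for x by (simp add: power2_eq_square algebra_simps)
  ultimately show "integrable (normal_dist m v) (\<lambda>x. x\<^sup>2)" by simp
  show "integrable (normal_dist m v) (\<lambda>x. x)" "(\<integral>x. x \<partial>normal_dist m v) = m" "(\<integral>x. (x - m)\<^sup>2 \<partial>normal_dist m v) = v"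
    by (fact *)+
qed

text \<open>\<open>gaussian_rv\<close> prescribes the laws of single functionals. The joint
  covariance of two of them is recovered by polarisation, from the variances of \<open>h\<close>,
  \<open>k\<close> and \<open>h + k\<close>.\<close>

lemma (in prob_space) gaussian_rv_moments:
  assumes X: "gaussian_rv M d X \<mu> \<Sigma>" and h: "h \<in> carrier_vec d" and k: "k \<in> carrier_vec d"
  shows "sq_int (\<lambda>\<omega>. h \<bullet> X \<omega>)" "expectation (\<lambda>\<omega>. h \<bullet> X \<omega>) = h \<bullet> \<mu>"
    "cov M (\<lambda>\<omega>. h \<bullet> X \<omega>) (\<lambda>\<omega>. k \<bullet> X \<omega>) = h \<bullet> (\<Sigma> *\<^sub>v k)"
proof -
  have psd: "pos_semidef d \<Sigma>" and \<mu>: "\<mu> \<in> carrier_vec d" and c: "\<And>\<omega>. \<omega> \<in> space M \<Longrightarrow> X \<omega> \<in> carrier_vec d"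
    and me: "\<And>i. i < d \<Longrightarrow> (\<lambda>\<omega>. vec_index (X \<omega>) i) \<in> borel_measurable M"
    and dist: "\<And>v. v \<in> carrier_vec d \<Longrightarrow> distr M borel (\<lambda>\<omega>. v \<bullet> X \<omega>) = normal_dist (v \<bullet> \<mu>) (v \<bullet> (\<Sigma> *\<^sub>v v))"
    using X by (auto simp: gaussian_rv_def)
  have meas: "(\<lambda>\<omega>. v \<bullet> X \<omega>) \<in> borel_measurable M" for v
  proof -
    have "(\<lambda>\<omega>. \<Sum>i<d. vec_index v i * vec_index (X \<omega>) i) \<in> borel_measurable M" using me by measurable
    then show ?thesis
      by (rule measurable_cong[THEN iffD1, rotated]) (use carrier_vecD[OF c] in \<open>auto simp: scalar_prod_def atLeast0LessThan\<close>)
  qed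
  have nn: "0 \<le> v \<bullet> (\<Sigma> *\<^sub>v v)" if "v \<in> carrier_vec d" for v by (rule pos_semidefD(5)[OF psd that])
  have sq: "sq_int (\<lambda>\<omega>. v \<bullet> X \<omega>)" if v: "v \<in> carrier_vec d" for v
    unfolding sq_int_def using integrable_distr[OF meas[of v], of "\<lambda>x. x\<^sup>2"] normal_dist_moments(2)[OF nn[OF v]] meas[of v]
    by (simp add: dist[OF v])
  have ex: "expectation (\<lambda>\<omega>. v \<bullet> X \<omega>) = v \<bullet> \<mu>" if v: "v \<in> carrier_vec d" for v
    using integral_distr[OF meas[of v], of "\<lambda>x. x"] normal_dist_moments(3)[OF nn[OF v], of "v \<bullet> \<mu>"] by (simp add: dist[OF v])
  have var: "cov M (\<lambda>\<omega>. v \<bullet> X \<omega>) (\<lambda>\<omega>. v \<bullet> X \<omega>) = v \<bullet> (\<Sigma> *\<^sub>v v)" if v: "v \<in> carrier_vec d" for v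
    unfolding cov_def ex[OF v]
    using integral_distr[OF meas[of v], of "\<lambda>x. (x - v \<bullet> \<mu>)\<^sup>2"] normal_dist_moments(4)[OF nn[OF v], of "v \<bullet> \<mu>"]
    by (simp add: dist[OF v] power2_eq_square)
  show "sq_int (\<lambda>\<omega>. h \<bullet> X \<omega>)" "expectation (\<lambda>\<omega>. h \<bullet> X \<omega>) = h \<bullet> \<mu>" by (fact sq[OF h] ex[OF h])+
  note [simp] = pos_semidefD(3,4)[OF psd] carrier_vecD[OF h] carrier_vecD[OF k]
  have hk: "h + k \<in> carrier_vec d" using h k by simp
  have e: "(h + k) \<bullet> X \<omega> = h \<bullet> X \<omega> + k \<bullet> X \<omega>" if "\<omega> \<in> space M" for \<omega>
    using c[OF that] by (simp add: sp)
  have "cov M (\<lambda>\<omega>. (h + k) \<bullet> X \<omega>) (\<lambda>\<omega>. (h + k) \<bullet> X \<omega>) = cov M (\<lambda>\<omega>. h \<bullet> X \<omega> + k \<bullet> X \<omega>) (\<lambda>\<omega>. h \<bullet> X \<omega> + k \<bullet> X \<omega>)"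
    by (rule cov_cong) (auto simp: e)
  then have "(h + k) \<bullet> (\<Sigma> *\<^sub>v (h + k)) = h \<bullet> (\<Sigma> *\<^sub>v h) + 2 * cov M (\<lambda>\<omega>. h \<bullet> X \<omega>) (\<lambda>\<omega>. k \<bullet> X \<omega>) + k \<bullet> (\<Sigma> *\<^sub>v k)"
    using cov_sym[of "\<lambda>\<omega>. k \<bullet> X \<omega>" "\<lambda>\<omega>. h \<bullet> X \<omega>"]
    unfolding var[OF hk] by (simp add: cov_add_left cov_add_right sq_int_add sq[OF h] sq[OF k] var[OF h] var[OF k])
  moreover have "k \<bullet> (\<Sigma> *\<^sub>v h) = h \<bullet> (\<Sigma> *\<^sub>v k)" by (rule sp_sym[OF pos_semidefD(2)[OF psd]]) simp_all
  ultimately show "cov M (\<lambda>\<omega>. h \<bullet> X \<omega>) (\<lambda>\<omega>. k \<bullet> X \<omega>) = h \<bullet> (\<Sigma> *\<^sub>v k)"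
    by (simp add: mv sp)
qed

section \<open>Linear combinations of independent sources\<close>

locale gaussian_sources = prob_space M for M :: "'w measure" +
  fixes I :: "'s set" and d :: "'s \<Rightarrow> nat" and Z :: "'s \<Rightarrow> 'w \<Rightarrow> rvec" and m :: "'s \<Rightarrow> rvec" and \<Sigma> :: "'s \<Rightarrow> rmat"
  assumes gauss: "s \<in> I \<Longrightarrow> gaussian_rv M (d s) (Z s) (m s) (\<Sigma> s)"
    and indep: "indep_vars (\<lambda>s. Pi\<^sub>M {..<d s} (\<lambda>_. borel)) (\<lambda>s \<omega>. restrict (vec_index (Z s \<omega>)) {..<d s}) I"
begin

lemma Z_carrier: "s \<in> I \<Longrightarrow> \<omega> \<in> space M \<Longrightarrow> Z s \<omega> \<in> carrier_vec (d s)"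
  using gauss by (auto simp: gaussian_rv_def)

text \<open>Independence is given for the coordinate tuples; applying a measurable functional to
  each of them preserves it, and the expectation of the product then factorises.\<close>

lemma sources_uncorrelated:
  assumes s: "s \<in> I" "t \<in> I" "s \<noteq> t" and h: "h \<in> carrier_vec (d s)" "k \<in> carrier_vec (d t)"
  shows "cov M (\<lambda>\<omega>. h \<bullet> Z s \<omega>) (\<lambda>\<omega>. k \<bullet> Z t \<omega>) = 0"
proof -
  \<comment> \<open>The composition rule acts on the whole family, so a functional is chosen for
    each label: \<open>h\<close> at \<open>s\<close> and \<open>k\<close> elsewhere, in particular
    at \<open>t\<close>.\<close>
  define g where "g = (\<lambda>r. if r = s then h else k)"
  let ?Y = "\<lambda>r \<omega>. \<Sum>i<d r. vec_index (g r) i * restrict (vec_index (Z r \<omega>)) {..<d r} i"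
  have "indep_vars (\<lambda>_. borel) ?Y I"
    by (rule indep_vars_compose2[OF indep]) measurable
  then have ind: "indep_vars (\<lambda>_. borel) ?Y {s, t}" by (rule indep_vars_subset) (use s in auto)
  have es: "?Y s \<omega> = h \<bullet> Z s \<omega>" if "\<omega> \<in> space M" for \<omega>
    using Z_carrier[OF s(1) that] by (simp add: g_def scalar_prod_def atLeast0LessThan)
  have et: "?Y t \<omega> = k \<bullet> Z t \<omega>" if "\<omega> \<in> space M" for \<omega>
    using Z_carrier[OF s(2) that] s(3) by (simp add: g_def scalar_prod_def atLeast0LessThan)
  note sq = gaussian_rv_moments(1)[OF gauss[OF s(1)] h(1) h(1)] gaussian_rv_moments(1)[OF gauss[OF s(2)] h(2) h(2)]
  have sqY: "sq_int (?Y s)" "sq_int (?Y t)"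
    using sq_int_cong[OF sq(1), of "?Y s"] sq_int_cong[OF sq(2), of "?Y t"] es et by auto
  have "expectation (\<lambda>\<omega>. \<Prod>r\<in>{s, t}. ?Y r \<omega>) = (\<Prod>r\<in>{s, t}. expectation (?Y r))"
    by (rule indep_vars_lebesgue_integral) (use ind sqY[THEN sq_int_integrable] in auto)
  then have "expectation (\<lambda>\<omega>. ?Y s \<omega> * ?Y t \<omega>) = expectation (?Y s) * expectation (?Y t)"
    using s(3) by simp
  then have "cov M (?Y s) (?Y t) = 0" using cov_eq[OF sqY] by simp
  moreover have "cov M (?Y s) (?Y t) = cov M (\<lambda>\<omega>. h \<bullet> Z s \<omega>) (\<lambda>\<omega>. k \<bullet> Z t \<omega>)"
    by (rule cov_cong) (use es et in auto)
  ultimately show ?thesis by simp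
qed

text \<open>Closure under \<open>congr\<close> is needed because scalar products are linear only on vectors of the right dimension, which
  is known on \<open>space M\<close> alone.\<close>

inductive_set lin_span :: "'s set \<Rightarrow> ('w \<Rightarrow> real) set" for T :: "'s set" where
  const: "(\<lambda>_. c) \<in> lin_span T"
| source: "s \<in> T \<Longrightarrow> s \<in> I \<Longrightarrow> h \<in> carrier_vec (d s) \<Longrightarrow> (\<lambda>\<omega>. h \<bullet> Z s \<omega>) \<in> lin_span T"
| add: "X \<in> lin_span T \<Longrightarrow> Y \<in> lin_span T \<Longrightarrow> (\<lambda>\<omega>. X \<omega> + Y \<omega>) \<in> lin_span T"
| congr: "X \<in> lin_span T \<Longrightarrow> (\<And>\<omega>. \<omega> \<in> space M \<Longrightarrow> X \<omega> = Y \<omega>) \<Longrightarrow> Y \<in> lin_span T"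

lemma lin_span_mono: "X \<in> lin_span T \<Longrightarrow> T \<subseteq> T' \<Longrightarrow> X \<in> lin_span T'"
  by (induction rule: lin_span.induct) (auto intro: lin_span.intros)

lemma lin_span_sq_int: "X \<in> lin_span T \<Longrightarrow> sq_int X"
proof (induction rule: lin_span.induct)
  case (congr X Y)
  then show ?case using sq_int_cong[of X Y] by blast
qed (auto intro: sq_int_const sq_int_add gaussian_rv_moments(1)[OF gauss])

lemma lin_span_source_uncorrelated:
  assumes "Y \<in> lin_span T'" "s \<in> I" "s \<notin> T'" "h \<in> carrier_vec (d s)"
  shows "cov M (\<lambda>\<omega>. h \<bullet> Z s \<omega>) Y = 0"
  using assms
proof (induction rule: lin_span.induct)
  case (const c)
  then show ?case by (simp add: cov_const)
next
  case (source t k)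
  then show ?case by (intro sources_uncorrelated) auto
next
  case (add X Y)
  then show ?case using lin_span_sq_int gaussian_rv_moments(1)[OF gauss] by (subst cov_add_right) auto
next
  case (congr X Y)
  then show ?case using cov_cong[of "\<lambda>\<omega>. h \<bullet> Z s \<omega>" "\<lambda>\<omega>. h \<bullet> Z s \<omega>" X Y] by simp
qed

lemma lin_span_uncorrelated:
  assumes "X \<in> lin_span T" "Y \<in> lin_span T'" "T \<inter> T' = {}"
  shows "cov M X Y = 0"
  using assms
proof (induction rule: lin_span.induct)
  case (const c)
  then show ?case by (simp add: cov_const)
next
  case (source t k)
  then show ?case by (intro lin_span_source_uncorrelated) auto
next
  case (add X X')
  then show ?case using lin_span_sq_int by (subst cov_add_left) auto
next
  case (congr X X')
  then show ?case using cov_cong[of X X' Y Y] by simp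
qed

text \<open>Bookkeeping for second moments: mean \<open>\<mu>\<close>, covariance form
  \<open>Q\<close>, and sources \<open>T\<close> spanning all functionals. \<open>Q\<close> is a
  function rather than a matrix, so that a linear map acts by substituting transposed vectors;
  \<open>T\<close> turns disjointness into vanishing cross covariance.\<close>

definition rvc :: "nat \<Rightarrow> ('w \<Rightarrow> rvec) \<Rightarrow> rvec \<Rightarrow> (rvec \<Rightarrow> rvec \<Rightarrow> real) \<Rightarrow> 's set \<Rightarrow> bool" where
  "rvc n Y \<mu> Q T \<longleftrightarrow> \<mu> \<in> carrier_vec n \<and> (\<forall>\<omega>\<in>space M. Y \<omega> \<in> carrier_vec n)
     \<and> (\<forall>g\<in>carrier_vec n. (\<lambda>\<omega>. g \<bullet> Y \<omega>) \<in> lin_span T \<and> expectation (\<lambda>\<omega>. g \<bullet> Y \<omega>) = g \<bullet> \<mu>)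
     \<and> (\<forall>g\<in>carrier_vec n. \<forall>h\<in>carrier_vec n. cov M (\<lambda>\<omega>. g \<bullet> Y \<omega>) (\<lambda>\<omega>. h \<bullet> Y \<omega>) = Q g h)"

lemma rvcD:
  assumes "rvc n Y \<mu> Q T"
  shows "\<mu> \<in> carrier_vec n" "\<omega> \<in> space M \<Longrightarrow> Y \<omega> \<in> carrier_vec n"
    "g \<in> carrier_vec n \<Longrightarrow> (\<lambda>\<omega>. g \<bullet> Y \<omega>) \<in> lin_span T"
    "g \<in> carrier_vec n \<Longrightarrow> expectation (\<lambda>\<omega>. g \<bullet> Y \<omega>) = g \<bullet> \<mu>"
    "g \<in> carrier_vec n \<Longrightarrow> h \<in> carrier_vec n \<Longrightarrow> cov M (\<lambda>\<omega>. g \<bullet> Y \<omega>) (\<lambda>\<omega>. h \<bullet> Y \<omega>) = Q g h"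
  using assms by (auto simp: rvc_def)

lemma rvc_cong:
  assumes Y: "rvc n Y \<mu> Q T" and "\<And>\<omega>. \<omega> \<in> space M \<Longrightarrow> Y \<omega> = Y' \<omega>" "\<mu> = \<mu>'"
    "\<And>g h. g \<in> carrier_vec n \<Longrightarrow> h \<in> carrier_vec n \<Longrightarrow> Q g h = Q' g h" "T \<subseteq> T'"
  shows "rvc n Y' \<mu>' Q' T'"
proof -
  have "expectation (\<lambda>\<omega>. g \<bullet> Y \<omega>) = expectation (\<lambda>\<omega>. g \<bullet> Y' \<omega>)" for g
    using assms(2) by (intro Bochner_Integration.integral_cong) auto
  moreover have "cov M (\<lambda>\<omega>. g \<bullet> Y \<omega>) (\<lambda>\<omega>. h \<bullet> Y \<omega>) = cov M (\<lambda>\<omega>. g \<bullet> Y' \<omega>) (\<lambda>\<omega>. h \<bullet> Y' \<omega>)" for g h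
    using assms(2) by (intro cov_cong) auto
  moreover have "(\<lambda>\<omega>. g \<bullet> Y' \<omega>) \<in> lin_span T'" if "g \<in> carrier_vec n" for g
    by (rule lin_span.congr[OF lin_span_mono[OF rvcD(3)[OF Y that] assms(5)]]) (use assms(2) in auto)
  ultimately show ?thesis using assms rvcD[OF Y] unfolding rvc_def by metis
qed

lemma rvc_zero: "rvc n (\<lambda>_. 0\<^sub>v n) (0\<^sub>v n) (\<lambda>_ _. 0) {}"
  by (auto simp: rvc_def sp cov_const intro: lin_span.intros)

lemma rvc_source: "s \<in> I \<Longrightarrow> rvc (d s) (Z s) (m s) (\<lambda>g h. g \<bullet> (\<Sigma> s *\<^sub>v h)) {s}"
  using gaussian_rv_moments[OF gauss[of s]] Z_carrier[of s] gauss[of s]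
  by (auto simp: rvc_def gaussian_rv_def intro: lin_span.intros)

lemma rvc_mult:
  assumes Y: "rvc n Y \<mu> Q T" and B: "B \<in> carrier_mat k n"
  shows "rvc k (\<lambda>\<omega>. B *\<^sub>v Y \<omega>) (B *\<^sub>v \<mu>) (\<lambda>g h. Q (transpose_mat B *\<^sub>v g) (transpose_mat B *\<^sub>v h)) T"
proof -
  have t: "transpose_mat B *\<^sub>v g \<in> carrier_vec n" if "g \<in> carrier_vec k" for g using B that by auto
  have e: "g \<bullet> (B *\<^sub>v Y \<omega>) = (transpose_mat B *\<^sub>v g) \<bullet> Y \<omega>" if "g \<in> carrier_vec k" "\<omega> \<in> space M" for g \<omega>
    using rvcD(2)[OF Y that(2)] B that(1) by (intro sp_transpose) auto
  have "(\<lambda>\<omega>. g \<bullet> (B *\<^sub>v Y \<omega>)) \<in> lin_span T" if g: "g \<in> carrier_vec k" for g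
    by (rule lin_span.congr[OF rvcD(3)[OF Y t[OF g]]]) (simp add: e[OF g])
  moreover have "expectation (\<lambda>\<omega>. g \<bullet> (B *\<^sub>v Y \<omega>)) = g \<bullet> (B *\<^sub>v \<mu>)" if g: "g \<in> carrier_vec k" for g
  proof -
    have "expectation (\<lambda>\<omega>. g \<bullet> (B *\<^sub>v Y \<omega>)) = (transpose_mat B *\<^sub>v g) \<bullet> \<mu>"
      unfolding rvcD(4)[OF Y t[OF g], symmetric] by (intro Bochner_Integration.integral_cong) (auto simp: e[OF g])
    also have "\<dots> = g \<bullet> (B *\<^sub>v \<mu>)" using rvcD(1)[OF Y] B g by (intro sp_transpose[symmetric]) auto
    finally show ?thesis .
  qed
  moreover have "cov M (\<lambda>\<omega>. g \<bullet> (B *\<^sub>v Y \<omega>)) (\<lambda>\<omega>. h \<bullet> (B *\<^sub>v Y \<omega>)) = Q (transpose_mat B *\<^sub>v g) (transpose_mat B *\<^sub>v h)"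
    if "g \<in> carrier_vec k" "h \<in> carrier_vec k" for g h
    unfolding rvcD(5)[OF Y t[OF that(1)] t[OF that(2)], symmetric] by (rule cov_cong) (auto simp: e that)
  ultimately show ?thesis using rvcD(1,2)[OF Y] B unfolding rvc_def by auto
qed

lemma rvc_add:
  assumes Y: "rvc n Y \<mu> Q T" and Y': "rvc n Y' \<mu>' Q' T'" and disj: "T \<inter> T' = {}"
  shows "rvc n (\<lambda>\<omega>. Y \<omega> + Y' \<omega>) (\<mu> + \<mu>') (\<lambda>g h. Q g h + Q' g h) (T \<union> T')"
proof -
  have e: "g \<bullet> (Y \<omega> + Y' \<omega>) = g \<bullet> Y \<omega> + g \<bullet> Y' \<omega>" if "\<omega> \<in> space M" for g \<omega>
    using rvcD(2)[OF Y that] rvcD(2)[OF Y' that] by (intro sp_addr) auto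
  have "(\<lambda>\<omega>. g \<bullet> (Y \<omega> + Y' \<omega>)) \<in> lin_span (T \<union> T')" if g: "g \<in> carrier_vec n" for g
  proof (rule lin_span.congr)
    show "(\<lambda>\<omega>. g \<bullet> Y \<omega> + g \<bullet> Y' \<omega>) \<in> lin_span (T \<union> T')"
      by (intro lin_span.add lin_span_mono[OF rvcD(3)[OF Y g]] lin_span_mono[OF rvcD(3)[OF Y' g]]) auto
  qed (simp add: e)
  moreover have "expectation (\<lambda>\<omega>. g \<bullet> (Y \<omega> + Y' \<omega>)) = g \<bullet> (\<mu> + \<mu>')" if g: "g \<in> carrier_vec n" for g
  proof -
    have "expectation (\<lambda>\<omega>. g \<bullet> (Y \<omega> + Y' \<omega>)) = expectation (\<lambda>\<omega>. g \<bullet> Y \<omega> + g \<bullet> Y' \<omega>)"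
      by (intro Bochner_Integration.integral_cong) (auto simp: e)
    also have "\<dots> = g \<bullet> \<mu> + g \<bullet> \<mu>'"
      using sq_int_integrable[OF lin_span_sq_int[OF rvcD(3)[OF Y g]]] sq_int_integrable[OF lin_span_sq_int[OF rvcD(3)[OF Y' g]]]
      by (simp add: rvcD(4)[OF Y g] rvcD(4)[OF Y' g])
    finally show ?thesis using rvcD(1)[OF Y] rvcD(1)[OF Y'] by (simp add: sp)
  qed
  moreover have "cov M (\<lambda>\<omega>. g \<bullet> (Y \<omega> + Y' \<omega>)) (\<lambda>\<omega>. h \<bullet> (Y \<omega> + Y' \<omega>)) = Q g h + Q' g h"
    if g: "g \<in> carrier_vec n" and h: "h \<in> carrier_vec n" for g h
  proof -
    note sq = lin_span_sq_int[OF rvcD(3)[OF Y g]] lin_span_sq_int[OF rvcD(3)[OF Y h]]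
      lin_span_sq_int[OF rvcD(3)[OF Y' g]] lin_span_sq_int[OF rvcD(3)[OF Y' h]]
    have z: "cov M (\<lambda>\<omega>. g \<bullet> Y \<omega>) (\<lambda>\<omega>. h \<bullet> Y' \<omega>) = 0" "cov M (\<lambda>\<omega>. g \<bullet> Y' \<omega>) (\<lambda>\<omega>. h \<bullet> Y \<omega>) = 0"
      using disj by (auto intro!: lin_span_uncorrelated[OF rvcD(3)[OF Y g] rvcD(3)[OF Y' h]]
          lin_span_uncorrelated[OF rvcD(3)[OF Y' g] rvcD(3)[OF Y h]])
    have "cov M (\<lambda>\<omega>. g \<bullet> (Y \<omega> + Y' \<omega>)) (\<lambda>\<omega>. h \<bullet> (Y \<omega> + Y' \<omega>)) =
        cov M (\<lambda>\<omega>. g \<bullet> Y \<omega> + g \<bullet> Y' \<omega>) (\<lambda>\<omega>. h \<bullet> Y \<omega> + h \<bullet> Y' \<omega>)"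
      by (rule cov_cong) (auto simp: e)
    also have "\<dots> = Q g h + Q' g h"
      using sq by (simp add: cov_add_left cov_add_right sq_int_add z rvcD(5)[OF Y g h] rvcD(5)[OF Y' g h])
    finally show ?thesis .
  qed
  ultimately show ?thesis using rvcD(1,2)[OF Y] rvcD(1,2)[OF Y'] unfolding rvc_def by auto
qed

lemma rvc_const: "b \<in> carrier_vec n \<Longrightarrow> rvc n (\<lambda>_. b) b (\<lambda>_ _. 0) {}"
  by (auto simp: rvc_def cov_const prob_space intro: lin_span.intros)

end

section \<open>The noise of one update\<close>

lemma tr_mult: "dim_col A = dim_row B \<Longrightarrow> transpose_mat (A * B) = transpose_mat B * transpose_mat (A :: rmat)"
  by (rule transpose_mult[of A "dim_row A" "dim_row B" B "dim_col B"]) (auto intro: carrier_matI)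

lemma tr_add: "dim_row A = dim_row B \<Longrightarrow> dim_col A = dim_col B \<Longrightarrow>
    transpose_mat (A + B) = transpose_mat A + transpose_mat (B :: rmat)"
  by (rule transpose_add[of A "dim_row A" "dim_col A"]) (auto intro: carrier_matI)

lemma tr_minus: "dim_row A = dim_row B \<Longrightarrow> dim_col A = dim_col B \<Longrightarrow>
    transpose_mat (A - B) = transpose_mat A - transpose_mat (B :: rmat)"
  by (rule transpose_minus[of A "dim_row A" "dim_col A"]) (auto intro: carrier_matI)

lemmas tr = tr_mult tr_add tr_minus transpose_one transpose_transpose

context mg_hierarchy
begin

section \<open>Affine structure of the update\<close>

text \<open>With \<open>f = A b\<close> the noiseless iteration has fixed point \<open>b\<close>. A
  state is split into \<open>b\<close>, an error \<open>w\<close> and accumulated noise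
  \<open>s\<close>; the noise evolves under the same smoother with zero right-hand side.\<close>

lemma random_smoother_affine:
  assumes "dim_vec b = n l" "dim_vec w = n l" "dim_vec s = n l" "dim_vec \<xi> = n l"
  shows "random_smoother (A l) (M l) (A l *\<^sub>v b) \<xi> (b + w + s) =
    b + Sm l *\<^sub>v w + random_smoother (A l) (M l) (0\<^sub>v (n l)) \<xi> s"
  using assms unfolding random_smoother_def Mi_def[symmetric]
  by (intro eq_vecI) (simp_all add: mv Sm_mv del: index_mult_mat_vec)

lemma smooth_steps_dim:
  assumes "dim_vec \<theta> = n l" shows "dim_vec (smooth_steps (A l) (M l) f \<xi> k \<theta>) = n l"
  using assms by (induction k) (auto simp: random_smoother_def Mi_def[symmetric])

abbreviation noise_steps :: "nat \<Rightarrow> (nat \<Rightarrow> rvec) \<Rightarrow> nat \<Rightarrow> rvec" where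
  "noise_steps l \<xi> k \<equiv> smooth_steps (A l) (M l) (0\<^sub>v (n l)) \<xi> k (0\<^sub>v (n l))"

lemma noise_steps_dim [simp]: "dim_vec (noise_steps l \<xi> k) = n l"
  by (rule smooth_steps_dim) simp

lemma noise_steps_Suc:
  "dim_vec (\<xi> k) = n l \<Longrightarrow> noise_steps l \<xi> (Suc k) = Sm l *\<^sub>v noise_steps l \<xi> k + Mi l *\<^sub>v \<xi> k"
  by (rule eq_vecI) (simp_all add: random_smoother_def Mi_def[symmetric] mv Sm_mv del: index_mult_mat_vec)

lemma smooth_steps_affine:
  assumes b: "dim_vec b = n l" and \<theta>: "dim_vec \<theta> = n l" and \<xi>: "\<And>j. j < k \<Longrightarrow> dim_vec (\<xi> j) = n l"
  shows "smooth_steps (A l) (M l) (A l *\<^sub>v b) \<xi> k \<theta> = b + (Sm l ^\<^sub>m k) *\<^sub>v (\<theta> - b) + noise_steps l \<xi> k"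
  using \<xi>
proof (induction k)
  case 0
  then show ?case using b \<theta> by (intro eq_vecI) (simp_all add: mv)
next
  case (Suc k)
  have "smooth_steps (A l) (M l) (A l *\<^sub>v b) \<xi> (Suc k) \<theta> =
      random_smoother (A l) (M l) (A l *\<^sub>v b) (\<xi> k) (b + (Sm l ^\<^sub>m k) *\<^sub>v (\<theta> - b) + noise_steps l \<xi> k)"
    using Suc by simp
  also have "\<dots> = b + Sm l *\<^sub>v ((Sm l ^\<^sub>m k) *\<^sub>v (\<theta> - b)) + noise_steps l \<xi> (Suc k)"
    using b \<theta> Suc.prems[of k] by (simp add: random_smoother_affine)
  finally show ?case using b \<theta> by (simp only: Sm_pow_Suc index_minus_vec)
qed

abbreviation mgmc_noise :: "rvec \<Rightarrow> (nat \<Rightarrow> nat \<Rightarrow> rvec) \<Rightarrow> nat \<Rightarrow> rvec" where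
  "mgmc_noise \<eta> \<xi> l \<equiv> mgmc A M P \<nu>1 \<nu>2 \<eta> \<xi> l (0\<^sub>v (n l)) (0\<^sub>v (n l))"

text \<open>The three claims share one induction, since the noise recursion rests on the affine form
  of the coarser level. The noise of an update is the same update run with zero data from
  zero.\<close>

lemma mgmc_affine:
  assumes "dim_vec \<eta> = n 0" "\<And>j k. 1 \<le> j \<Longrightarrow> j \<le> l \<Longrightarrow> k < \<nu>1 + \<nu>2 \<Longrightarrow> dim_vec (\<xi> j k) = n j"
    and "dim_vec b = n l" "dim_vec \<theta> = n l"
  shows "mgmc A M P \<nu>1 \<nu>2 \<eta> \<xi> l (A l *\<^sub>v b) \<theta> = b + X l *\<^sub>v (\<theta> - b) + mgmc_noise \<eta> \<xi> l"
    and "dim_vec (mgmc_noise \<eta> \<xi> l) = n l"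
    and "l = Suc l' \<Longrightarrow> mgmc_noise \<eta> \<xi> l = (Sm l ^\<^sub>m \<nu>2) *\<^sub>v (Gm l' *\<^sub>v noise_steps l (\<xi> l) \<nu>1 + P l *\<^sub>v mgmc_noise \<eta> \<xi> l')
      + noise_steps l (\<lambda>k. \<xi> l (\<nu>1 + k)) \<nu>2"
proof -
  have "mgmc A M P \<nu>1 \<nu>2 \<eta> \<xi> l (A l *\<^sub>v b) \<theta> = b + X l *\<^sub>v (\<theta> - b) + mgmc_noise \<eta> \<xi> l \<and>
      dim_vec (mgmc_noise \<eta> \<xi> l) = n l \<and>
      (\<forall>l'. l = Suc l' \<longrightarrow> mgmc_noise \<eta> \<xi> l = (Sm l ^\<^sub>m \<nu>2) *\<^sub>v (Gm l' *\<^sub>v noise_steps l (\<xi> l) \<nu>1 + P l *\<^sub>v mgmc_noise \<eta> \<xi> l')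
      + noise_steps l (\<lambda>k. \<xi> l (\<nu>1 + k)) \<nu>2)"
    using assms
  proof (induction l arbitrary: b \<theta>)
    case 0
    then show ?case by (auto intro!: eq_vecI simp: Ai_def[symmetric] X_0 mv simp del: index_mult_mat_vec)
  next
    case (Suc l)
    let ?l = "Suc l"
    let ?s1 = "noise_steps ?l (\<xi> ?l) \<nu>1" and ?s2 = "noise_steps ?l (\<lambda>k. \<xi> ?l (\<nu>1 + k)) \<nu>2"
    let ?N = "mgmc_noise \<eta> \<xi> l"
    have \<xi>1: "dim_vec (\<xi> ?l j) = n ?l" if "j < \<nu>1" for j using Suc.prems(2)[of ?l j] that by simp
    have \<xi>2: "dim_vec (\<xi> ?l (\<nu>1 + j)) = n ?l" if "j < \<nu>2" for j using Suc.prems(2)[of ?l "\<nu>1 + j"] that by simp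
    have IH: "mgmc A M P \<nu>1 \<nu>2 \<eta> \<xi> l (A l *\<^sub>v c) (0\<^sub>v (n l)) = c + X l *\<^sub>v (0\<^sub>v (n l) - c) + ?N" "dim_vec ?N = n l"
      if "dim_vec c = n l" for c
      using Suc.IH[of c "0\<^sub>v (n l)"] Suc.prems(1,2) that by auto
    have N [simp]: "dim_vec ?N = n l" by (rule IH(2)[of "0\<^sub>v (n l)"]) simp
    \<comment> \<open>For arbitrary \<open>c\<close> and \<open>\<theta>\<close>: zeros give the
      noise recursion, and the given arguments give the affine form.\<close>
    have gen: "mgmc A M P \<nu>1 \<nu>2 \<eta> \<xi> ?l (A ?l *\<^sub>v c) \<theta> =
        c + (Sm ?l ^\<^sub>m \<nu>2) *\<^sub>v (Gm l *\<^sub>v ((Sm ?l ^\<^sub>m \<nu>1) *\<^sub>v (\<theta> - c) + ?s1) + P ?l *\<^sub>v ?N) + ?s2"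
      if c: "dim_vec c = n ?l" and \<theta>: "dim_vec \<theta> = n ?l" for c \<theta>
    proof -
      define w where "w = (Sm ?l ^\<^sub>m \<nu>1) *\<^sub>v (\<theta> - c) + ?s1"
      have w [simp]: "dim_vec w = n ?l" by (simp add: w_def)
      have \<theta>1: "smooth_steps (A ?l) (M ?l) (A ?l *\<^sub>v c) (\<xi> ?l) \<nu>1 \<theta> = c + w"
      proof -
        have e: "smooth_steps (A ?l) (M ?l) (A ?l *\<^sub>v c) (\<xi> ?l) \<nu>1 \<theta> =
            c + (Sm ?l ^\<^sub>m \<nu>1) *\<^sub>v (\<theta> - c) + ?s1"
          by (rule smooth_steps_affine[OF c \<theta> \<xi>1])
        show ?thesis unfolding e w_def using c by (intro eq_vecI) (simp_all del: index_mult_mat_vec)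
      qed
      define g where "g = transpose_mat (P ?l) *\<^sub>v (A ?l *\<^sub>v c - A ?l *\<^sub>v (c + w))"
      have "A ?l *\<^sub>v c - A ?l *\<^sub>v (c + w) = 0\<^sub>v (n ?l) - A ?l *\<^sub>v w"
        using c by (intro eq_vecI) (simp_all add: mv del: index_mult_mat_vec)
      \<comment> \<open>The restricted residual is the coarse matrix applied to minus the projected
        error, so the induction hypothesis applies with fixed point \<open>- cc l w\<close>.\<close>
      then have g: "g = A l *\<^sub>v (0\<^sub>v (n l) - cc l w)"
        unfolding g_def by (simp add: mv cc_def)
      have \<psi>: "mgmc A M P \<nu>1 \<nu>2 \<eta> \<xi> l g (0\<^sub>v (n l)) = (0\<^sub>v (n l) - cc l w) + X l *\<^sub>v (0\<^sub>v (n l) - (0\<^sub>v (n l) - cc l w)) + ?N"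
        unfolding g by (rule IH(1)) simp
      have "c + w + P ?l *\<^sub>v mgmc A M P \<nu>1 \<nu>2 \<eta> \<xi> l g (0\<^sub>v (n l)) = c + (Gm l *\<^sub>v w + P ?l *\<^sub>v ?N)"
        unfolding \<psi> using c by (intro eq_vecI) (simp_all add: mv Gm_mv del: index_mult_mat_vec)
      moreover have "mgmc A M P \<nu>1 \<nu>2 \<eta> \<xi> ?l (A ?l *\<^sub>v c) \<theta> =
          smooth_steps (A ?l) (M ?l) (A ?l *\<^sub>v c) (\<lambda>k. \<xi> ?l (\<nu>1 + k)) \<nu>2
            (c + w + P ?l *\<^sub>v mgmc A M P \<nu>1 \<nu>2 \<eta> \<xi> l g (0\<^sub>v (n l)))"
        by (simp add: Let_def \<theta>1 g_def)
      ultimately have "mgmc A M P \<nu>1 \<nu>2 \<eta> \<xi> ?l (A ?l *\<^sub>v c) \<theta> =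
          smooth_steps (A ?l) (M ?l) (A ?l *\<^sub>v c) (\<lambda>k. \<xi> ?l (\<nu>1 + k)) \<nu>2 (c + (Gm l *\<^sub>v w + P ?l *\<^sub>v ?N))" by simp
      also have "\<dots> = c + (Sm ?l ^\<^sub>m \<nu>2) *\<^sub>v (c + (Gm l *\<^sub>v w + P ?l *\<^sub>v ?N) - c) + ?s2"
        by (rule smooth_steps_affine[OF c]) (simp_all add: c \<xi>2)
      also have "c + (Gm l *\<^sub>v w + P ?l *\<^sub>v ?N) - c = Gm l *\<^sub>v w + P ?l *\<^sub>v ?N"
        using c by (intro eq_vecI) (simp_all del: index_mult_mat_vec)
      finally show ?thesis unfolding w_def .
    qed
    have z: "A ?l *\<^sub>v 0\<^sub>v (n ?l) = 0\<^sub>v (n ?l)" by (simp add: mv)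
    have noise: "mgmc_noise \<eta> \<xi> ?l = (Sm ?l ^\<^sub>m \<nu>2) *\<^sub>v (Gm l *\<^sub>v ?s1 + P ?l *\<^sub>v ?N) + ?s2"
      unfolding gen[OF index_zero_vec(2) index_zero_vec(2), unfolded z]
      by (intro eq_vecI) (simp_all add: mv del: index_mult_mat_vec)
    show ?case
    proof (intro conjI allI impI)
      show "mgmc A M P \<nu>1 \<nu>2 \<eta> \<xi> ?l (A ?l *\<^sub>v b) \<theta> = b + X ?l *\<^sub>v (\<theta> - b) + mgmc_noise \<eta> \<xi> ?l"
        unfolding gen[OF Suc.prems(3,4)] noise using Suc.prems(3,4)
        by (intro eq_vecI) (simp_all add: X_Suc_mv mv del: index_mult_mat_vec)
      show "dim_vec (mgmc_noise \<eta> \<xi> ?l) = n ?l" unfolding noise by simp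
    qed (use noise in auto)
  qed
  then show "mgmc A M P \<nu>1 \<nu>2 \<eta> \<xi> l (A l *\<^sub>v b) \<theta> = b + X l *\<^sub>v (\<theta> - b) + mgmc_noise \<eta> \<xi> l"
    and "dim_vec (mgmc_noise \<eta> \<xi> l) = n l"
    and "l = Suc l' \<Longrightarrow> mgmc_noise \<eta> \<xi> l = (Sm l ^\<^sub>m \<nu>2) *\<^sub>v (Gm l' *\<^sub>v noise_steps l (\<xi> l) \<nu>1 + P l *\<^sub>v mgmc_noise \<eta> \<xi> l')
      + noise_steps l (\<lambda>k. \<xi> l (\<nu>1 + k)) \<nu>2" by blast+
qed

text \<open>The covariance form of the noise of an affine iteration with matrix \<open>B\<close> that preserves the covariance \<open>A\<inverse>\<close>.\<close>

definition wform :: "nat \<Rightarrow> rmat \<Rightarrow> rvec \<Rightarrow> rvec \<Rightarrow> real" where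
  "wform l B g h = g \<bullet> (Ai l *\<^sub>v h) - (transpose_mat B *\<^sub>v g) \<bullet> (Ai l *\<^sub>v (transpose_mat B *\<^sub>v h))"

section \<open>Covariance balance of the components of a cycle\<close>

lemma Sm_T_mv: "dim_vec g = n l \<Longrightarrow> transpose_mat (Sm l) *\<^sub>v g = g - A l *\<^sub>v (Mi l *\<^sub>v g)"
  by (simp add: Sm_def tr mv mg_syms)

lemma Gm_T_mv: "dim_vec g = n (Suc l) \<Longrightarrow> transpose_mat (Gm l) *\<^sub>v g = g -
    A (Suc l) *\<^sub>v (P (Suc l) *\<^sub>v (Ai l *\<^sub>v (transpose_mat (P (Suc l)) *\<^sub>v g - transpose_mat (X l) *\<^sub>v (transpose_mat (P (Suc l)) *\<^sub>v g))))"
  by (rule eq_vecI) (simp_all add: Gm_def tr mv mg_syms del: index_mult_mat_vec)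

text \<open>In matrices, with \<open>M\<close> symmetric: \<open>S A\<inverse> S\<^sup>T +
  M\<inverse> (M + M\<^sup>T - A) M\<inverse> = A\<inverse>\<close>. The noise covariance of the
  smoother is exactly what keeps \<open>A\<inverse>\<close> stationary.\<close>

lemma smoother_noise_balance:
  assumes g: "dim_vec g = n l" and h: "dim_vec h = n l"
  shows "(transpose_mat (Sm l) *\<^sub>v g) \<bullet> (Ai l *\<^sub>v (transpose_mat (Sm l) *\<^sub>v h))
    + (Mi l *\<^sub>v g) \<bullet> ((M l + transpose_mat (M l) - A l) *\<^sub>v (Mi l *\<^sub>v h)) = g \<bullet> (Ai l *\<^sub>v h)"
proof -
  let ?r = "Mi l *\<^sub>v g" and ?s = "Mi l *\<^sub>v h"
  have 1: "?r \<bullet> h = g \<bullet> ?s" using g h sp_transpose[of g "Mi l" h] by (simp add: mg_syms)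
  have 2: "(A l *\<^sub>v ?r) \<bullet> (Ai l *\<^sub>v h) = ?r \<bullet> h" using h sp_transpose[of ?r "A l" "Ai l *\<^sub>v h"] by (simp add: mg_syms)
  have 3: "(A l *\<^sub>v ?r) \<bullet> ?s = ?r \<bullet> (A l *\<^sub>v ?s)" using sp_transpose[of ?r "A l" ?s] by (simp add: mg_syms)
  show ?thesis using g h 1 2 3 by (simp add: Sm_T_mv mv sp mg_syms)
qed

text \<open>By the Galerkin identity, the covariance that \<open>Gm\<close> takes away from
  \<open>Ai (Suc l)\<close> is returned by the prolongated coarse noise; the term
  \<open>wform l (X l)\<close> accounts for the inexact coarse update.\<close>

lemma coarse_noise_balance:
  assumes g: "dim_vec g = n (Suc l)" and h: "dim_vec h = n (Suc l)"
  defines "p \<equiv> transpose_mat (P (Suc l)) *\<^sub>v g" and "q \<equiv> transpose_mat (P (Suc l)) *\<^sub>v h"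
  shows "(transpose_mat (Gm l) *\<^sub>v g) \<bullet> (Ai (Suc l) *\<^sub>v (transpose_mat (Gm l) *\<^sub>v h))
    + wform l (X l) p q = g \<bullet> (Ai (Suc l) *\<^sub>v h)"
proof -
  let ?l = "Suc l"
  have d [simp]: "dim_vec p = n l" "dim_vec q = n l" by (simp_all add: p_def q_def)
  let ?x = "transpose_mat (X l) *\<^sub>v p" and ?y = "transpose_mat (X l) *\<^sub>v q"
  let ?d = "Ai l *\<^sub>v (p - ?x)" and ?e = "Ai l *\<^sub>v (q - ?y)"
  have G: "transpose_mat (Gm l) *\<^sub>v g = g - A ?l *\<^sub>v (P ?l *\<^sub>v ?d)" "transpose_mat (Gm l) *\<^sub>v h = h - A ?l *\<^sub>v (P ?l *\<^sub>v ?e)"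
    using g h by (simp_all add: Gm_T_mv p_def q_def)
  have 1: "(A ?l *\<^sub>v (P ?l *\<^sub>v ?d)) \<bullet> (Ai ?l *\<^sub>v h) = ?d \<bullet> q"
    using h sp_transpose[of "P ?l *\<^sub>v ?d" "A ?l" "Ai ?l *\<^sub>v h"] sp_transpose[of ?d "transpose_mat (P ?l)" h]
    by (simp add: mg_syms q_def)
  have 2: "g \<bullet> (P ?l *\<^sub>v ?e) = p \<bullet> ?e"
    using g sp_transpose[of g "P ?l" ?e] by (simp add: p_def)
  have 3: "(A ?l *\<^sub>v (P ?l *\<^sub>v ?d)) \<bullet> (P ?l *\<^sub>v ?e) = ?d \<bullet> (q - ?y)"
  proof -
    have "(A ?l *\<^sub>v (P ?l *\<^sub>v ?d)) \<bullet> (P ?l *\<^sub>v ?e) = ip ?l (P ?l *\<^sub>v ?d) (P ?l *\<^sub>v ?e)"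
      unfolding ip_def using sp_transpose[of "P ?l *\<^sub>v ?d" "A ?l" "P ?l *\<^sub>v ?e"] by (simp add: mg_syms)
    also have "\<dots> = ip l ?d ?e" by (rule ip_P_P) simp_all
    finally show ?thesis by (simp add: ip_def)
  qed
  have s: "u \<bullet> (Ai l *\<^sub>v v) = (Ai l *\<^sub>v u) \<bullet> v" if "dim_vec u = n l" "dim_vec v = n l" for u v
    using sp_transpose[of u "Ai l" v] that by (simp add: mg_syms)
  show ?thesis unfolding G wform_def using g h 1 2 3
    by (simp add: mv sp s)
qed

end

locale mgmc_process = mg_hierarchy n A M P \<nu>1 \<nu>2 +
    gaussian_sources Pr "sources L (\<nu>1 + \<nu>2)" "source_dim n L" Z m \<Sigma>
  for n A M P \<nu>1 \<nu>2 and Pr :: "'w measure" and L Z m \<Sigma> +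
  assumes m_Coarse: "m (Coarse j) = 0\<^sub>v (n 0)" and \<Sigma>_Coarse: "\<Sigma> (Coarse j) = minv (A 0)"
    and m_Smooth: "m (Smooth j l k) = 0\<^sub>v (n l)"
    and \<Sigma>_Smooth: "\<Sigma> (Smooth j l k) = M l + transpose_mat (M l) - A l"
begin

lemma source_mem: "Initial \<in> sources L (\<nu>1 + \<nu>2)" "Coarse j \<in> sources L (\<nu>1 + \<nu>2)"
  "1 \<le> l \<Longrightarrow> l \<le> L \<Longrightarrow> k < \<nu>1 + \<nu>2 \<Longrightarrow> Smooth j l k \<in> sources L (\<nu>1 + \<nu>2)"
  by (auto simp: sources_def)

text \<open>Each step adds the amount given by \<open>smoother_noise_balance\<close>, so the forms
  telescope. \<open>off\<close> shifts the labels: 0 for pre-smoothing and \<open>\<nu>1\<close> for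
  post-smoothing.\<close>

lemma noise_steps_rvc:
  assumes l: "1 \<le> l" "l \<le> L" and k: "off + k \<le> \<nu>1 + \<nu>2"
  shows "rvc (n l) (\<lambda>\<omega>. noise_steps l (\<lambda>i. Z (Smooth j l (off + i)) \<omega>) k) (0\<^sub>v (n l)) (wform l (Sm l ^\<^sub>m k))
    ((\<lambda>i. Smooth j l (off + i)) ` {..<k})"
  using k
proof (induction k)
  case 0
  show ?case by (rule rvc_cong[OF rvc_zero]) (auto simp: wform_def mv)
next
  case (Suc k)
  let ?s = "Smooth j l (off + k)"
  have s: "?s \<in> sources L (\<nu>1 + \<nu>2)" using Suc.prems l by (intro source_mem) auto
  have IH: "rvc (n l) (\<lambda>\<omega>. noise_steps l (\<lambda>i. Z (Smooth j l (off + i)) \<omega>) k) (0\<^sub>v (n l)) (wform l (Sm l ^\<^sub>m k))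
    ((\<lambda>i. Smooth j l (off + i)) ` {..<k})" using Suc by simp
  have Z: "rvc (n l) (Z ?s) (0\<^sub>v (n l)) (\<lambda>g h. g \<bullet> ((M l + transpose_mat (M l) - A l) *\<^sub>v h)) {?s}"
    using rvc_source[OF s] by (simp add: m_Smooth \<Sigma>_Smooth)
  have pw: "Sm l ^\<^sub>m Suc k = Sm l * Sm l ^\<^sub>m k"
  proof (rule mat_eq_mv)
    show "Sm l ^\<^sub>m Suc k \<in> carrier_mat (n l) (n l)" "Sm l * Sm l ^\<^sub>m k \<in> carrier_mat (n l) (n l)"
      using Sm_carrier pow_carrier_mat by auto
    show "Sm l ^\<^sub>m Suc k *\<^sub>v x = Sm l * Sm l ^\<^sub>m k *\<^sub>v x" if "x \<in> carrier_vec (n l)" for x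
      using that pow_mv_Suc'[OF Sm_carrier that, of k] by (simp add: mv del: pow_mat.simps)
  qed
  have "rvc (n l) (\<lambda>\<omega>. Sm l *\<^sub>v noise_steps l (\<lambda>i. Z (Smooth j l (off + i)) \<omega>) k + Mi l *\<^sub>v Z ?s \<omega>)
     (Sm l *\<^sub>v 0\<^sub>v (n l) + Mi l *\<^sub>v 0\<^sub>v (n l))
     (\<lambda>g h. wform l (Sm l ^\<^sub>m k) (transpose_mat (Sm l) *\<^sub>v g) (transpose_mat (Sm l) *\<^sub>v h) +
        (transpose_mat (Mi l) *\<^sub>v g) \<bullet> ((M l + transpose_mat (M l) - A l) *\<^sub>v (transpose_mat (Mi l) *\<^sub>v h)))
     ((\<lambda>i. Smooth j l (off + i)) ` {..<k} \<union> {?s})"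
    by (intro rvc_add rvc_mult[OF IH Sm_carrier] rvc_mult[OF Z pos_defD(1)[OF Mi_pd]]) auto
  then show ?case
  proof (rule rvc_cong)
    fix \<omega> assume "\<omega> \<in> space Pr"
    then have "dim_vec (Z ?s \<omega>) = n l" using Z_carrier[OF s] by (auto dest: carrier_vecD)
    then show "Sm l *\<^sub>v noise_steps l (\<lambda>i. Z (Smooth j l (off + i)) \<omega>) k + Mi l *\<^sub>v Z ?s \<omega> =
        noise_steps l (\<lambda>i. Z (Smooth j l (off + i)) \<omega>) (Suc k)"
      by (simp only: noise_steps_Suc)
  next
    fix g h :: rvec assume "g \<in> carrier_vec (n l)" "h \<in> carrier_vec (n l)"
    then have d: "dim_vec g = n l" "dim_vec h = n l" by auto
    show "wform l (Sm l ^\<^sub>m k) (transpose_mat (Sm l) *\<^sub>v g) (transpose_mat (Sm l) *\<^sub>v h) +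
        (transpose_mat (Mi l) *\<^sub>v g) \<bullet> ((M l + transpose_mat (M l) - A l) *\<^sub>v (transpose_mat (Mi l) *\<^sub>v h)) =
        wform l (Sm l ^\<^sub>m Suc k) g h"
      unfolding pw using smoother_noise_balance[OF d] d by (simp add: wform_def tr mv mg_syms del: pow_mat.simps)
  qed (auto simp: mv lessThan_Suc)
qed

definition update_noise :: "nat \<Rightarrow> nat \<Rightarrow> 'w \<Rightarrow> rvec" where
  "update_noise j l \<omega> = mgmc_noise (Z (Coarse j) \<omega>) (\<lambda>l k. Z (Smooth j l k) \<omega>) l"

definition update_sources :: "nat \<Rightarrow> nat \<Rightarrow> source set" where
  "update_sources j l = insert (Coarse j) {Smooth j i k | i k. 1 \<le> i \<and> i \<le> l \<and> k < \<nu>1 + \<nu>2}"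

lemma Z_dims:
  assumes "\<omega> \<in> space Pr"
  shows "dim_vec (Z (Coarse j) \<omega>) = n 0" "1 \<le> l \<Longrightarrow> l \<le> L \<Longrightarrow> k < \<nu>1 + \<nu>2 \<Longrightarrow> dim_vec (Z (Smooth j l k) \<omega>) = n l"
  using Z_carrier[OF source_mem(2) assms, of j] Z_carrier[OF source_mem(3) assms, of l k j] by auto

text \<open>\<open>wform\<close> telescopes along the composition: the pre-smoothing noise is
  carried by \<open>Gm\<close>, \<open>coarse_noise_balance\<close> merges it with the coarse noise,
  and post-smoothing adds its own share. Distinct labels keep the three contributions
  uncorrelated.\<close>

lemma update_noise_rvc:
  assumes "l \<le> L"
  shows "rvc (n l) (update_noise j l) (0\<^sub>v (n l)) (wform l (X l)) (update_sources j l)"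
  using assms
proof (induction l)
  case 0
  have "rvc (n 0) (Z (Coarse j)) (0\<^sub>v (n 0)) (\<lambda>g h. g \<bullet> (Ai 0 *\<^sub>v h)) {Coarse j}"
    using rvc_source[OF source_mem(2), of j] by (simp add: m_Coarse \<Sigma>_Coarse Ai_def)
  then show ?case
  proof (rule rvc_cong)
    show "Z (Coarse j) \<omega> = update_noise j 0 \<omega>" if "\<omega> \<in> space Pr" for \<omega>
      using Z_dims(1)[OF that, of j] by (intro eq_vecI) (simp_all add: update_noise_def Ai_def[symmetric] mv)
    have t: "transpose_mat (0\<^sub>m (n 0) (n 0)) = (0\<^sub>m (n 0) (n 0) :: rmat)" by (intro eq_matI) auto
    show "g \<bullet> (Ai 0 *\<^sub>v h) = wform 0 (X 0) g h" if "g \<in> carrier_vec (n 0)" "h \<in> carrier_vec (n 0)" for g h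
      using that by (simp add: wform_def X_0 mv sp t)
  qed (auto simp: update_sources_def)
next
  case (Suc l)
  let ?l = "Suc l"
  have l: "1 \<le> ?l" "?l \<le> L" using Suc.prems by auto
  let ?T1 = "(\<lambda>i. Smooth j ?l (0 + i)) ` {..<\<nu>1}" and ?T2 = "(\<lambda>i. Smooth j ?l (\<nu>1 + i)) ` {..<\<nu>2}"
  let ?s1 = "\<lambda>\<omega>. noise_steps ?l (\<lambda>i. Z (Smooth j ?l (0 + i)) \<omega>) \<nu>1"
  let ?s2 = "\<lambda>\<omega>. noise_steps ?l (\<lambda>i. Z (Smooth j ?l (\<nu>1 + i)) \<omega>) \<nu>2"
  have IH: "rvc (n l) (update_noise j l) (0\<^sub>v (n l)) (wform l (X l)) (update_sources j l)" using Suc by simp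
  note s1 = noise_steps_rvc[OF l, of 0 \<nu>1 j, simplified]
  note s2 = noise_steps_rvc[OF l, of \<nu>1 \<nu>2 j, simplified]
  have G: "Gm l \<in> carrier_mat (n ?l) (n ?l)" by (rule carrier_matI) simp_all
  have Pw: "Sm ?l ^\<^sub>m \<nu>2 \<in> carrier_mat (n ?l) (n ?l)" by (rule carrier_matI) simp_all
  have step1: "rvc (n ?l) (\<lambda>\<omega>. Gm l *\<^sub>v ?s1 \<omega> + P ?l *\<^sub>v update_noise j l \<omega>) (Gm l *\<^sub>v 0\<^sub>v (n ?l) + P ?l *\<^sub>v 0\<^sub>v (n l))
     (\<lambda>g h. wform ?l (Sm ?l ^\<^sub>m \<nu>1) (transpose_mat (Gm l) *\<^sub>v g) (transpose_mat (Gm l) *\<^sub>v h) +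
        wform l (X l) (transpose_mat (P ?l) *\<^sub>v g) (transpose_mat (P ?l) *\<^sub>v h)) (?T1 \<union> update_sources j l)"
    unfolding add_0_left by (intro rvc_add rvc_mult[OF s1 G] rvc_mult[OF IH P_carrier]) (auto simp: update_sources_def)
  have "rvc (n ?l) (\<lambda>\<omega>. (Sm ?l ^\<^sub>m \<nu>2) *\<^sub>v (Gm l *\<^sub>v ?s1 \<omega> + P ?l *\<^sub>v update_noise j l \<omega>) + ?s2 \<omega>)
     ((Sm ?l ^\<^sub>m \<nu>2) *\<^sub>v (Gm l *\<^sub>v 0\<^sub>v (n ?l) + P ?l *\<^sub>v 0\<^sub>v (n l)) + 0\<^sub>v (n ?l))
     (\<lambda>g h. (wform ?l (Sm ?l ^\<^sub>m \<nu>1) (transpose_mat (Gm l) *\<^sub>v (transpose_mat (Sm ?l ^\<^sub>m \<nu>2) *\<^sub>v g)) (transpose_mat (Gm l) *\<^sub>v (transpose_mat (Sm ?l ^\<^sub>m \<nu>2) *\<^sub>v h)) +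
        wform l (X l) (transpose_mat (P ?l) *\<^sub>v (transpose_mat (Sm ?l ^\<^sub>m \<nu>2) *\<^sub>v g)) (transpose_mat (P ?l) *\<^sub>v (transpose_mat (Sm ?l ^\<^sub>m \<nu>2) *\<^sub>v h)))
       + wform ?l (Sm ?l ^\<^sub>m \<nu>2) g h) ((?T1 \<union> update_sources j l) \<union> ?T2)"
    by (intro rvc_add rvc_mult[OF step1 Pw] s2) (auto simp: update_sources_def)
  then show ?case
  proof (rule rvc_cong)
    fix \<omega> assume \<omega>: "\<omega> \<in> space Pr"
    have "mgmc_noise (Z (Coarse j) \<omega>) (\<lambda>l k. Z (Smooth j l k) \<omega>) ?l =
      (Sm ?l ^\<^sub>m \<nu>2) *\<^sub>v (Gm l *\<^sub>v noise_steps ?l (\<lambda>k. Z (Smooth j ?l k) \<omega>) \<nu>1 + P ?l *\<^sub>v mgmc_noise (Z (Coarse j) \<omega>) (\<lambda>l k. Z (Smooth j l k) \<omega>) l)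
      + noise_steps ?l (\<lambda>k. Z (Smooth j ?l (\<nu>1 + k)) \<omega>) \<nu>2"
      by (rule mgmc_affine(3)[of _ ?l _ "0\<^sub>v (n ?l)" "0\<^sub>v (n ?l)"]) (use Z_dims[OF \<omega>] Suc.prems in auto)
    then show "(Sm ?l ^\<^sub>m \<nu>2) *\<^sub>v (Gm l *\<^sub>v ?s1 \<omega> + P ?l *\<^sub>v update_noise j l \<omega>) + ?s2 \<omega> = update_noise j ?l \<omega>"
      by (simp only: update_noise_def add_0_left)
  next
    fix g h :: rvec assume "g \<in> carrier_vec (n ?l)" "h \<in> carrier_vec (n ?l)"
    then have d: "dim_vec g = n ?l" "dim_vec h = n ?l" by auto
    let ?g = "transpose_mat (Sm ?l ^\<^sub>m \<nu>2) *\<^sub>v g" and ?h = "transpose_mat (Sm ?l ^\<^sub>m \<nu>2) *\<^sub>v h"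
    have dgh: "dim_vec ?g = n ?l" "dim_vec ?h = n ?l"
      by (simp_all only: dim_mult_mat_vec index_transpose_mat Sm_dims)
    have "transpose_mat (X ?l) *\<^sub>v x = transpose_mat (Sm ?l ^\<^sub>m \<nu>1) *\<^sub>v (transpose_mat (Gm l) *\<^sub>v (transpose_mat (Sm ?l ^\<^sub>m \<nu>2) *\<^sub>v x))"
      if "dim_vec x = n ?l" for x
      using that by (simp add: X_Suc tr mv)
    then show "(wform ?l (Sm ?l ^\<^sub>m \<nu>1) (transpose_mat (Gm l) *\<^sub>v ?g) (transpose_mat (Gm l) *\<^sub>v ?h) +
        wform l (X l) (transpose_mat (P ?l) *\<^sub>v ?g) (transpose_mat (P ?l) *\<^sub>v ?h)) + wform ?l (Sm ?l ^\<^sub>m \<nu>2) g h = wform ?l (X ?l) g h"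
      using coarse_noise_balance[OF dgh] d by (simp add: wform_def)
    next
    show "(?T1 \<union> update_sources j l) \<union> ?T2 \<subseteq> update_sources j ?l" by (auto simp: update_sources_def)
  qed (auto simp: mv)
qed

end

section \<open>Covariances along the chain\<close>

locale mgmc_markov = mgmc_process n A M P \<nu>1 \<nu>2 Pr L Z m \<Sigma>
  for n A M P \<nu>1 \<nu>2 and Pr :: "'w measure" and L Z m \<Sigma> +
  fixes \<theta> :: "nat \<Rightarrow> 'w \<Rightarrow> rvec" and b :: rvec
  assumes b: "b \<in> carrier_vec (n L)"
    and \<theta>_0: "\<theta> 0 = Z Initial"
    and \<theta>_Suc: "\<omega> \<in> space Pr \<Longrightarrow> \<theta> (Suc j) \<omega> =
      mgmc A M P \<nu>1 \<nu>2 (Z (Coarse j) \<omega>) (\<lambda>l k. Z (Smooth j l k) \<omega>) L (A L *\<^sub>v b) (\<theta> j \<omega>)"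
begin

text \<open>States move by \<open>X\<close>, so functionals of states are pulled back by its
  transpose; all moments are expressed through pulled back functionals.\<close>

definition XT :: "nat \<Rightarrow> rvec \<Rightarrow> rvec" where
  "XT s g = (transpose_mat (X L) ^\<^sub>m s) *\<^sub>v g"

lemma XT_carrier: "transpose_mat (X L) \<in> carrier_mat (n L) (n L)"
  using X_carrier by simp

lemma XT_0: "g \<in> carrier_vec (n L) \<Longrightarrow> XT 0 g = g"
  by (simp add: XT_def)

lemma XT_Suc: "g \<in> carrier_vec (n L) \<Longrightarrow> XT (Suc s) g = XT s (transpose_mat (X L) *\<^sub>v g)"
  unfolding XT_def by (rule pow_mv_Suc[OF XT_carrier])

lemma XT_Suc': "g \<in> carrier_vec (n L) \<Longrightarrow> XT (Suc s) g = transpose_mat (X L) *\<^sub>v XT s g"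
  unfolding XT_def by (rule pow_mv_Suc'[OF XT_carrier])

lemma XT_mem: "g \<in> carrier_vec (n L) \<Longrightarrow> XT s g \<in> carrier_vec (n L)"
  unfolding XT_def using pow_carrier_mat[OF XT_carrier] by (rule mult_mat_vec_carrier)

lemma XT_add: "g \<in> carrier_vec (n L) \<Longrightarrow> XT s (XT t g) = XT (s + t) g"
  by (induction s) (simp_all add: XT_0 XT_mem XT_Suc')

text \<open>\<open>Q j\<close> is the covariance form of the \<open>j\<close>-th state; the deviation from the limit covariance is transported by \<open>X\<close>.\<close>

definition q :: "rvec \<Rightarrow> rvec \<Rightarrow> real" where "q g h = g \<bullet> (Ai L *\<^sub>v h)"

definition E0 :: "rvec \<Rightarrow> rvec \<Rightarrow> real" where "E0 g h = g \<bullet> (\<Sigma> Initial *\<^sub>v h) - q g h"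

definition Q :: "nat \<Rightarrow> rvec \<Rightarrow> rvec \<Rightarrow> real" where "Q j g h = q g h + E0 (XT j g) (XT j h)"

definition past :: "nat \<Rightarrow> source set" where "past j = insert Initial (\<Union>i<j. update_sources i L)"

lemma \<theta>_Suc_affine:
  assumes \<omega>: "\<omega> \<in> space Pr" and \<theta>: "\<theta> j \<omega> \<in> carrier_vec (n L)"
  shows "\<theta> (Suc j) \<omega> = (b - X L *\<^sub>v b) + X L *\<^sub>v \<theta> j \<omega> + update_noise j L \<omega>"
proof -
  have "\<theta> (Suc j) \<omega> = b + X L *\<^sub>v (\<theta> j \<omega> - b) + update_noise j L \<omega>"
    unfolding \<theta>_Suc[OF \<omega>] update_noise_def
    by (rule mgmc_affine(1)) (use Z_dims[OF \<omega>] b \<theta> in auto)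
  also have "\<dots> = (b - X L *\<^sub>v b) + X L *\<^sub>v \<theta> j \<omega> + update_noise j L \<omega>"
    using b \<theta> rvcD(2)[OF update_noise_rvc[OF order.refl, of j] \<omega>]
    by (intro eq_vecI) (auto simp: mv simp del: index_mult_mat_vec)
  finally show ?thesis .
qed

text \<open>The error of the mean and the covariance deviation obey the homogeneous recursion of
  \<open>X\<close>: the affine term keeps \<open>b\<close> fixed, and the noise form
  \<open>wform\<close> keeps \<open>q\<close> fixed.\<close>

lemma \<theta>_rvc:
  "\<exists>\<mu>. rvc (n L) (\<theta> j) \<mu> (Q j) (past j) \<and>
     (\<forall>g\<in>carrier_vec (n L). g \<bullet> \<mu> = g \<bullet> b + XT j g \<bullet> (m Initial - b))"
proof (induction j)
  case 0
  have "rvc (n L) (Z Initial) (m Initial) (\<lambda>g h. g \<bullet> (\<Sigma> Initial *\<^sub>v h)) {Initial}"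
    using rvc_source[OF source_mem(1)] by simp
  then have r: "rvc (n L) (\<theta> 0) (m Initial) (Q 0) (past 0)"
    by (rule rvc_cong) (auto simp: \<theta>_0 Q_def E0_def XT_0 past_def)
  moreover have "g \<bullet> m Initial = g \<bullet> b + XT 0 g \<bullet> (m Initial - b)" if "g \<in> carrier_vec (n L)" for g
    using that b rvcD(1)[OF r] by (simp add: XT_0 sp)
  ultimately show ?case by blast
next
  case (Suc j)
  then obtain \<mu> where r: "rvc (n L) (\<theta> j) \<mu> (Q j) (past j)"
    and \<mu>: "\<And>g. g \<in> carrier_vec (n L) \<Longrightarrow> g \<bullet> \<mu> = g \<bullet> b + XT j g \<bullet> (m Initial - b)" by blast
  have d: "b - X L *\<^sub>v b \<in> carrier_vec (n L)" using b by (auto intro!: carrier_vecI)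
  \<comment> \<open>Labels carry the index of the update, and the past of state \<open>j\<close>
    contains only the initial state and updates below \<open>j\<close>.\<close>
  have disj: "({} \<union> past j) \<inter> update_sources j L = {}" by (auto simp: past_def update_sources_def)
  have "rvc (n L) (\<lambda>\<omega>. (b - X L *\<^sub>v b) + X L *\<^sub>v \<theta> j \<omega> + update_noise j L \<omega>) ((b - X L *\<^sub>v b) + X L *\<^sub>v \<mu> + 0\<^sub>v (n L))
    (\<lambda>g h. 0 + Q j (transpose_mat (X L) *\<^sub>v g) (transpose_mat (X L) *\<^sub>v h) + wform L (X L) g h) ({} \<union> past j \<union> update_sources j L)"
    by (intro rvc_add rvc_const[OF d] rvc_mult[OF r X_carrier] update_noise_rvc order.refl disj) simp
  then have "rvc (n L) (\<theta> (Suc j)) ((b - X L *\<^sub>v b) + X L *\<^sub>v \<mu> + 0\<^sub>v (n L)) (Q (Suc j)) (past (Suc j))"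
  proof (rule rvc_cong)
    show "(b - X L *\<^sub>v b) + X L *\<^sub>v \<theta> j \<omega> + update_noise j L \<omega> = \<theta> (Suc j) \<omega>" if "\<omega> \<in> space Pr" for \<omega>
      using \<theta>_Suc_affine[OF that rvcD(2)[OF r that]] by simp
    show "0 + Q j (transpose_mat (X L) *\<^sub>v g) (transpose_mat (X L) *\<^sub>v h) + wform L (X L) g h = Q (Suc j) g h"
      if "g \<in> carrier_vec (n L)" "h \<in> carrier_vec (n L)" for g h
      using that by (simp add: Q_def XT_Suc wform_def q_def)
    show "{} \<union> past j \<union> update_sources j L \<subseteq> past (Suc j)" by (auto simp: past_def lessThan_Suc)
  qed simp
  moreover have "g \<bullet> ((b - X L *\<^sub>v b) + X L *\<^sub>v \<mu> + 0\<^sub>v (n L)) = g \<bullet> b + XT (Suc j) g \<bullet> (m Initial - b)"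
    if g: "g \<in> carrier_vec (n L)" for g
    using g b rvcD(1)[OF r] \<mu>[OF mult_mat_vec_carrier[OF XT_carrier g]]
    by (simp add: sp XT_Suc sp_transpose[of g "X L"])
  ultimately show ?case by blast
qed

lemma \<theta>_carrier: "\<omega> \<in> space Pr \<Longrightarrow> \<theta> j \<omega> \<in> carrier_vec (n L)"
  using \<theta>_rvc[of j] rvcD(2) by blast

lemma \<theta>_sq_int: "g \<in> carrier_vec (n L) \<Longrightarrow> sq_int (\<lambda>\<omega>. g \<bullet> \<theta> j \<omega>)"
  using \<theta>_rvc[of j] rvcD(3) lin_span_sq_int by blast

lemma \<theta>_mean: "g \<in> carrier_vec (n L) \<Longrightarrow> expectation (\<lambda>\<omega>. g \<bullet> \<theta> j \<omega>) = g \<bullet> b + XT j g \<bullet> (m Initial - b)"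
  using \<theta>_rvc[of j] rvcD(4) by metis

text \<open>Induction on the lag: the last update of the later state is peeled off, and its noise is
  uncorrelated with the sources that determine state \<open>j\<close>.\<close>

lemma \<theta>_lag_cov:
  assumes "g \<in> carrier_vec (n L)" "h \<in> carrier_vec (n L)"
  shows "cov Pr (\<lambda>\<omega>. g \<bullet> \<theta> (j + s) \<omega>) (\<lambda>\<omega>. h \<bullet> \<theta> j \<omega>) = Q j (XT s g) h"
  using assms(1)
proof (induction s arbitrary: g)
  case 0
  then show ?case using \<theta>_rvc[of j] rvcD(5) assms(2) by (auto simp: XT_0)
next
  case (Suc s)
  let ?g = "transpose_mat (X L) *\<^sub>v g" and ?N = "\<lambda>\<omega>. g \<bullet> update_noise (j + s) L \<omega>"
  have g: "?g \<in> carrier_vec (n L)" using mult_mat_vec_carrier[OF XT_carrier Suc.prems] .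
  obtain \<mu> where r: "rvc (n L) (\<theta> j) \<mu> (Q j) (past j)" using \<theta>_rvc[of j] by blast
  note N = rvcD(2,3)[OF update_noise_rvc[OF order.refl, of "j + s"]]
  have e: "g \<bullet> \<theta> (j + Suc s) \<omega> = (g \<bullet> (b - X L *\<^sub>v b) + ?g \<bullet> \<theta> (j + s) \<omega>) + ?N \<omega>" if \<omega>: "\<omega> \<in> space Pr" for \<omega>
    using \<theta>_Suc_affine[OF \<omega> \<theta>_carrier[OF \<omega>, of "j + s"]] N(1)[OF \<omega>] b \<theta>_carrier[OF \<omega>, of "j + s"] Suc.prems
    by (simp add: sp sp_transpose[of g "X L"])
  have "cov Pr (\<lambda>\<omega>. g \<bullet> \<theta> (j + Suc s) \<omega>) (\<lambda>\<omega>. h \<bullet> \<theta> j \<omega>) =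
      cov Pr (\<lambda>\<omega>. (g \<bullet> (b - X L *\<^sub>v b) + ?g \<bullet> \<theta> (j + s) \<omega>) + ?N \<omega>) (\<lambda>\<omega>. h \<bullet> \<theta> j \<omega>)"
    by (rule cov_cong[OF e refl])
  also have "\<dots> = cov Pr (\<lambda>\<omega>. ?g \<bullet> \<theta> (j + s) \<omega>) (\<lambda>\<omega>. h \<bullet> \<theta> j \<omega>) + cov Pr ?N (\<lambda>\<omega>. h \<bullet> \<theta> j \<omega>)"
    using \<theta>_sq_int[OF g] \<theta>_sq_int[OF assms(2)] lin_span_sq_int[OF N(2)[OF Suc.prems]]
    by (simp add: cov_add_left sq_int_add sq_int_const cov_const)
  also have "cov Pr ?N (\<lambda>\<omega>. h \<bullet> \<theta> j \<omega>) = 0"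
    by (rule lin_span_uncorrelated[OF N(2)[OF Suc.prems] rvcD(3)[OF r assms(2)]])
       (auto simp: past_def update_sources_def)
  finally show ?case using Suc.IH[OF g] Suc.prems by (simp add: XT_Suc)
qed

end

lemma gaussian_mean_vec:
  assumes "prob_space Pr" "gaussian_rv Pr d Y \<mu> \<Sigma>"
  shows "mean_vec Pr d Y = \<mu>" "cov_mat Pr d Y = \<Sigma>"
proof -
  interpret prob_space Pr by fact
  have \<mu>: "\<mu> \<in> carrier_vec d" and \<Sigma>: "\<Sigma> \<in> carrier_mat d d" and c: "\<And>\<omega>. \<omega> \<in> space Pr \<Longrightarrow> Y \<omega> \<in> carrier_vec d"
    using assms(2) by (auto simp: gaussian_rv_def pos_semidef_def)
  have u: "unit_vec d i \<bullet> Y \<omega> = vec_index (Y \<omega>) i" if "\<omega> \<in> space Pr" "i < d" for i \<omega>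
    using scalar_prod_left_unit[OF c[OF that(1)] that(2)] .
  have "expectation (\<lambda>\<omega>. vec_index (Y \<omega>) i) = vec_index \<mu> i" if i: "i < d" for i
  proof -
    have "expectation (\<lambda>\<omega>. vec_index (Y \<omega>) i) = expectation (\<lambda>\<omega>. unit_vec d i \<bullet> Y \<omega>)"
      by (intro Bochner_Integration.integral_cong) (auto simp: u i)
    also have "\<dots> = unit_vec d i \<bullet> \<mu>" by (rule gaussian_rv_moments(2)[OF assms(2) unit_vec_carrier unit_vec_carrier])
    finally show ?thesis using scalar_prod_left_unit[OF \<mu> i] by simp
  qed
  then show "mean_vec Pr d Y = \<mu>" using \<mu> by (intro eq_vecI) (auto simp: mean_vec_def)
  have "cov Pr (\<lambda>\<omega>. vec_index (Y \<omega>) i) (\<lambda>\<omega>. vec_index (Y \<omega>) j) = \<Sigma> $$ (i, j)" if ij: "i < d" "j < d" for i j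
  proof -
    have "cov Pr (\<lambda>\<omega>. vec_index (Y \<omega>) i) (\<lambda>\<omega>. vec_index (Y \<omega>) j) =
        cov Pr (\<lambda>\<omega>. unit_vec d i \<bullet> Y \<omega>) (\<lambda>\<omega>. unit_vec d j \<bullet> Y \<omega>)"
      by (rule cov_cong) (auto simp: u ij)
    also have "\<dots> = unit_vec d i \<bullet> (\<Sigma> *\<^sub>v unit_vec d j)" by (rule gaussian_rv_moments(3)[OF assms(2)]) simp_all
    also have "\<dots> = vec_index (\<Sigma> *\<^sub>v unit_vec d j) i"
      by (rule scalar_prod_left_unit[OF mult_mat_vec_carrier[OF \<Sigma> unit_vec_carrier] ij(1)])
    finally show ?thesis using ij \<Sigma> by simp
  qed
  then show "cov_mat Pr d Y = \<Sigma>" using \<Sigma> by (intro eq_matI) (auto simp: cov_mat_def)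
qed

lemma vnorm_transpose_le:
  assumes "dim_vec x = dim_row Y" shows "vnorm (transpose_mat Y *\<^sub>v x) \<le> mnorm Y * vnorm x"
proof (rule vnorm_le_of_sq)
  let ?z = "transpose_mat Y *\<^sub>v x"
  have "?z \<bullet> ?z = x \<bullet> (Y *\<^sub>v ?z)" using assms sp_transpose[of x Y ?z] by simp
  also have "\<dots> \<le> vnorm x * vnorm (Y *\<^sub>v ?z)" using sp_cauchy_schwarz[of x "Y *\<^sub>v ?z"] assms by simp
  also have "\<dots> \<le> vnorm x * (mnorm Y * vnorm ?z)" by (intro mult_left_mono vnorm_mult_le) simp_all
  finally show "?z \<bullet> ?z \<le> mnorm Y * vnorm x * vnorm ?z" by (simp add: mult_ac)
qed (simp add: mnorm_nonneg)

section \<open>The dual energy norm\<close>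

text \<open>The norm on functionals dual to the energy norm; equally, the energy norm of the
  solution of \<open>A x = v\<close>.\<close>

definition dual_norm :: "rmat \<Rightarrow> rvec \<Rightarrow> real" where
  "dual_norm A v = sqrt (v \<bullet> (minv A *\<^sub>v v))"

locale energy_matrix =
  fixes d :: nat and A :: rmat
  assumes A: "pos_def d A"
begin

lemmas R_pd = msqrt_pos_def[OF A] and J_pd = pos_def_minv_pos_def[OF msqrt_pos_def[OF A]]
  and Ai_pd = pos_def_minv_pos_def[OF A]

lemmas em_dims [simp] = pos_defD(3,4)[OF R_pd] pos_defD(3,4)[OF J_pd] pos_defD(3,4)[OF A] pos_defD(3,4)[OF Ai_pd]

lemma R_R: "dim_vec x = d \<Longrightarrow> msqrt A *\<^sub>v (msqrt A *\<^sub>v x) = A *\<^sub>v x"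
  using msqrt_props(2)[OF A] by (simp flip: mv_mult)

lemma R_J: "dim_vec x = d \<Longrightarrow> msqrt A *\<^sub>v (minv (msqrt A) *\<^sub>v x) = x" "dim_vec x = d \<Longrightarrow> minv (msqrt A) *\<^sub>v (msqrt A *\<^sub>v x) = x"
  using mv_minv[OF R_pd] by auto

lemma R_sp: "dim_vec x = d \<Longrightarrow> dim_vec y = d \<Longrightarrow> x \<bullet> (msqrt A *\<^sub>v y) = (msqrt A *\<^sub>v x) \<bullet> y"
  using sp_transpose[of x "msqrt A" y] pos_defD(2)[OF R_pd] by simp

lemma J_sp: "dim_vec x = d \<Longrightarrow> dim_vec y = d \<Longrightarrow> x \<bullet> (minv (msqrt A) *\<^sub>v y) = (minv (msqrt A) *\<^sub>v x) \<bullet> y"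
  using sp_transpose[of x "minv (msqrt A)" y] pos_defD(2)[OF J_pd] by simp

lemma J_J: "dim_vec x = d \<Longrightarrow> minv (msqrt A) *\<^sub>v (minv (msqrt A) *\<^sub>v x) = minv A *\<^sub>v x"
proof -
  assume x: "dim_vec x = d"
  let ?y = "minv A *\<^sub>v x"
  have "msqrt A *\<^sub>v (msqrt A *\<^sub>v ?y) = x" using x mv_minv(1)[OF A x] by (simp add: R_R)
  then have "minv (msqrt A) *\<^sub>v (minv (msqrt A) *\<^sub>v x) = minv (msqrt A) *\<^sub>v (minv (msqrt A) *\<^sub>v (msqrt A *\<^sub>v (msqrt A *\<^sub>v ?y)))"
    by simp
  then show ?thesis by (simp add: R_J)
qed

lemma dual_norm_J: "dim_vec v = d \<Longrightarrow> dual_norm A v = vnorm (minv (msqrt A) *\<^sub>v v)"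
  unfolding dual_norm_def vnorm_def by (simp add: J_sp flip: J_J)

lemma dual_norm_nonneg: "dim_vec v = d \<Longrightarrow> 0 \<le> dual_norm A v"
  by (simp add: dual_norm_J)

lemma dual_norm_sq: "dim_vec v = d \<Longrightarrow> (dual_norm A v)\<^sup>2 = v \<bullet> (minv A *\<^sub>v v)"
  unfolding dual_norm_J vnorm_power2 by (simp add: J_sp flip: J_J)

lemma dual_form_le: "dim_vec v = d \<Longrightarrow> dim_vec w = d \<Longrightarrow> \<bar>v \<bullet> (minv A *\<^sub>v w)\<bar> \<le> dual_norm A v * dual_norm A w"
  unfolding dual_norm_J using sp_cauchy_schwarz[of "minv (msqrt A) *\<^sub>v v" "minv (msqrt A) *\<^sub>v w"]
  by (simp add: J_sp flip: J_J)

lemma dual_pairing_le: "dim_vec v = d \<Longrightarrow> dim_vec x = d \<Longrightarrow> \<bar>v \<bullet> x\<bar> \<le> dual_norm A v * vnorm (msqrt A *\<^sub>v x)"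
proof -
  assume d: "dim_vec v = d" "dim_vec x = d"
  have "v \<bullet> x = (minv (msqrt A) *\<^sub>v v) \<bullet> (msqrt A *\<^sub>v x)"
    using d by (simp add: R_J flip: J_sp)
  then show ?thesis using d sp_cauchy_schwarz[of "minv (msqrt A) *\<^sub>v v" "msqrt A *\<^sub>v x"] by (simp add: dual_norm_J)
qed

text \<open>\<open>energy_mnorm\<close> is the operator norm of \<open>R X J\<close> with
  \<open>R = msqrt A\<close> and \<open>J\<close> its inverse. The transpose of that matrix carries
  \<open>J v\<close> to \<open>J X\<^sup>T v\<close>, whose Euclidean length is the dual
  norm.\<close>

lemma dual_norm_transpose_le:
  assumes X: "X \<in> carrier_mat d d" and v: "dim_vec v = d"
  shows "dual_norm A (transpose_mat X *\<^sub>v v) \<le> energy_mnorm A X * dual_norm A v"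
proof -
  note [simp] = carrier_matD[OF X]
  let ?Y = "msqrt A * X * minv (msqrt A)" and ?y = "minv (msqrt A) *\<^sub>v v"
  have "transpose_mat ?Y *\<^sub>v ?y = minv (msqrt A) *\<^sub>v (transpose_mat X *\<^sub>v v)"
    using v pos_defD(2)[OF R_pd] pos_defD(2)[OF J_pd] by (simp add: tr mv R_J)
  moreover have "vnorm (transpose_mat ?Y *\<^sub>v ?y) \<le> mnorm ?Y * vnorm ?y" by (rule vnorm_transpose_le) simp
  ultimately show ?thesis using v by (simp add: dual_norm_J energy_mnorm_def)
qed

lemma energy_mnorm_nonneg: "0 \<le> energy_mnorm A X"
  by (simp add: energy_mnorm_def mnorm_nonneg)

text \<open>Conjugation with \<open>msqrt A\<close> turns an energy-selfadjoint nonnegative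
  \<open>X\<close> into a symmetric semidefinite matrix, for which a bound on the quadratic form is
  a bound on the norm.\<close>

lemma energy_mnorm_le:
  assumes X: "X \<in> carrier_mat d d" and \<delta>: "0 \<le> \<delta>"
    and sym: "\<And>x y. dim_vec x = d \<Longrightarrow> dim_vec y = d \<Longrightarrow> x \<bullet> (A *\<^sub>v (X *\<^sub>v y)) = (X *\<^sub>v x) \<bullet> (A *\<^sub>v y)"
    and nn: "\<And>x. dim_vec x = d \<Longrightarrow> 0 \<le> x \<bullet> (A *\<^sub>v (X *\<^sub>v x))"
    and le: "\<And>x. dim_vec x = d \<Longrightarrow> x \<bullet> (A *\<^sub>v (X *\<^sub>v x)) \<le> \<delta> * (x \<bullet> (A *\<^sub>v x))"
  shows "energy_mnorm A X \<le> \<delta>"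
  unfolding energy_mnorm_def
proof (rule psd_mnorm_le[OF _ _ \<delta>])
  note [simp] = carrier_matD[OF X]
  let ?Y = "msqrt A * X * minv (msqrt A)" and ?J = "minv (msqrt A)"
  have Y: "?Y \<in> carrier_mat d d" by (rule carrier_matI) simp_all
  have Yf: "x \<bullet> (?Y *\<^sub>v y) = (?J *\<^sub>v x) \<bullet> (A *\<^sub>v (X *\<^sub>v (?J *\<^sub>v y)))" if "dim_vec x = d" "dim_vec y = d" for x y
    using that R_sp[of "?J *\<^sub>v x" "msqrt A *\<^sub>v (X *\<^sub>v (?J *\<^sub>v y))"] by (simp add: mv R_R R_J)
  show "pos_semidef d ?Y" unfolding pos_semidef_def
  proof (intro conjI ballI Y)
    show "transpose_mat ?Y = ?Y"
    proof (rule mat_eq_mv[of _ d d], use Y in simp, rule Y, rule vec_eq_sp[of _ d])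
      fix x g :: rvec assume x: "x \<in> carrier_vec d" and g: "g \<in> carrier_vec d"
      have "g \<bullet> (transpose_mat ?Y *\<^sub>v x) = (?Y *\<^sub>v g) \<bullet> x"
        using sp_transpose[of g "transpose_mat ?Y" x] x g by simp
      also have "\<dots> = x \<bullet> (?Y *\<^sub>v g)" using x by (intro sp_comm) simp
      also have "\<dots> = (X *\<^sub>v (?J *\<^sub>v x)) \<bullet> (A *\<^sub>v (?J *\<^sub>v g))" using x g by (simp only: Yf carrier_vecD sym em_dims dim_mult_mat_vec)
      also have "\<dots> = (?J *\<^sub>v g) \<bullet> (A *\<^sub>v (X *\<^sub>v (?J *\<^sub>v x)))" by (rule sp_sym[OF pos_defD(2)[OF A]]) simp_all
      also have "\<dots> = g \<bullet> (?Y *\<^sub>v x)" using x g by (simp only: Yf carrier_vecD)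
      finally show "g \<bullet> (transpose_mat ?Y *\<^sub>v x) = g \<bullet> (?Y *\<^sub>v x)" .
    qed (auto intro!: carrier_vecI)
    show "0 \<le> x \<bullet> (?Y *\<^sub>v x)" if "x \<in> carrier_vec d" for x
      using that nn[of "?J *\<^sub>v x"] by (simp only: Yf carrier_vecD em_dims dim_mult_mat_vec)
  qed
  show "x \<bullet> (?Y *\<^sub>v x) \<le> \<delta> * (x \<bullet> x)" if x: "x \<in> carrier_vec d" for x
  proof -
    have "x \<bullet> (?Y *\<^sub>v x) \<le> \<delta> * ((?J *\<^sub>v x) \<bullet> (A *\<^sub>v (?J *\<^sub>v x)))"
      using x le[of "?J *\<^sub>v x"] by (simp only: Yf carrier_vecD em_dims dim_mult_mat_vec)
    also have "(?J *\<^sub>v x) \<bullet> (A *\<^sub>v (?J *\<^sub>v x)) = x \<bullet> x"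
      using x by (simp add: R_sp R_J flip: R_R)
    finally show ?thesis .
  qed
qed

text \<open>Makes the hypothesis on the initial covariance a bound for the variance of a functional
  in terms of its dual norm.\<close>

lemma form_le_dual_norm:
  assumes C: "C \<in> carrier_mat d d" and v: "dim_vec v = d"
  shows "v \<bullet> (C *\<^sub>v v) \<le> mnorm (msqrt A * C * msqrt A) * (dual_norm A v)\<^sup>2"
proof -
  note [simp] = carrier_matD[OF C]
  let ?y = "minv (msqrt A) *\<^sub>v v"
  have "?y \<bullet> ((msqrt A * C * msqrt A) *\<^sub>v ?y) \<le> mnorm (msqrt A * C * msqrt A) * (?y \<bullet> ?y)"
    by (rule form_le_mnorm[of _ d]) (auto intro!: carrier_matI carrier_vecI)
  also have "?y \<bullet> ((msqrt A * C * msqrt A) *\<^sub>v ?y) = v \<bullet> (C *\<^sub>v v)"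
    using v by (simp add: mv R_sp R_J)
  finally show ?thesis using v by (simp add: dual_norm_J vnorm_power2)
qed

end

text \<open>Lag 0 is left out of the series, so the majorant sums to
  \<open>\<rho> / (1 - \<rho>)\<close>, and
  \<open>1 + 2 * \<rho> / (1 - \<rho>) = (1 + \<rho>) / (1 - \<rho>)\<close>. With
  \<open>a = l\<close> and \<open>K = 0\<close> the lemma treats the limit alone.\<close>

lemma autocorrelation_sum_bounds:
  fixes a l :: "nat \<Rightarrow> real"
  assumes \<rho>: "0 \<le> \<rho>" "\<rho> < 1" and l: "\<And>s. \<bar>l s\<bar> \<le> \<rho> ^ s" and a: "\<And>s. \<bar>a s - l s\<bar> \<le> K * \<rho> ^ s"
  shows "summable (\<lambda>s. l (Suc s))" "summable (\<lambda>s. a (Suc s))"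
    "1 + 2 * (\<Sum>s. l (Suc s)) \<le> (1 + \<rho>) / (1 - \<rho>)"
    "\<bar>(1 + 2 * (\<Sum>s. a (Suc s))) - (1 + 2 * (\<Sum>s. l (Suc s)))\<bar> \<le> 2 * K * (\<rho> / (1 - \<rho>))"
proof -
  have g: "(\<lambda>s. c * \<rho> ^ Suc s) sums (c * (\<rho> / (1 - \<rho>)))" for c
    using sums_mult[OF geometric_sums[of \<rho>], of "c * \<rho>"] \<rho> by (simp add: mult_ac)
  have lb: "norm (l (Suc s)) \<le> 1 * \<rho> ^ Suc s" and ab: "norm (a (Suc s) - l (Suc s)) \<le> K * \<rho> ^ Suc s" for s
    using l[of "Suc s"] a[of "Suc s"] by simp_all
  show sl: "summable (\<lambda>s. l (Suc s))"
    by (rule summable_comparison_test'[OF sums_summable[OF g[of 1]] lb])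
  have sd: "summable (\<lambda>s. a (Suc s) - l (Suc s))"
    by (rule summable_comparison_test'[OF sums_summable[OF g[of K]] ab])
  show sa: "summable (\<lambda>s. a (Suc s))" using summable_add[OF sd sl] by simp
  have "(\<Sum>s. l (Suc s)) \<le> 1 * (\<rho> / (1 - \<rho>))"
    by (rule sums_le[OF _ summable_sums[OF sl] g[of 1]]) (use lb in \<open>simp only: real_norm_def abs_le_iff\<close>)
  then show "1 + 2 * (\<Sum>s. l (Suc s)) \<le> (1 + \<rho>) / (1 - \<rho>)" using \<rho> by (simp add: field_simps)
  have "(\<Sum>s. a (Suc s) - l (Suc s)) \<le> K * (\<rho> / (1 - \<rho>))"
    by (rule sums_le[OF _ summable_sums[OF sd] g[of K]]) (use ab in \<open>simp only: real_norm_def abs_le_iff\<close>)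
  moreover have "- (K * (\<rho> / (1 - \<rho>))) \<le> (\<Sum>s. a (Suc s) - l (Suc s))"
  proof (rule sums_le[OF _ sums_minus[OF g[of K]] summable_sums[OF sd]])
    show "- (K * \<rho> ^ Suc s) \<le> a (Suc s) - l (Suc s)" for s using a[of "Suc s"] by linarith
  qed
  moreover have "(\<Sum>s. a (Suc s) - l (Suc s)) = (\<Sum>s. a (Suc s)) - (\<Sum>s. l (Suc s))"
    by (rule suminf_diff[OF sa sl, symmetric])
  ultimately show "\<bar>(1 + 2 * (\<Sum>s. a (Suc s))) - (1 + 2 * (\<Sum>s. l (Suc s)))\<bar> \<le> 2 * K * (\<rho> / (1 - \<rho>))"
    by (simp only: abs_le_iff mult.assoc) linarith
qed

context prob_space begin

lemma cov_sum_right: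
  assumes "finite J" "\<And>j. j \<in> J \<Longrightarrow> sq_int (u j)" "sq_int Y"
  shows "cov M Y (\<lambda>\<omega>. \<Sum>j\<in>J. u j \<omega>) = (\<Sum>j\<in>J. cov M Y (u j)) \<and> sq_int (\<lambda>\<omega>. \<Sum>j\<in>J. u j \<omega>)"
  using assms(1,2)
proof (induction rule: finite_induct)
  case empty
  then show ?case by (simp add: cov_const sq_int_const)
next
  case (insert j J)
  then show ?case using assms(3) by (simp add: cov_add_right sq_int_add)
qed

text \<open>A new summand contributes its variance, at most \<open>K\<close>, and twice its
  covariances with the predecessors. Together this is at most
  \<open>K * ((1 + \<rho>) / (1 - \<rho>))\<close>, a fixed amount per summand.\<close>

lemma variance_sum_le:
  fixes u :: "nat \<Rightarrow> 'a \<Rightarrow> real"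
  assumes u: "\<And>j. sq_int (u j)" and \<rho>: "0 \<le> \<rho>" "\<rho> < 1"
    and c: "\<And>j s. \<bar>cov M (u (j + s)) (u j)\<bar> \<le> K * \<rho> ^ s"
  shows "cov M (\<lambda>\<omega>. \<Sum>j=1..N. u j \<omega>) (\<lambda>\<omega>. \<Sum>j=1..N. u j \<omega>) \<le> real N * (K * (2 / (1 - \<rho>)))"
proof (induction N)
  case 0
  show ?case by (simp add: cov_const)
next
  case (Suc N)
  let ?S = "\<lambda>\<omega>. \<Sum>j=1..N. u j \<omega>"
  have K: "0 \<le> K" using order_trans[OF abs_ge_zero c[of 0 0]] by simp
  have S: "sq_int ?S" using cov_sum_right[of "{1..N}" u "u 0"] u by auto
  have "cov M (u (Suc N)) ?S = (\<Sum>j=1..N. cov M (u (Suc N)) (u j))"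
    using cov_sum_right[of "{1..N}" u "u (Suc N)"] u by auto
  also have "\<dots> \<le> (\<Sum>j=1..N. K * \<rho> ^ (Suc N - j))"
  proof (rule sum_mono)
    fix j assume "j \<in> {1..N}"
    then have "Suc N = j + (Suc N - j)" by auto
    then show "cov M (u (Suc N)) (u j) \<le> K * \<rho> ^ (Suc N - j)"
      using c[of j "Suc N - j"] by simp
  qed
  also have "\<dots> = K * (\<Sum>j=1..N. \<rho> ^ j)"
    unfolding sum_distrib_left
    by (rule sum.reindex_bij_witness[of _ "\<lambda>j. Suc N - j" "\<lambda>j. Suc N - j"]) auto
  also have "\<dots> \<le> K * (\<rho> / (1 - \<rho>))"
  proof (rule mult_left_mono[OF _ K])
    have "(\<Sum>j=1..N. \<rho> ^ j) = \<rho> * (\<Sum>j<N. \<rho> ^ j)"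
      by (simp add: sum_distrib_left sum.atLeast1_atMost_eq)
    also have "\<dots> \<le> \<rho> * (1 / (1 - \<rho>))"
      using \<rho> by (intro mult_left_mono) (simp_all add: sum_gp_strict divide_right_mono)
    finally show "(\<Sum>j=1..N. \<rho> ^ j) \<le> \<rho> / (1 - \<rho>)" by simp
  qed
  finally have cross: "cov M (u (Suc N)) ?S \<le> K * (\<rho> / (1 - \<rho>))" .
  have var: "cov M (u (Suc N)) (u (Suc N)) \<le> K" using c[of "Suc N" 0] by simp
  have "cov M (\<lambda>\<omega>. ?S \<omega> + u (Suc N) \<omega>) (\<lambda>\<omega>. ?S \<omega> + u (Suc N) \<omega>) =
      cov M ?S ?S + 2 * cov M (u (Suc N)) ?S + cov M (u (Suc N)) (u (Suc N))"
    using S u[of "Suc N"] cov_sym[of ?S "u (Suc N)"] by (simp add: cov_add_left cov_add_right sq_int_add)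
  also have "\<dots> \<le> real N * (K * (2 / (1 - \<rho>))) + (2 * (K * (\<rho> / (1 - \<rho>))) + K)"
    using Suc cross var by linarith
  also have "2 * (K * (\<rho> / (1 - \<rho>))) + K = K * ((1 + \<rho>) / (1 - \<rho>))" using \<rho> by (simp add: field_simps)
  also have "\<dots> \<le> K * (2 / (1 - \<rho>))" using \<rho> K by (intro mult_left_mono divide_right_mono) auto
  finally have F: "cov M (\<lambda>\<omega>. ?S \<omega> + u (Suc N) \<omega>) (\<lambda>\<omega>. ?S \<omega> + u (Suc N) \<omega>) \<le>
      real N * (K * (2 / (1 - \<rho>))) + K * (2 / (1 - \<rho>))" by simp
  have "(\<lambda>\<omega>. \<Sum>j=1..Suc N. u j \<omega>) = (\<lambda>\<omega>. ?S \<omega> + u (Suc N) \<omega>)" by (simp add: fun_eq_iff)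
  moreover have "real (Suc N) * (K * (2 / (1 - \<rho>))) = real N * (K * (2 / (1 - \<rho>))) + K * (2 / (1 - \<rho>))"
    by (simp only: of_nat_Suc distrib_right mult_1_left add.commute)
  ultimately show ?case using F by simp
qed

lemma mean_square_error_split:
  assumes "sq_int Y"
  shows "expectation (\<lambda>\<omega>. \<bar>c - Y \<omega>\<bar> ^ 2) = (c - expectation Y)\<^sup>2 + cov M Y Y"
proof -
  have "expectation (\<lambda>\<omega>. \<bar>c - Y \<omega>\<bar> ^ 2) = expectation (\<lambda>\<omega>. c\<^sup>2 - 2 * c * Y \<omega> + Y \<omega> * Y \<omega>)"
    by (simp add: power2_eq_square algebra_simps)
  also have "\<dots> = c\<^sup>2 - 2 * c * expectation Y + expectation (\<lambda>\<omega>. Y \<omega> * Y \<omega>)"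
    using sq_int_integrable[OF assms] sq_int_mult[OF assms assms] by (simp add: prob_space)
  also have "\<dots> = (c - expectation Y)\<^sup>2 + cov M Y Y"
    unfolding cov_eq[OF assms assms] by (simp add: power2_eq_square algebra_simps)
  finally show ?thesis .
qed

end

section \<open>Galerkin hierarchies\<close>

lemma diag_lower_props:
  shows "dim_row (diag_part A) = dim_row A" "dim_col (diag_part A) = dim_col A"
    "dim_row (lower_part A) = dim_row A" "dim_col (lower_part A) = dim_col A"
  by (simp_all add: diag_part_def lower_part_def)

section \<open>The symmetric Gauss-Seidel splitting with the data term\<close>

locale sgs_splitting =
  fixes d :: nat and A K :: rmat
  assumes A: "pos_def d A" and K: "pos_semidef d K"
begin

abbreviation "D \<equiv> diag_part A"
abbreviation "Lo \<equiv> lower_part A"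

lemmas sg_dims [simp] = pos_defD(3,4)[OF A] pos_semidefD(3,4)[OF K] diag_lower_props

lemma A_split: "A = D + Lo + transpose_mat Lo"
proof (rule eq_matI)
  fix i j assume "i < dim_row (D + Lo + transpose_mat Lo)" "j < dim_col (D + Lo + transpose_mat Lo)"
  then have ij: "i < d" "j < d" by auto
  have "A $$ (i, j) = A $$ (j, i)" using pos_defD(2)[OF A] ij by (metis index_transpose_mat(1) sg_dims(1,2))
  then show "A $$ (i, j) = (D + Lo + transpose_mat Lo) $$ (i, j)"
    using ij by (auto simp: diag_part_def lower_part_def)
qed simp_all

lemma D_pd: "pos_def d D"
  unfolding pos_def_def
proof (intro conjI ballI impI)
  show "D \<in> carrier_mat d d" by (rule carrier_matI) simp_all
  show "transpose_mat D = D" by (rule eq_matI) (auto simp: diag_part_def)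
  fix x :: rvec assume x: "x \<in> carrier_vec d" "x \<noteq> 0\<^sub>v d"
  have pos: "0 < A $$ (i, i)" if i: "i < d" for i
  proof -
    have "unit_vec d i \<noteq> (0\<^sub>v d :: rvec)" using i by (metis index_unit_vec(2) index_zero_vec(1) zero_neq_one)
    then have "0 < unit_vec d i \<bullet> (A *\<^sub>v unit_vec d i)" using pos_defD(5)[OF A unit_vec_carrier] by simp
    also have "unit_vec d i \<bullet> (A *\<^sub>v unit_vec d i) = vec_index (A *\<^sub>v unit_vec d i) i"
      by (rule scalar_prod_left_unit[OF mult_mat_vec_carrier[OF pos_defD(1)[OF A] unit_vec_carrier] i])
    finally show ?thesis using i by simp
  qed
  have row: "vec_index (D *\<^sub>v x) i = A $$ (i, i) * vec_index x i" if i: "i < d" for i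
  proof -
    have "vec_index (D *\<^sub>v x) i = (\<Sum>j<d. (if i = j then A $$ (i, j) else 0) * vec_index x j)"
      using i x by (simp add: scalar_prod_def diag_part_def atLeast0LessThan)
    also have "\<dots> = (\<Sum>j<d. if j = i then A $$ (i, i) * vec_index x i else 0)" by (intro sum.cong) auto
    finally show ?thesis using i by simp
  qed
  have "x \<bullet> (D *\<^sub>v x) = (\<Sum>i<d. A $$ (i, i) * (vec_index x i)\<^sup>2)"
    unfolding scalar_prod_def by (simp add: row power2_eq_square atLeast0LessThan mult_ac del: index_mult_mat_vec)
  moreover obtain i where i: "i < d" "vec_index x i \<noteq> 0" using x by (metis carrier_vecD eq_vecI index_zero_vec)
  ultimately show "0 < x \<bullet> (D *\<^sub>v x)"
    using pos by (auto intro!: sum_pos2[of _ i] simp: less_imp_le)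
qed

lemma DK_pd: "pos_def d (D + K)"
  by (rule pos_def_ge[OF D_pd])
    (use pos_defD(1,2)[OF D_pd] pos_semidefD(1,2,5)[OF K] in \<open>auto simp: tr mv sp\<close>)

lemmas sg_dims' [simp] = pos_defD(3,4)[OF pos_def_minv_pos_def[OF DK_pd]] pos_defD(3,4)[OF pos_def_minv_pos_def[OF D_pd]]

lemma sgs_update_carrier: "sgs_update A K \<in> carrier_mat d d"
  by (rule carrier_matI) (simp_all add: sgs_update_def)

lemma sgs_carrier: "sgs A \<in> carrier_mat d d"
  by (rule carrier_matI) (simp_all add: sgs_def)

text \<open>With \<open>N = D + K\<close> the product
  \<open>(N + L) N\<inverse> (N + L\<^sup>T)\<close> expands to
  \<open>N + L + L\<^sup>T + L N\<inverse> L\<^sup>T\<close>, and the first three terms are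
  \<open>A + K\<close>.\<close>

lemma sgs_update_eq: "sgs_update A K = A + K + Lo * minv (D + K) * transpose_mat Lo"
proof (rule mat_eq_mv[OF sgs_update_carrier])
  fix x :: rvec assume x: "x \<in> carrier_vec d"
  have "(D + K) *\<^sub>v (minv (D + K) *\<^sub>v z) = z" "minv (D + K) *\<^sub>v ((D + K) *\<^sub>v z) = z" if "dim_vec z = d" for z
    using mv_minv[OF DK_pd that] .
  note c = this
  have "sgs_update A K *\<^sub>v x = (D + K + Lo) *\<^sub>v (minv (D + K) *\<^sub>v ((D + K) *\<^sub>v x + transpose_mat Lo *\<^sub>v x))"
    using x by (simp add: sgs_update_def mv_mult mv_add)
  also have "\<dots> = (D + K + Lo) *\<^sub>v (x + minv (D + K) *\<^sub>v (transpose_mat Lo *\<^sub>v x))"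
    using x by (simp add: mv_vadd c)
  also have "\<dots> = (D + K) *\<^sub>v x + transpose_mat Lo *\<^sub>v x + Lo *\<^sub>v x + Lo *\<^sub>v (minv (D + K) *\<^sub>v (transpose_mat Lo *\<^sub>v x))"
    using x mv_add[of "D + K" Lo] by (intro eq_vecI) (simp_all add: mv_vadd c del: index_mult_mat_vec mv_add)
  also have "\<dots> = (A + K + Lo * minv (D + K) * transpose_mat Lo) *\<^sub>v x"
    by (subst (3) A_split) (use x in \<open>intro eq_vecI; simp add: mv del: index_mult_mat_vec\<close>)
  finally show "sgs_update A K *\<^sub>v x = (A + K + Lo * minv (D + K) * transpose_mat Lo) *\<^sub>v x" .
qed (rule carrier_matI; simp)

lemma sgs_update_sym: "transpose_mat (sgs_update A K) = sgs_update A K"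
proof -
  have t: "transpose_mat (minv (D + K)) = minv (D + K)" by (rule pos_defD(2)[OF pos_def_minv_pos_def[OF DK_pd]])
  show ?thesis unfolding sgs_update_eq
    using pos_defD(2)[OF A] pos_semidefD(2)[OF K]
    by (simp add: tr t assoc_mult_mat[of Lo d d "minv (D + K)" d "transpose_mat Lo" d] carrier_matI)
qed

lemma sgs_update_form: "x \<in> carrier_vec d \<Longrightarrow>
    x \<bullet> (sgs_update A K *\<^sub>v x) = x \<bullet> (A *\<^sub>v x) + x \<bullet> (K *\<^sub>v x) +
      (transpose_mat Lo *\<^sub>v x) \<bullet> (minv (D + K) *\<^sub>v (transpose_mat Lo *\<^sub>v x))"
  by (simp add: sgs_update_eq mv sp sp_transpose[of x Lo])

lemma sgs_update_ge:
  assumes x: "x \<in> carrier_vec d"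
  shows "x \<bullet> ((A + K) *\<^sub>v x) \<le> x \<bullet> (sgs_update A K *\<^sub>v x)"
proof -
  have "0 \<le> (transpose_mat Lo *\<^sub>v x) \<bullet> (minv (D + K) *\<^sub>v (transpose_mat Lo *\<^sub>v x))"
    by (rule pos_semidefD(5)[OF pos_def_imp_semidef[OF pos_def_minv_pos_def[OF DK_pd]]]) (auto intro: carrier_vecI)
  then show ?thesis unfolding sgs_update_form[OF x] using x by (simp add: mv sp)
qed

text \<open>For \<open>w = D\<inverse> y\<close> and \<open>z = (D + K)\<inverse> y\<close>, expand
  \<open>0 \<le> (w - z) \<bullet> D (w - z)\<close> and use
  \<open>z \<bullet> y = z \<bullet> D z + z \<bullet> K z\<close>.\<close>

lemma minv_antitone:
  assumes y: "y \<in> carrier_vec d"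
  shows "y \<bullet> (minv (D + K) *\<^sub>v y) \<le> y \<bullet> (minv D *\<^sub>v y)"
proof -
  let ?z = "minv (D + K) *\<^sub>v y" and ?w = "minv D *\<^sub>v y"
  have d [simp]: "dim_vec y = d" using y by simp
  have "0 \<le> (?w - ?z) \<bullet> (D *\<^sub>v (?w - ?z))"
    by (rule pos_semidefD(5)[OF pos_def_imp_semidef[OF D_pd]]) (auto intro: carrier_vecI)
  also have "\<dots> = ?w \<bullet> y - ?w \<bullet> (D *\<^sub>v ?z) - ?z \<bullet> y + ?z \<bullet> (D *\<^sub>v ?z)"
    by (simp add: mv sp mv_minv[OF D_pd])
  also have "?w \<bullet> (D *\<^sub>v ?z) = ?z \<bullet> y"
    using sp_sym[OF pos_defD(2)[OF D_pd], of ?w ?z] by (simp add: mv_minv[OF D_pd])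
  finally have 1: "2 * (?z \<bullet> y) \<le> ?w \<bullet> y + ?z \<bullet> (D *\<^sub>v ?z)" by simp
  have "?z \<bullet> y = ?z \<bullet> (D *\<^sub>v ?z) + ?z \<bullet> (K *\<^sub>v ?z)"
    using arg_cong[OF mv_minv(1)[OF DK_pd d], of "\<lambda>v. ?z \<bullet> v"] by (simp add: mv_add sp_addr)
  moreover have "0 \<le> ?z \<bullet> (K *\<^sub>v ?z)" by (rule pos_semidefD(5)[OF K]) (auto intro: carrier_vecI)
  ultimately have "?z \<bullet> y \<le> ?w \<bullet> y" using 1 by linarith
  then show ?thesis using sp_comm[of ?z y] sp_comm[of ?w y] by simp
qed

lemma sgs_form: "x \<in> carrier_vec d \<Longrightarrow>
    x \<bullet> (sgs A *\<^sub>v x) = x \<bullet> (A *\<^sub>v x) + (transpose_mat Lo *\<^sub>v x) \<bullet> (minv D *\<^sub>v (transpose_mat Lo *\<^sub>v x))"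
proof -
  assume x: "x \<in> carrier_vec d"
  have Z: "pos_semidef d (0\<^sub>m d d)" by (auto simp: pos_semidef_def mv sp intro!: eq_matI)
  \<comment> \<open>The plain splitting is the case \<open>K = 0\<close> of the updated one.\<close>
  interpret Z: sgs_splitting d A "0\<^sub>m d d" by unfold_locales (rule A Z)+
  have D0: "D + 0\<^sub>m d d = D" by (rule right_add_zero_mat[of D d d]) (rule pos_defD(1)[OF D_pd])
  have "sgs_update A (0\<^sub>m d d) = sgs A" unfolding sgs_update_def sgs_def D0 ..
  then show ?thesis using Z.sgs_update_form[OF x] x unfolding D0 by (simp add: mv sp)
qed

lemma sgs_update_le:
  assumes x: "x \<in> carrier_vec d"
  shows "x \<bullet> (sgs_update A K *\<^sub>v x) \<le> x \<bullet> (sgs A *\<^sub>v x) + x \<bullet> (K *\<^sub>v x)"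
  unfolding sgs_update_form[OF x] sgs_form[OF x]
  using minv_antitone[of "transpose_mat Lo *\<^sub>v x"] by (simp add: carrier_vecI)

end

section \<open>Galerkin matrices as forms on the Hilbert space\<close>

locale multilevel_fem = perturbed_form V S "\<lambda>u v. Obs u \<bullet> (minv \<Gamma> *\<^sub>v Obs v)" K Kc
  for V :: "'h::{real_inner, complete_space} set" and S and Obs :: "'h \<Rightarrow> rvec" and \<Gamma> K Kc +
  fixes \<phi> :: "nat \<Rightarrow> nat \<Rightarrow> 'h" and n :: "nat \<Rightarrow> nat" and \<beta> :: nat
  assumes basis: "is_level_basis \<phi> n l"
    and inV: "level_space \<phi> n l \<subseteq> V"
    and nested: "level_space \<phi> n l \<subseteq> level_space \<phi> n (Suc l)"
    and Obs: "bounded_linear_obs \<beta> Obs"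
    and Gamma: "pos_def \<beta> \<Gamma>"
begin

abbreviation "Pl \<equiv> recon \<phi> n"
abbreviation "Al \<equiv> stiffness_mat S \<phi> n"
abbreviation "Bl \<equiv> obs_mat \<beta> Obs \<phi> n"
abbreviation "Kl l \<equiv> Bl l * minv \<Gamma> * transpose_mat (Bl l)"
abbreviation "At l \<equiv> Al l + Kl l"
abbreviation "Mt l \<equiv> sgs_update (Al l) (Kl l)"
abbreviation "Il \<equiv> prolongation \<phi> n"

lemma Obs_props:
  "dim_vec (Obs u) = \<beta>" "Obs (u + v) = Obs u + Obs v" "Obs (r *\<^sub>R u) = r \<cdot>\<^sub>v Obs u"
  using Obs by (auto simp: bounded_linear_obs_def dest: carrier_vecD)

lemma fem_dims [simp]: "dim_row (Al l) = n l" "dim_col (Al l) = n l" "dim_row (Bl l) = n l" "dim_col (Bl l) = \<beta>"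
  "dim_row (minv \<Gamma>) = \<beta>" "dim_col (minv \<Gamma>) = \<beta>"
  using pos_def_minv(1)[OF Gamma] by (auto simp: stiffness_mat_def obs_mat_def)

lemma recon_mem: "Pl l x \<in> level_space \<phi> n l"
  unfolding recon_def level_space_def by (intro span_sum span_scale span_base) auto

lemma recon_V: "Pl l x \<in> V"
  using recon_mem inV by blast

lemma basis_V: "j < n l \<Longrightarrow> \<phi> l j \<in> V"
  using inV[of l] span_base[of "\<phi> l j" "\<phi> l ` {..<n l}"] by (auto simp: level_space_def)

lemma recon_surj: "v \<in> level_space \<phi> n l \<Longrightarrow> \<exists>x\<in>carrier_vec (n l). Pl l x = v"
proof -
  assume v: "v \<in> level_space \<phi> n l"
  have inj: "inj_on (\<phi> l) {..<n l}" using basis[of l] by (simp add: is_level_basis_def)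
  obtain u where "v = (\<Sum>w\<in>\<phi> l ` {..<n l}. u w *\<^sub>R w)"
    using v unfolding level_space_def span_finite[OF finite_imageI[OF finite_lessThan]] by blast
  also have "\<dots> = (\<Sum>j<n l. u (\<phi> l j) *\<^sub>R \<phi> l j)" by (rule sum.reindex_cong[OF inj]) auto
  finally have "Pl l (Matrix.vec (n l) (\<lambda>j. u (\<phi> l j))) = v" by (simp add: recon_def)
  then show ?thesis by (intro bexI[of _ "Matrix.vec (n l) (\<lambda>j. u (\<phi> l j))"]) auto
qed

lemma recon_eq_0: "x \<in> carrier_vec (n l) \<Longrightarrow> Pl l x = 0 \<Longrightarrow> x = 0\<^sub>v (n l)"
proof -
  assume x: "x \<in> carrier_vec (n l)" and 0: "Pl l x = 0"
  have inj: "inj_on (\<phi> l) {..<n l}" and ind: "independent (\<phi> l ` {..<n l})"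
    using basis[of l] by (auto simp: is_level_basis_def)
  let ?u = "\<lambda>w. vec_index x (inv_into {..<n l} (\<phi> l) w)"
  have "(\<Sum>w\<in>\<phi> l ` {..<n l}. ?u w *\<^sub>R w) = Pl l x"
    unfolding recon_def by (rule sum.reindex_cong[OF inj refl]) (simp add: inv_into_f_f[OF inj])
  then have "?u w = 0" if "w \<in> \<phi> l ` {..<n l}" for w
    using independentD[OF ind finite_imageI[OF finite_lessThan] subset_refl, of ?u w] that 0 by simp
  then have "vec_index x j = 0" if "j < n l" for j
    using that inv_into_f_f[OF inj, of j] by force
  then show ?thesis using x by (intro eq_vecI) auto
qed

lemma S_sum: "finite J \<Longrightarrow> (\<And>j. j \<in> J \<Longrightarrow> f j \<in> V) \<Longrightarrow> S (\<Sum>j\<in>J. f j) = (\<Sum>j\<in>J. S (f j)) \<and> (\<Sum>j\<in>J. f j) \<in> V"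
proof (induction rule: finite_induct)
  case empty
  have "S (0 *\<^sub>R 0) = 0 *\<^sub>R S 0" by (rule S_scale[OF subspace_0[OF V]])
  then show ?case using subspace_0[OF V] by simp
next
  case (insert j J)
  then show ?case using subspace_add[OF V] by (simp add: S_add)
qed

lemma S_recon: "S (Pl l x) = (\<Sum>j<n l. vec_index x j *\<^sub>R S (\<phi> l j))"
proof -
  have "S (Pl l x) = (\<Sum>j<n l. S (vec_index x j *\<^sub>R \<phi> l j))"
    unfolding recon_def using S_sum[of "{..<n l}" "\<lambda>j. vec_index x j *\<^sub>R \<phi> l j"] basis_V subspace_scale[OF V] by auto
  also have "\<dots> = (\<Sum>j<n l. vec_index x j *\<^sub>R S (\<phi> l j))" by (intro sum.cong refl S_scale basis_V) auto
  finally show ?thesis .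
qed

lemma Al_form:
  assumes "dim_vec x = n l" "dim_vec y = n l"
  shows "x \<bullet> (Al l *\<^sub>v y) = inner (S (Pl l x)) (S (Pl l y))"
proof -
  have "inner (S (Pl l x)) (S (Pl l y)) =
      (\<Sum>i<n l. \<Sum>j<n l. vec_index x i * (vec_index y j * inner (S (\<phi> l i)) (S (\<phi> l j))))"
  proof -
    have "inner (S (Pl l x)) (S (Pl l y)) =
        (\<Sum>i<n l. inner (vec_index x i *\<^sub>R S (\<phi> l i)) (\<Sum>j<n l. vec_index y j *\<^sub>R S (\<phi> l j)))"
      unfolding S_recon by (rule inner_sum_left)
    then show ?thesis by (simp add: inner_sum_right mult.left_commute)
  qed
  also have "\<dots> = x \<bullet> (Al l *\<^sub>v y)"
    using assms by (simp add: scalar_prod_def stiffness_mat_def energy_def atLeast0LessThan sum_distrib_left mult_ac)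
  finally show ?thesis by simp
qed

lemma Obs_sum: "finite J \<Longrightarrow> i < \<beta> \<Longrightarrow> vec_index (Obs (\<Sum>j\<in>J. f j)) i = (\<Sum>j\<in>J. vec_index (Obs (f j)) i)"
proof (induction rule: finite_induct)
  case empty
  have "Obs (0 *\<^sub>R 0) = 0 \<cdot>\<^sub>v Obs 0" by (rule Obs_props(3))
  then have "vec_index (Obs 0) i = vec_index (0 \<cdot>\<^sub>v Obs 0) i" by simp
  then show ?case using empty by (simp add: Obs_props)
qed (simp add: Obs_props)

lemma Bl_T_mv: "dim_vec x = n l \<Longrightarrow> transpose_mat (Bl l) *\<^sub>v x = Obs (Pl l x)"
proof (rule eq_vecI)
  fix i assume x: "dim_vec x = n l" and "i < dim_vec (Obs (Pl l x))"
  then have i: "i < \<beta>" by (simp add: Obs_props)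
  show "vec_index (transpose_mat (Bl l) *\<^sub>v x) i = vec_index (Obs (Pl l x)) i"
    unfolding recon_def Obs_sum[OF finite_lessThan i] Obs_props(3) using i x
    by (simp add: Obs_props scalar_prod_def obs_mat_def atLeast0LessThan mult.commute)
qed (simp add: Obs_props)

lemma Kl_form:
  assumes "dim_vec x = n l" "dim_vec y = n l"
  shows "x \<bullet> (Kl l *\<^sub>v y) = Obs (Pl l x) \<bullet> (minv \<Gamma> *\<^sub>v Obs (Pl l y))"
  using assms by (simp add: mv_mult Bl_T_mv Obs_props sp_transpose[of x "Bl l"])

lemma At_form:
  assumes "dim_vec x = n l" "dim_vec y = n l"
  shows "x \<bullet> (At l *\<^sub>v y) = ta (Pl l x) (Pl l y)"
  using assms by (simp add: mv_add sp_addr Al_form Kl_form ta_def del: mv_mult)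

lemma Al_pd: "pos_def (n l) (Al l)"
  unfolding pos_def_def
proof (intro conjI ballI impI)
  show "Al l \<in> carrier_mat (n l) (n l)" by (rule carrier_matI) simp_all
  show "transpose_mat (Al l) = Al l" by (rule eq_matI) (auto simp: stiffness_mat_def energy_def inner_commute)
  fix x :: rvec assume x: "x \<in> carrier_vec (n l)" "x \<noteq> 0\<^sub>v (n l)"
  then have "Pl l x \<noteq> 0" using recon_eq_0 by blast
  then have "S (Pl l x) \<noteq> 0" using K(2)[OF recon_V[of l x]] by auto
  then show "0 < x \<bullet> (Al l *\<^sub>v x)" using x by (simp add: Al_form)
qed

lemma Kl_psd: "pos_semidef (n l) (Kl l)"
  unfolding pos_semidef_def
proof (intro conjI ballI)
  show "Kl l \<in> carrier_mat (n l) (n l)" by (rule carrier_matI) simp_all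
  show "transpose_mat (Kl l) = Kl l"
    using pos_defD(2)[OF pos_def_minv_pos_def[OF Gamma]]
    by (simp add: tr assoc_mult_mat[of "Bl l" "n l" \<beta> "minv \<Gamma>" \<beta> "transpose_mat (Bl l)" "n l"] carrier_matI)
  show "0 \<le> x \<bullet> (Kl l *\<^sub>v x)" if "x \<in> carrier_vec (n l)" for x
    using that c_nonneg[of "Pl l x"] by (simp only: Kl_form carrier_vecD)
qed

sublocale sgs: sgs_splitting "n l" "Al l" "Kl l" for l
  by unfold_locales (rule Al_pd Kl_psd)+

lemma At_pd: "pos_def (n l) (At l)"
proof (rule pos_def_ge[OF Al_pd])
  show "At l \<in> carrier_mat (n l) (n l)" by (rule carrier_matI) simp_all
  show "transpose_mat (At l) = At l"
    using pos_defD(2)[OF Al_pd] pos_semidefD(2)[OF Kl_psd] by (simp add: tr_add del: tr_mult)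
  show "x \<bullet> (Al l *\<^sub>v x) \<le> x \<bullet> (At l *\<^sub>v x)" if "x \<in> carrier_vec (n l)" for x
    using that pos_semidefD(5)[OF Kl_psd that] by (simp add: mv_add sp_addr del: mv_mult)
qed

text \<open>\<open>inv_into\<close> is meaningful on the range of the reconstruction, and nestedness
  places the coarse basis functions there. The matrix then realises the inclusion of the
  spaces.\<close>

lemma Il_props:
  shows "Il (Suc l) \<in> carrier_mat (n (Suc l)) (n l)"
    and "z \<in> carrier_vec (n l) \<Longrightarrow> Pl (Suc l) (Il (Suc l) *\<^sub>v z) = Pl l z"
proof -
  define p where "p = (\<lambda>j. inv_into (carrier_vec (n (Suc l))) (Pl (Suc l)) (Pl l (unit_vec (n l) j)))"
  have ex: "Pl l (unit_vec (n l) j) \<in> Pl (Suc l) ` carrier_vec (n (Suc l))" for j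
    using recon_surj[OF subsetD[OF nested recon_mem]] by (metis imageI)
  have p: "p j \<in> carrier_vec (n (Suc l))" "Pl (Suc l) (p j) = Pl l (unit_vec (n l) j)" for j
    unfolding p_def by (rule inv_into_into[OF ex] f_inv_into_f[OF ex])+
  show I: "Il (Suc l) \<in> carrier_mat (n (Suc l)) (n l)" by (rule carrier_matI) (simp_all add: prolongation_def)
  have Ie: "Il (Suc l) $$ (i, j) = vec_index (p j) i" if "i < n (Suc l)" "j < n l" for i j
    using that p(1)[of j] by (simp add: prolongation_def mat_of_cols_index p_def)
  have unit: "Pl l (unit_vec (n l) j) = \<phi> l j" if "j < n l" for j
  proof -
    have "Pl l (unit_vec (n l) j) = (\<Sum>i<n l. if i = j then \<phi> l j else 0)"
      unfolding recon_def using that by (intro sum.cong) auto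
    then show ?thesis using that by simp
  qed
  assume z: "z \<in> carrier_vec (n l)"
  have "Pl (Suc l) (Il (Suc l) *\<^sub>v z) = (\<Sum>i<n (Suc l). (\<Sum>j<n l. vec_index (p j) i * vec_index z j) *\<^sub>R \<phi> (Suc l) i)"
    unfolding recon_def using z I
    by (intro sum.cong refl arg_cong2[where f = scaleR]) (auto simp: scalar_prod_def Ie atLeast0LessThan)
  also have "\<dots> = (\<Sum>j<n l. vec_index z j *\<^sub>R Pl (Suc l) (p j))"
    unfolding recon_def scaleR_sum_left scaleR_sum_right by (subst sum.swap) (simp add: mult.commute)
  also have "\<dots> = Pl l z" unfolding p(2) recon_def[of _ _ _ z] by (intro sum.cong refl) (simp add: unit)
  finally show "Pl (Suc l) (Il (Suc l) *\<^sub>v z) = Pl l z" .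
qed

text \<open>The Galerkin identity is checked by testing: prolongation leaves the represented
  function unchanged, so both sides evaluate the same form \<open>ta\<close>.\<close>

lemma hierarchy: "mg_hierarchy n At Mt Il"
proof
  fix l
  show "pos_def (n l) (At l)" by (rule At_pd)
  show "Mt l \<in> carrier_mat (n l) (n l)" by (rule sgs.sgs_update_carrier)
  show "transpose_mat (Mt l) = Mt l" by (rule sgs.sgs_update_sym)
  show "x \<bullet> (At l *\<^sub>v x) \<le> x \<bullet> (Mt l *\<^sub>v x)" if "x \<in> carrier_vec (n l)" for x by (rule sgs.sgs_update_ge[OF that])
  show I: "Il (Suc l) \<in> carrier_mat (n (Suc l)) (n l)" by (rule Il_props)
  note [simp] = carrier_matD[OF I] pos_defD(3,4)[OF At_pd]
  show "transpose_mat (Il (Suc l)) * At (Suc l) * Il (Suc l) = At l"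
  proof (rule mat_eq_mv[of _ "n l" "n l"])
    fix x :: rvec assume x: "x \<in> carrier_vec (n l)"
    show "(transpose_mat (Il (Suc l)) * At (Suc l) * Il (Suc l)) *\<^sub>v x = At l *\<^sub>v x"
    proof (rule vec_eq_sp[of _ "n l"])
      fix g :: rvec assume g: "g \<in> carrier_vec (n l)"
      have e: "(transpose_mat (Il (Suc l)) * At (Suc l) * Il (Suc l)) *\<^sub>v x =
          transpose_mat (Il (Suc l)) *\<^sub>v (At (Suc l) *\<^sub>v (Il (Suc l) *\<^sub>v x))"
        using x by (simp add: mv_mult[of "transpose_mat (Il (Suc l)) * At (Suc l)" "Il (Suc l)"]
            mv_mult[of "transpose_mat (Il (Suc l))" "At (Suc l)"])
      have "g \<bullet> (transpose_mat (Il (Suc l)) *\<^sub>v (At (Suc l) *\<^sub>v (Il (Suc l) *\<^sub>v x))) =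
          (Il (Suc l) *\<^sub>v g) \<bullet> (At (Suc l) *\<^sub>v (Il (Suc l) *\<^sub>v x))"
        using g by (subst sp_transpose) simp_all
      also have "\<dots> = ta (Pl (Suc l) (Il (Suc l) *\<^sub>v g)) (Pl (Suc l) (Il (Suc l) *\<^sub>v x))" by (rule At_form) simp_all
      also have "\<dots> = ta (Pl l g) (Pl l x)" unfolding Il_props(2)[OF g] Il_props(2)[OF x] ..
      also have "\<dots> = g \<bullet> (At l *\<^sub>v x)" by (rule At_form[OF carrier_vecD[OF g] carrier_vecD[OF x], symmetric])
      finally show "g \<bullet> ((transpose_mat (Il (Suc l)) * At (Suc l) * Il (Suc l)) *\<^sub>v x) = g \<bullet> (At l *\<^sub>v x)" unfolding e .
    qed (auto intro: carrier_vecI)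
  qed (rule carrier_matI; simp)+
qed

text \<open>The source of level independence for the load vector and the data vector: a functional
  bounded in the norm of the Hilbert space, tested with \<open>minv (At l) *\<^sub>v f\<close>, is
  controlled by the Poincare inequality.\<close>

lemma dual_norm_le:
  assumes f: "f \<in> carrier_vec (n l)" and le: "\<And>x. x \<in> carrier_vec (n l) \<Longrightarrow> f \<bullet> x \<le> \<kappa> * norm (Pl l x)"
    and \<kappa>: "0 \<le> \<kappa>"
  shows "dual_norm (At l) f \<le> \<kappa> * K"
proof -
  interpret energy_matrix "n l" "At l" by unfold_locales (rule At_pd)
  let ?x = "minv (At l) *\<^sub>v f"
  have x: "?x \<in> carrier_vec (n l)" by (rule carrier_vecI) (simp only: dim_mult_mat_vec em_dims)
  have df: "dim_vec f = n l" "dim_vec ?x = n l" using f x by auto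
  have "ta (Pl l ?x) (Pl l ?x) = ?x \<bullet> f"
    unfolding At_form[OF df(2) df(2), symmetric] mv_minv(1)[OF At_pd df(1)] ..
  then have t: "ta (Pl l ?x) (Pl l ?x) = (dual_norm (At l) f)\<^sup>2"
    using dual_norm_sq[OF df(1)] sp_comm[of ?x f] df by simp
  have "(dual_norm (At l) f)\<^sup>2 = f \<bullet> ?x" by (rule dual_norm_sq[OF df(1)])
  also have "\<dots> \<le> \<kappa> * norm (Pl l ?x)" by (rule le[OF x])
  also have "\<dots> \<le> \<kappa> * (K * norm (S (Pl l ?x)))" using K(2)[OF recon_V] \<kappa> by (rule mult_left_mono)
  also have "\<dots> \<le> \<kappa> * (K * dual_norm (At l) f)"
  proof (intro mult_left_mono power2_le_imp_le[OF _ dual_norm_nonneg[OF df(1)]] \<kappa> less_imp_le[OF K(1)])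
    show "(norm (S (Pl l ?x)))\<^sup>2 \<le> (dual_norm (At l) f)\<^sup>2"
      unfolding t[symmetric] ta_def using c_nonneg[of "Pl l ?x"] by (simp add: power2_norm_eq_inner)
  qed
  finally have "dual_norm (At l) f * dual_norm (At l) f \<le> (\<kappa> * K) * dual_norm (At l) f"
    by (simp only: power2_eq_square mult_ac)
  then show ?thesis using dual_norm_nonneg[OF df(1)] \<kappa> K(1) by (cases "dual_norm (At l) f = 0") auto
qed

text \<open>The constant collects \<open>CM\<close> from the smoother bound,
  \<open>c2\<^sup>2 / c1\<^sup>2\<close> from the norm equivalence used in both directions,
  \<open>\<kappa>\<close> from duality, \<open>CP\<close> from passing between neighbouring levels,
  and \<open>Kc * K * K\<close> from the data term measured in the energy.\<close>

lemma approximation_property: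
  assumes CA: "0 < CA" and reg: "\<And>f u. u \<in> V \<Longrightarrow> (\<And>v. v \<in> V \<Longrightarrow> energy S u v = inner f v) \<Longrightarrow> u \<in> W \<and> normW u \<le> CA * norm f"
    and approx: "\<And>l w. w \<in> W \<Longrightarrow> (INF v\<in>level_space \<phi> n l. energy_norm S (w - v)) \<le> sqrt (\<Psi> l) * normW w"
    and \<Psi>: "\<And>l. 0 \<le> \<Psi> l" "0 \<le> CP" "\<And>l. \<Psi> l \<le> CP * \<Psi> (Suc l)"
    and inverse: "\<And>l v. v \<in> level_space \<phi> n l \<Longrightarrow> energy_norm S v \<le> norm v / sqrt (\<Psi> l)"
    and c12: "0 < c1" "0 < c2" and \<Phi>: "\<And>l. 0 \<le> \<Phi> l"
    and equiv: "\<And>l x. x \<in> carrier_vec (n l) \<Longrightarrow> c1 * norm (Pl l x) \<le> \<Phi> l * vnorm x \<and> \<Phi> l * vnorm x \<le> c2 * norm (Pl l x)"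
    and CM: "0 \<le> CM" "\<And>l. mnorm (sgs (Al l)) \<le> CM * mnorm (Al l)"
    and e: "e \<in> carrier_vec (n (Suc l))" and orth: "transpose_mat (Il (Suc l)) *\<^sub>v (At (Suc l) *\<^sub>v e) = 0\<^sub>v (n l)"
  defines "\<kappa> \<equiv> (CA * (1 + Kc * K * K)\<^sup>2)\<^sup>2"
  shows "e \<bullet> (Mt (Suc l) *\<^sub>v e) \<le> (CM * (c2\<^sup>2 / c1\<^sup>2) * (\<kappa> * CP) + Kc * K * K) * (e \<bullet> (At (Suc l) *\<^sub>v e))"
proof -
  let ?l = "Suc l"
  let ?u = "Pl ?l e"
  define \<tau> where "\<tau> = ta ?u ?u"
  have de: "dim_vec e = n ?l" using e by simp
  have \<tau>: "e \<bullet> (At ?l *\<^sub>v e) = \<tau>" unfolding \<tau>_def by (rule At_form[OF de de])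
  have \<tau>_ge: "(norm (S ?u))\<^sup>2 \<le> \<tau>" unfolding \<tau>_def ta_def using c_nonneg[of ?u] by (simp add: power2_norm_eq_inner)
  then have \<tau>0: "0 \<le> \<tau>" by (meson order_trans zero_le_power2)
  note I = Il_props(1)[of l]
  have orth': "ta ?u v = 0" if v: "v \<in> level_space \<phi> n l" for v
  proof -
    obtain z where z: "z \<in> carrier_vec (n l)" "Pl l z = v" using recon_surj[OF v] by blast
    have dz: "dim_vec z = n l" "dim_vec (Il ?l *\<^sub>v z) = n ?l" using z I by auto
    have dAe: "dim_vec (At ?l *\<^sub>v e) = n ?l" by simp
    have "0 = z \<bullet> (transpose_mat (Il ?l) *\<^sub>v (At ?l *\<^sub>v e))" unfolding orth by (simp add: sp)
    also have "\<dots> = (Il ?l *\<^sub>v z) \<bullet> (At ?l *\<^sub>v e)"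
      using sp_transpose[of z "transpose_mat (Il ?l)" "At ?l *\<^sub>v e"] dz carrier_matD[OF I] by simp
    also have "\<dots> = ta v ?u" unfolding At_form[OF dz(2) de] Il_props(2)[OF z(1)] z(2) ..
    finally show ?thesis using c_sym by (simp add: ta_def inner_commute)
  qed
  have "0 \<in> level_space \<phi> n l" by (simp add: level_space_def span_zero)
  then have AN: "(norm ?u)\<^sup>2 \<le> \<kappa> * \<Psi> l * \<tau>"
    unfolding \<tau>_def \<kappa>_def by (intro aubin_nitsche[OF CA reg inV _ \<Psi>(1) approx recon_V orth']) auto
  have \<kappa>0: "0 \<le> \<kappa>" by (simp add: \<kappa>_def)
  \<comment> \<open>The inverse estimate and the first half of the norm equivalence;
    \<open>\<Phi>\<close> cancels below against the second half.\<close>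
  have mA: "mnorm (Al ?l) \<le> (\<Phi> ?l)\<^sup>2 / (c1\<^sup>2 * \<Psi> ?l)"
  proof (rule psd_mnorm_le[OF pos_def_imp_semidef[OF Al_pd]])
    fix x :: rvec assume x: "x \<in> carrier_vec (n ?l)"
    have "norm (S (Pl ?l x)) \<le> norm (Pl ?l x) / sqrt (\<Psi> ?l)"
      using inverse[OF recon_mem] by (simp add: energy_norm_def energy_def norm_eq_sqrt_inner)
    then have "(norm (S (Pl ?l x)))\<^sup>2 \<le> (norm (Pl ?l x) / sqrt (\<Psi> ?l))\<^sup>2" by (rule power_mono) simp
    also have "\<dots> = (norm (Pl ?l x))\<^sup>2 / \<Psi> ?l" using \<Psi>(1) by (simp add: power_divide)
    also have "(norm (Pl ?l x))\<^sup>2 \<le> (\<Phi> ?l * vnorm x / c1)\<^sup>2"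
      using equiv[OF x] c12 by (intro power_mono) (auto simp: field_simps)
    finally have "(norm (S (Pl ?l x)))\<^sup>2 \<le> (\<Phi> ?l * vnorm x / c1)\<^sup>2 / \<Psi> ?l"
      using \<Psi>(1) by (simp add: divide_right_mono)
    also have "\<dots> = (\<Phi> ?l)\<^sup>2 / (c1\<^sup>2 * \<Psi> ?l) * (x \<bullet> x)" by (simp add: power_mult_distrib power_divide vnorm_power2)
    also have "(norm (S (Pl ?l x)))\<^sup>2 = x \<bullet> (Al ?l *\<^sub>v x)" using x by (simp add: Al_form power2_norm_eq_inner)
    finally show "x \<bullet> (Al ?l *\<^sub>v x) \<le> (\<Phi> ?l)\<^sup>2 / (c1\<^sup>2 * \<Psi> ?l) * (x \<bullet> x)" .
  qed (use \<Psi>(1) in simp)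
  have "e \<bullet> (sgs (Al ?l) *\<^sub>v e) \<le> mnorm (sgs (Al ?l)) * (e \<bullet> e)"
    by (rule form_le_mnorm[OF sgs.sgs_carrier e])
  also have "\<dots> \<le> CM * mnorm (Al ?l) * (e \<bullet> e)" using CM(2) sp_self_nonneg by (rule mult_right_mono)
  also have "\<dots> \<le> CM * ((\<Phi> ?l)\<^sup>2 / (c1\<^sup>2 * \<Psi> ?l)) * (e \<bullet> e)"
    using mA CM(1) sp_self_nonneg by (intro mult_right_mono mult_left_mono)
  also have "\<dots> = CM / (c1\<^sup>2 * \<Psi> ?l) * (\<Phi> ?l * vnorm e)\<^sup>2" by (simp add: power_mult_distrib vnorm_power2)
  also have "\<dots> \<le> CM / (c1\<^sup>2 * \<Psi> ?l) * (c2 * norm ?u)\<^sup>2"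
    using equiv[OF e] CM(1) \<Psi>(1) \<Phi> by (intro mult_left_mono power_mono) auto
  also have "\<dots> \<le> CM / (c1\<^sup>2 * \<Psi> ?l) * (c2\<^sup>2 * (\<kappa> * \<Psi> l * \<tau>))"
    unfolding power_mult_distrib using AN CM(1) \<Psi>(1) by (intro mult_left_mono) auto
  also have "\<dots> = CM * (c2\<^sup>2 / c1\<^sup>2) * \<kappa> * \<tau> * (\<Psi> l / \<Psi> ?l)" by simp
  also have "\<dots> \<le> CM * (c2\<^sup>2 / c1\<^sup>2) * \<kappa> * \<tau> * CP"
  proof (rule mult_left_mono)
    \<comment> \<open>The duality estimate lives on the coarse level and the inverse estimate on the
      fine one. If \<open>\<Psi>\<close> vanishes on the fine level, the quotient is 0 by the
      convention for division.\<close>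
    show "\<Psi> l / \<Psi> ?l \<le> CP" using \<Psi>(1)[of ?l] \<Psi>(2) \<Psi>(3)[of l] by (cases "\<Psi> ?l = 0") (simp_all add: pos_divide_le_eq)
  qed (use CM(1) \<kappa>0 \<tau>0 in simp)
  finally have s: "e \<bullet> (sgs (Al ?l) *\<^sub>v e) \<le> CM * (c2\<^sup>2 / c1\<^sup>2) * (\<kappa> * CP) * \<tau>" by (simp add: mult_ac)
  have "e \<bullet> (Kl ?l *\<^sub>v e) \<le> Kc * norm ?u * norm ?u"
    unfolding Kl_form[OF de de] using c_bound(2)[of ?u ?u] by linarith
  also have "\<dots> \<le> Kc * (K * norm (S ?u)) * (K * norm (S ?u))"
    using c_bound(1) K(1) K(2)[OF recon_V] by (intro mult_mono mult_left_mono) auto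
  also have "\<dots> = Kc * K * K * (norm (S ?u))\<^sup>2" by (simp add: power2_eq_square mult_ac)
  also have "\<dots> \<le> Kc * K * K * \<tau>" using \<tau>_ge c_bound(1) K(1) by (intro mult_left_mono) auto
  finally have k: "e \<bullet> (Kl ?l *\<^sub>v e) \<le> Kc * K * K * \<tau>" .
  show ?thesis unfolding \<tau> using sgs.sgs_update_le[OF e] s k by (simp only: distrib_right)
qed

text \<open>The Woodbury identity, verified on the solution: if \<open>G z = y\<close>, then
  \<open>x = A\<inverse> B z\<close> satisfies \<open>At x = B \<Gamma>\<inverse> (\<Gamma> z +
  B\<^sup>T x) = B \<Gamma>\<inverse> y\<close>. It identifies the posterior mean with the fixed
  point of the chain.\<close>

lemma posterior_mean:
  assumes y: "y \<in> carrier_vec \<beta>"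
  shows "minv (Al l) *\<^sub>v (Bl l *\<^sub>v (minv (\<Gamma> + transpose_mat (Bl l) * minv (Al l) * Bl l) *\<^sub>v y)) =
    minv (At l) *\<^sub>v (Bl l *\<^sub>v (minv \<Gamma> *\<^sub>v y))"
proof -
  note Ai = pos_def_minv_pos_def[OF Al_pd[of l]]
  note [simp] = pos_defD(3,4)[OF Ai] pos_defD(3,4)[OF Gamma] pos_defD(3,4)[OF At_pd]
  let ?G = "\<Gamma> + transpose_mat (Bl l) * minv (Al l) * Bl l"
  have G: "pos_def \<beta> ?G"
  proof (rule pos_def_ge[OF Gamma])
    show "?G \<in> carrier_mat \<beta> \<beta>" by (rule carrier_matI) simp_all
    show "transpose_mat ?G = ?G"
      using pos_defD(2)[OF Gamma] pos_defD(2)[OF Ai]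
      by (simp add: tr assoc_mult_mat[of "transpose_mat (Bl l)" \<beta> "n l" "minv (Al l)" "n l" "Bl l" \<beta>] carrier_matI)
    show "x \<bullet> (\<Gamma> *\<^sub>v x) \<le> x \<bullet> (?G *\<^sub>v x)" if x: "x \<in> carrier_vec \<beta>" for x
    proof -
      let ?b = "Bl l *\<^sub>v x"
      have dx: "dim_vec x = \<beta>" using x by simp
      have "?G *\<^sub>v x = \<Gamma> *\<^sub>v x + transpose_mat (Bl l) *\<^sub>v (minv (Al l) *\<^sub>v ?b)"
        using dx by (simp add: mv_add mv_mult)
      then have "x \<bullet> (?G *\<^sub>v x) = x \<bullet> (\<Gamma> *\<^sub>v x) + x \<bullet> (transpose_mat (Bl l) *\<^sub>v (minv (Al l) *\<^sub>v ?b))"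
        by (simp only: sp_addr dim_mult_mat_vec index_transpose_mat fem_dims pos_defD(3)[OF Gamma])
      also have "x \<bullet> (transpose_mat (Bl l) *\<^sub>v (minv (Al l) *\<^sub>v ?b)) = ?b \<bullet> (minv (Al l) *\<^sub>v ?b)"
        using sp_transpose[of x "transpose_mat (Bl l)" "minv (Al l) *\<^sub>v ?b"] dx by simp
      finally show ?thesis
        using pos_semidefD(5)[OF pos_def_imp_semidef[OF Ai], of ?b] by (simp add: carrier_vecI)
    qed
  qed
  note [simp] = pos_defD(3,4)[OF pos_def_minv_pos_def[OF G]]
  define z where "z = minv ?G *\<^sub>v y"
  define x where "x = minv (Al l) *\<^sub>v (Bl l *\<^sub>v z)"
  have d: "dim_vec z = \<beta>" "dim_vec x = n l" by (simp_all add: z_def x_def)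
  have gz: "\<Gamma> *\<^sub>v z + transpose_mat (Bl l) *\<^sub>v x = y"
    using mv_minv(1)[OF G, of y] y d unfolding z_def[symmetric] by (simp add: mv x_def)
  have "At l *\<^sub>v x = Bl l *\<^sub>v z + Bl l *\<^sub>v (minv \<Gamma> *\<^sub>v (transpose_mat (Bl l) *\<^sub>v x))"
    using d mv_minv(1)[OF Al_pd, of "Bl l *\<^sub>v z" l] by (simp add: mv x_def)
  also have "z = minv \<Gamma> *\<^sub>v (\<Gamma> *\<^sub>v z)" using mv_minv(2)[OF Gamma d(1)] by simp
  also have "Bl l *\<^sub>v (minv \<Gamma> *\<^sub>v (\<Gamma> *\<^sub>v z)) + Bl l *\<^sub>v (minv \<Gamma> *\<^sub>v (transpose_mat (Bl l) *\<^sub>v x)) = Bl l *\<^sub>v (minv \<Gamma> *\<^sub>v y)"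
    unfolding gz[symmetric] using d by (simp add: mv_vadd)
  finally have "At l *\<^sub>v x = Bl l *\<^sub>v (minv \<Gamma> *\<^sub>v y)" .
  then have "minv (At l) *\<^sub>v (Bl l *\<^sub>v (minv \<Gamma> *\<^sub>v y)) = x" using mv_minv(2)[OF At_pd d(2)] by metis
  then show ?thesis by (simp only: x_def z_def)
qed

end

section \<open>Error bounds for the chain\<close>

context energy_matrix
begin

lemma pow_transpose_sp:
  fixes X :: rmat
  assumes X: "X \<in> carrier_mat d d" and g: "g \<in> carrier_vec d"
  shows "v \<in> carrier_vec d \<Longrightarrow> g \<bullet> ((X ^\<^sub>m s) *\<^sub>v v) = ((transpose_mat X ^\<^sub>m s) *\<^sub>v g) \<bullet> v"
proof (induction s arbitrary: v)
  case 0
  then show ?case using g X by (simp add: mv)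
next
  case (Suc s)
  have XT: "transpose_mat X \<in> carrier_mat d d" using X by simp
  have w: "(transpose_mat X ^\<^sub>m s) *\<^sub>v g \<in> carrier_vec d"
    by (rule mult_mat_vec_carrier[OF pow_carrier_mat[OF XT] g])
  have "g \<bullet> ((X ^\<^sub>m Suc s) *\<^sub>v v) = ((transpose_mat X ^\<^sub>m s) *\<^sub>v g) \<bullet> (X *\<^sub>v v)"
    unfolding pow_mv_Suc[OF X Suc.prems] by (rule Suc.IH[OF mult_mat_vec_carrier[OF X Suc.prems]])
  also have "\<dots> = (transpose_mat X *\<^sub>v ((transpose_mat X ^\<^sub>m s) *\<^sub>v g)) \<bullet> v"
    using carrier_vecD[OF w] Suc.prems X by (intro sp_transpose) auto
  finally show ?case unfolding pow_mv_Suc'[OF XT g] .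
qed

lemma dual_norm_pow_le:
  assumes X: "X \<in> carrier_mat d d" and g: "g \<in> carrier_vec d"
  shows "dual_norm A ((transpose_mat X ^\<^sub>m s) *\<^sub>v g) \<le> energy_mnorm A X ^ s * dual_norm A g"
proof (induction s)
  case 0
  then show ?case using g X by (simp add: mv)
next
  case (Suc s)
  have XT: "transpose_mat X \<in> carrier_mat d d" using X by simp
  have w: "(transpose_mat X ^\<^sub>m s) *\<^sub>v g \<in> carrier_vec d"
    by (rule mult_mat_vec_carrier[OF pow_carrier_mat[OF XT] g])
  have "dual_norm A ((transpose_mat X ^\<^sub>m Suc s) *\<^sub>v g) \<le> energy_mnorm A X * dual_norm A ((transpose_mat X ^\<^sub>m s) *\<^sub>v g)"
    unfolding pow_mv_Suc'[OF XT g] by (rule dual_norm_transpose_le[OF X carrier_vecD[OF w]])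
  also have "\<dots> \<le> energy_mnorm A X * (energy_mnorm A X ^ s * dual_norm A g)"
    by (rule mult_left_mono[OF Suc energy_mnorm_nonneg])
  finally show ?case by simp
qed

lemma dual_norm_pos: "F \<in> carrier_vec d \<Longrightarrow> F \<noteq> 0\<^sub>v d \<Longrightarrow> 0 < dual_norm A F"
  unfolding dual_norm_def using pos_defD(5)[OF Ai_pd] by simp

lemma limit_autocorr_eq:
  assumes "X \<in> carrier_mat d d" "F \<in> carrier_vec d"
  shows "limit_autocorr A X F s = (((transpose_mat X ^\<^sub>m s) *\<^sub>v F) \<bullet> (minv A *\<^sub>v F)) / (F \<bullet> (minv A *\<^sub>v F))"
  unfolding limit_autocorr_def
  using pow_transpose_sp[OF assms mult_mat_vec_carrier[OF pos_defD(1)[OF Ai_pd] assms(2)]] by simp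

lemma limit_autocorr_le:
  assumes X: "X \<in> carrier_mat d d" and F: "F \<in> carrier_vec d" "F \<noteq> 0\<^sub>v d"
  shows "\<bar>limit_autocorr A X F s\<bar> \<le> energy_mnorm A X ^ s"
proof -
  let ?v = "(transpose_mat X ^\<^sub>m s) *\<^sub>v F"
  have dF: "dim_vec F = d" using F by simp
  have v: "dim_vec ?v = d"
    using mult_mat_vec_carrier[OF pow_carrier_mat[of "transpose_mat X" d s] F(1)] X by auto
  have p: "0 < dual_norm A F" by (rule dual_norm_pos[OF F])
  have "\<bar>?v \<bullet> (minv A *\<^sub>v F)\<bar> \<le> dual_norm A ?v * dual_norm A F" by (rule dual_form_le[OF v dF])
  also have "\<dots> \<le> (energy_mnorm A X ^ s * dual_norm A F) * dual_norm A F"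
    using dual_norm_pow_le[OF X F(1)] p by (intro mult_right_mono) auto
  also have "\<dots> = energy_mnorm A X ^ s * (F \<bullet> (minv A *\<^sub>v F))"
    unfolding dual_norm_sq[OF dF, symmetric] by (simp add: power2_eq_square)
  finally have "\<bar>?v \<bullet> (minv A *\<^sub>v F)\<bar> \<le> energy_mnorm A X ^ s * (F \<bullet> (minv A *\<^sub>v F))" .
  moreover have "0 < F \<bullet> (minv A *\<^sub>v F)" by (rule pos_defD(5)[OF Ai_pd F])
  ultimately show ?thesis unfolding limit_autocorr_eq[OF X F(1)] abs_divide by (simp add: pos_divide_le_eq)
qed

end

section \<open>Bounds for one chain under strict contraction\<close>

context mgmc_markov
begin

sublocale em: energy_matrix "n L" "A L"
  by unfold_locales (rule A_pd)

abbreviation "\<rho> \<equiv> energy_mnorm (A L) (X L)"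
abbreviation "dn \<equiv> dual_norm (A L)"

lemma dn_XT: "g \<in> carrier_vec (n L) \<Longrightarrow> dn (XT s g) \<le> \<rho> ^ s * dn g"
  unfolding XT_def by (rule em.dual_norm_pow_le[OF X_carrier])

lemma dn_nonneg: "g \<in> carrier_vec (n L) \<Longrightarrow> 0 \<le> dn g"
  by (rule em.dual_norm_nonneg) simp

lemma q_le: "g \<in> carrier_vec (n L) \<Longrightarrow> h \<in> carrier_vec (n L) \<Longrightarrow> \<bar>q g h\<bar> \<le> dn g * dn h"
  unfolding q_def Ai_def by (rule em.dual_form_le) auto

lemma q_self: "g \<in> carrier_vec (n L) \<Longrightarrow> q g g = (dn g)\<^sup>2"
  unfolding q_def Ai_def by (rule em.dual_norm_sq[symmetric]) auto

lemma \<theta>_0_moments: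
  "mean_vec Pr (n L) (\<theta> 0) = m Initial" "cov_mat Pr (n L) (\<theta> 0) = \<Sigma> Initial" "pos_semidef (n L) (\<Sigma> Initial)"
  "m Initial \<in> carrier_vec (n L)"
  using gaussian_mean_vec[OF prob_space_axioms gauss[OF source_mem(1)]] gauss[OF source_mem(1)]
  by (auto simp: \<theta>_0 gaussian_rv_def)

context
  fixes C0 :: real
  assumes C0: "mnorm (msqrt (A L) * cov_mat Pr (n L) (\<theta> 0) * msqrt (A L)) < C0"
    and \<rho>1: "\<rho> < 1"
begin

lemma C0_pos: "0 < C0"
  using mnorm_nonneg C0 by (rule le_less_trans)

text \<open>\<open>C0\<close> stems from the initial covariance and the summand 1 from the limit
  covariance; Cauchy-Schwarz for each form passes from equal to different arguments.\<close>

lemma E0_le: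
  assumes g: "g \<in> carrier_vec (n L)" and h: "h \<in> carrier_vec (n L)"
  shows "\<bar>E0 g h\<bar> \<le> (C0 + 1) * (dn g * dn h)"
proof -
  have \<Sigma>: "v \<bullet> (\<Sigma> Initial *\<^sub>v v) \<le> (sqrt C0 * dn v)\<^sup>2" if v: "v \<in> carrier_vec (n L)" for v
  proof -
    have "v \<bullet> (\<Sigma> Initial *\<^sub>v v) \<le> mnorm (msqrt (A L) * \<Sigma> Initial * msqrt (A L)) * (dn v)\<^sup>2"
      using v by (intro em.form_le_dual_norm pos_semidefD(1)[OF \<theta>_0_moments(3)]) auto
    also have "\<dots> \<le> C0 * (dn v)\<^sup>2" using C0 unfolding \<theta>_0_moments(2) by (intro mult_right_mono) auto
    finally show ?thesis using C0_pos by (simp add: power_mult_distrib)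
  qed
  have "\<bar>g \<bullet> (\<Sigma> Initial *\<^sub>v h)\<bar> \<le> (sqrt C0 * dn g) * (sqrt C0 * dn h)"
    using C0_pos dn_nonneg[OF g] dn_nonneg[OF h]
    by (intro psd_cauchy_schwarz_bound[OF \<theta>_0_moments(3) g h \<Sigma>[OF g] \<Sigma>[OF h]]) auto
  also have "\<dots> = (sqrt C0 * sqrt C0) * (dn g * dn h)" by (simp only: mult_ac)
  also have "\<dots> = C0 * (dn g * dn h)" using C0_pos by simp
  finally show ?thesis using q_le[OF g h] unfolding E0_def by (simp add: distrib_right)
qed

text \<open>One-sided and free of \<open>C0\<close>: the initial covariance is nonnegative, so at
  worst the deviation cancels the limit variance. The constant 1 keeps the variance positive after
  one update.\<close>

lemma E0_ge: "g \<in> carrier_vec (n L) \<Longrightarrow> - (dn g)\<^sup>2 \<le> E0 g g"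
  using pos_semidefD(5)[OF \<theta>_0_moments(3)] q_self[of g] by (simp add: E0_def)

lemma E0_XT_le:
  assumes F: "F \<in> carrier_vec (n L)"
  shows "\<bar>E0 (XT j (XT s F)) (XT j F)\<bar> \<le> (C0 + 1) * \<rho> ^ (2 * j) * \<rho> ^ s * (dn F)\<^sup>2"
proof -
  have "\<bar>E0 (XT j (XT s F)) (XT j F)\<bar> \<le> (C0 + 1) * (dn (XT (j + s) F) * dn (XT j F))"
    using E0_le[OF XT_mem[OF XT_mem[OF F]] XT_mem[OF F], of j s j] by (simp add: XT_add[OF F])
  also have "\<dots> \<le> (C0 + 1) * ((\<rho> ^ (j + s) * dn F) * (\<rho> ^ j * dn F))"
    using C0_pos dn_XT[OF F] dn_nonneg[OF XT_mem[OF F]] dn_nonneg[OF F] em.energy_mnorm_nonneg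
    by (intro mult_left_mono mult_mono) auto
  also have "\<dots> = (C0 + 1) * \<rho> ^ (2 * j) * \<rho> ^ s * (dn F)\<^sup>2"
    unfolding mult_2 power_add power2_eq_square by (simp only: mult_ac)
  finally show ?thesis .
qed

text \<open>Uniform in \<open>j\<close>, with \<open>C0 + 1\<close> from the deviation and 1 from
  the limit form; the decay in the lag is the input for the variance of the average.\<close>

lemma Q_le:
  assumes F: "F \<in> carrier_vec (n L)"
  shows "\<bar>Q j (XT s F) F\<bar> \<le> (C0 + 2) * (dn F)\<^sup>2 * \<rho> ^ s"
proof -
  note \<rho>0 = em.energy_mnorm_nonneg[of "X L"]
  have "\<bar>q (XT s F) F\<bar> \<le> (\<rho> ^ s * dn F) * dn F"
    using q_le[OF XT_mem[OF F] F, of s] mult_right_mono[OF dn_XT[OF F, of s] dn_nonneg[OF F]] by linarith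
  moreover have "(C0 + 1) * \<rho> ^ (2 * j) * \<rho> ^ s * (dn F)\<^sup>2 \<le> (C0 + 1) * 1 * \<rho> ^ s * (dn F)\<^sup>2"
    using \<rho>0 \<rho>1 C0_pos by (intro mult_right_mono mult_left_mono power_le_one) auto
  ultimately have "\<bar>Q j (XT s F) F\<bar> \<le> (\<rho> ^ s * dn F) * dn F + (C0 + 1) * 1 * \<rho> ^ s * (dn F)\<^sup>2"
    using E0_XT_le[OF F, of j s] unfolding Q_def by linarith
  also have "\<dots> = (C0 + 2) * (dn F)\<^sup>2 * \<rho> ^ s" by (simp add: power2_eq_square algebra_simps)
  finally show ?thesis .
qed

text \<open>The autocorrelation is its limit with perturbed numerator and denominator. Both
  perturbations are of order \<open>r = \<rho> ^ (2 * j)\<close>, and the denominator stays above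
  \<open>1 - r\<close> times its limit.\<close>

lemma iact_bound:
  assumes F: "F \<in> carrier_vec (n L)" "F \<noteq> 0\<^sub>v (n L)" and j: "1 \<le> j"
  shows "cov Pr (\<lambda>\<omega>. F \<bullet> \<theta> j \<omega>) (\<lambda>\<omega>. F \<bullet> \<theta> j \<omega>) \<noteq> 0"
    and "summable (\<lambda>s. autocorr Pr F \<theta> j (Suc s))"
    and "\<bar>iact Pr F \<theta> j - limit_iact (A L) (X L) F\<bar>
      \<le> 4 * (C0 + 1) * (\<rho> ^ (2 * j + 1) / ((1 - \<rho>) * (1 - \<rho> ^ (2 * j))))"
proof -
  note \<rho>0 = em.energy_mnorm_nonneg[of "X L"]
  define p where "p = dn F"
  have p: "0 < p" unfolding p_def by (rule em.dual_norm_pos[OF F])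
  define r where "r = \<rho> ^ (2 * j)"
  \<comment> \<open>The hypothesis \<open>1 \<le> j\<close> enters here:
    \<open>r \<le> \<rho> < 1\<close>.\<close>
  have "\<rho> ^ (2 * j) \<le> \<rho> ^ 1" using j \<rho>0 \<rho>1 by (intro power_decreasing) auto
  then have r: "0 \<le> r" "r < 1" unfolding r_def using \<rho>0 \<rho>1 by auto
  have Q0: "(1 - r) * p\<^sup>2 \<le> Q j F F"
  proof -
    have "(dn (XT j F))\<^sup>2 \<le> (\<rho> ^ j * p)\<^sup>2"
      unfolding p_def by (rule power_mono[OF dn_XT[OF F(1)] dn_nonneg[OF XT_mem[OF F(1)]]])
    also have "\<dots> = r * p\<^sup>2" unfolding r_def by (simp add: power_mult_distrib power_mult[symmetric] mult.commute)
    finally show ?thesis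
      using E0_ge[OF XT_mem[OF F(1)], of j] q_self[OF F(1)] unfolding Q_def p_def by (simp add: algebra_simps)
  qed
  have rp: "0 < (1 - r) * p\<^sup>2" using r p by simp
  then have Qp: "0 < Q j F F" using Q0 by linarith
  have var: "cov Pr (\<lambda>\<omega>. F \<bullet> \<theta> j \<omega>) (\<lambda>\<omega>. F \<bullet> \<theta> j \<omega>) = Q j F F"
    using \<theta>_lag_cov[OF F(1) F(1), of j 0] by (simp add: XT_0[OF F(1)])
  then show "cov Pr (\<lambda>\<omega>. F \<bullet> \<theta> j \<omega>) (\<lambda>\<omega>. F \<bullet> \<theta> j \<omega>) \<noteq> 0" using Qp by simp
  have ac: "autocorr Pr F \<theta> j s = Q j (XT s F) F / Q j F F" for s
    unfolding autocorr_def var \<theta>_lag_cov[OF F(1) F(1)] ..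
  have lc: "limit_autocorr (A L) (X L) F s = q (XT s F) F / p\<^sup>2" for s
    unfolding em.limit_autocorr_eq[OF X_carrier F(1)] p_def q_self[OF F(1), symmetric] by (simp add: q_def XT_def Ai_def)
  \<comment> \<open>The factor 2 counts numerator and denominator; the factor 2 in the definition of
    the autocorrelation time turns it into the final \<open>4 * (C0 + 1)\<close>.\<close>
  define K where "K = 2 * (C0 + 1) * r / (1 - r)"
  have diff: "\<bar>autocorr Pr F \<theta> j s - limit_autocorr (A L) (X L) F s\<bar> \<le> K * \<rho> ^ s" for s
  proof -
    let ?e = "E0 (XT j (XT s F)) (XT j F)" and ?err = "E0 (XT j F) (XT j F)"
    have e: "\<bar>?e\<bar> \<le> (C0 + 1) * r * \<rho> ^ s * p\<^sup>2" unfolding r_def p_def by (rule E0_XT_le[OF F(1)])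
    have e0: "\<bar>?err\<bar> \<le> (C0 + 1) * r * p\<^sup>2"
      using E0_XT_le[OF F(1), of j 0] unfolding r_def p_def by (simp add: XT_0[OF F(1)])
    have qs: "\<bar>q (XT s F) F\<bar> \<le> \<rho> ^ s * p\<^sup>2"
      using q_le[OF XT_mem[OF F(1)] F(1), of s] mult_right_mono[OF dn_XT[OF F(1), of s] dn_nonneg[OF F(1)]]
      unfolding p_def by (simp add: power2_eq_square)
    \<comment> \<open>Over the common denominator the products of limit terms cancel, and each
      remaining term contains a deviation.\<close>
    have quot: "autocorr Pr F \<theta> j s - limit_autocorr (A L) (X L) F s = (?e * p\<^sup>2 - q (XT s F) F * ?err) / (Q j F F * p\<^sup>2)"
      unfolding ac lc using Qp p q_self[OF F(1)]
      by (simp add: diff_frac_eq) (simp add: Q_def p_def algebra_simps)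
    have "\<bar>autocorr Pr F \<theta> j s - limit_autocorr (A L) (X L) F s\<bar> =
        \<bar>?e * p\<^sup>2 - q (XT s F) F * ?err\<bar> / (Q j F F * p\<^sup>2)"
      unfolding quot abs_divide using Qp by (simp add: abs_mult)
    also have "\<dots> \<le> ((C0 + 1) * r * \<rho> ^ s * p\<^sup>2 * p\<^sup>2 + (\<rho> ^ s * p\<^sup>2) * ((C0 + 1) * r * p\<^sup>2)) / ((1 - r) * p\<^sup>2 * p\<^sup>2)"
    proof (rule frac_le)
      have "\<bar>?e * p\<^sup>2\<bar> \<le> (C0 + 1) * r * \<rho> ^ s * p\<^sup>2 * p\<^sup>2" unfolding abs_mult using e by (simp add: mult_right_mono)
      moreover have "\<bar>q (XT s F) F * ?err\<bar> \<le> (\<rho> ^ s * p\<^sup>2) * ((C0 + 1) * r * p\<^sup>2)"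
        unfolding abs_mult using qs e0 \<rho>0 by (intro mult_mono) auto
      ultimately show "\<bar>?e * p\<^sup>2 - q (XT s F) F * ?err\<bar> \<le> (C0 + 1) * r * \<rho> ^ s * p\<^sup>2 * p\<^sup>2 + (\<rho> ^ s * p\<^sup>2) * ((C0 + 1) * r * p\<^sup>2)"
        by linarith
      show "(1 - r) * p\<^sup>2 * p\<^sup>2 \<le> Q j F F * p\<^sup>2" using Q0 by (intro mult_right_mono) auto
      show "0 < (1 - r) * p\<^sup>2 * p\<^sup>2" using rp p by simp
      show "0 \<le> (C0 + 1) * r * \<rho> ^ s * p\<^sup>2 * p\<^sup>2 + \<rho> ^ s * p\<^sup>2 * ((C0 + 1) * r * p\<^sup>2)"
        using C0_pos r \<rho>0 by simp
    qed
    also have "\<dots> = K * \<rho> ^ s" unfolding K_def using p r by (simp add: field_simps)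
    finally show ?thesis .
  qed
  note lb = em.limit_autocorr_le[OF X_carrier F]
  note sums = autocorrelation_sum_bounds[OF \<rho>0 \<rho>1 lb diff]
  show "summable (\<lambda>s. autocorr Pr F \<theta> j (Suc s))" by (rule sums(2))
  have "\<bar>iact Pr F \<theta> j - limit_iact (A L) (X L) F\<bar> \<le> 2 * K * (\<rho> / (1 - \<rho>))"
    unfolding iact_def limit_iact_def by (rule sums(4))
  also have "\<dots> = 4 * (C0 + 1) * (\<rho> ^ (2 * j + 1) / ((1 - \<rho>) * (1 - \<rho> ^ (2 * j))))"
    unfolding K_def r_def by (simp add: mult_ac)
  finally show "\<bar>iact Pr F \<theta> j - limit_iact (A L) (X L) F\<bar>
      \<le> 4 * (C0 + 1) * (\<rho> ^ (2 * j + 1) / ((1 - \<rho>) * (1 - \<rho> ^ (2 * j))))" .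
qed

text \<open>Bias and variance are separated. \<open>\<delta>\<close> bounds the contraction number,
  \<open>k\<close> the functional and \<open>B\<close> the energy norm of the mean, so that the
  bound depends on the level through these three numbers and \<open>C0\<close> alone.\<close>

lemma mean_square_error_bound:
  assumes C0': "vnorm (msqrt (A L) *\<^sub>v mean_vec Pr (n L) (\<theta> 0)) < C0"
    and \<delta>: "\<rho> \<le> \<delta>" "\<delta> < 1" and F: "F \<in> carrier_vec (n L)" and k: "dn F \<le> k"
    and B: "vnorm (msqrt (A L) *\<^sub>v b) \<le> B"
    and \<zeta>: "gaussian_rv Pr (n L) \<zeta> b \<Lambda>" and N: "1 \<le> N"
  shows "sqrt (integral\<^sup>L Pr (\<lambda>\<omega>.
      \<bar>integral\<^sup>L Pr (\<lambda>\<omega>'. F \<bullet> \<zeta> \<omega>') - (1 / real N) * (\<Sum>j=1..N. F \<bullet> \<theta> j \<omega>)\<bar> ^ 2))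
    \<le> sqrt ((k * (C0 + B) / (1 - \<delta>))\<^sup>2 + (C0 + 2) * k\<^sup>2 * (2 / (1 - \<delta>))) / sqrt (real N)"
proof -
  note \<rho>0 = em.energy_mnorm_nonneg[of "X L"]
  let ?S = "\<lambda>\<omega>. \<Sum>j=1..N. F \<bullet> \<theta> j \<omega>"
  let ?Y = "\<lambda>\<omega>. (1 / real N) * ?S \<omega>"
  have N0: "0 < real N" using N by simp
  have k0: "0 \<le> k" using k dn_nonneg[OF F] by linarith
  have B0: "0 \<le> B" using B vnorm_nonneg order_trans by blast
  have sqF: "sq_int (\<lambda>\<omega>. F \<bullet> \<theta> j \<omega>)" for j by (rule \<theta>_sq_int[OF F])
  have sqS: "sq_int ?S" using cov_sum_right[of "{1..N}" "\<lambda>j \<omega>. F \<bullet> \<theta> j \<omega>" "\<lambda>_. 0"] sqF sq_int_const by auto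
  have sqY: "sq_int ?Y" by (rule sq_int_cmult[OF sqS])
  have c: "integral\<^sup>L Pr (\<lambda>\<omega>'. F \<bullet> \<zeta> \<omega>') = F \<bullet> b" by (rule gaussian_rv_moments(2)[OF \<zeta> F F])
  define w where "w j = XT j F \<bullet> (m Initial - b)" for j
  have dm: "dim_vec (m Initial) = n L" "dim_vec b = n L" using \<theta>_0_moments(4) b by auto
  have w: "\<bar>w j\<bar> \<le> k * (C0 + B) * \<rho> ^ j" for j
  proof -
    have dX: "dim_vec (XT j F) = n L" using XT_mem[OF F] by auto
    have "w j = XT j F \<bullet> m Initial - XT j F \<bullet> b" unfolding w_def using dm by (intro sp_minusr) simp
    then have "\<bar>w j\<bar> \<le> dn (XT j F) * vnorm (msqrt (A L) *\<^sub>v m Initial) + dn (XT j F) * vnorm (msqrt (A L) *\<^sub>v b)"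
      using em.dual_pairing_le[OF dX dm(1)] em.dual_pairing_le[OF dX dm(2)] by linarith
    also have "\<dots> = dn (XT j F) * (vnorm (msqrt (A L) *\<^sub>v m Initial) + vnorm (msqrt (A L) *\<^sub>v b))"
      by (simp add: distrib_left)
    also have "\<dots> \<le> (\<rho> ^ j * k) * (C0 + B)"
    proof (intro mult_mono add_mono)
      show "dn (XT j F) \<le> \<rho> ^ j * k" using dn_XT[OF F, of j] mult_left_mono[OF k zero_le_power[OF \<rho>0, of j]] by linarith
    qed (use C0' B \<rho>0 k0 in \<open>auto simp: \<theta>_0_moments\<close>)
    finally show ?thesis by (simp add: mult_ac)
  qed
  have EY: "expectation ?Y = F \<bullet> b + (1 / real N) * (\<Sum>j=1..N. w j)"
  proof -
    have "expectation ?Y = (1 / real N) * (\<Sum>j=1..N. F \<bullet> b + w j)"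
      using sq_int_integrable[OF sqF] by (simp add: \<theta>_mean[OF F] w_def Bochner_Integration.integral_sum)
    then show ?thesis using N0 by (simp add: sum.distrib distrib_left)
  qed
  have geo: "(\<Sum>j=1..N. \<rho> ^ j) \<le> 1 / (1 - \<delta>)"
  proof -
    have "(\<Sum>j=1..N. \<rho> ^ j) \<le> (\<Sum>j<Suc N. \<rho> ^ j)" using \<rho>0 by (intro sum_mono2) auto
    also have "\<dots> = (1 - \<rho> ^ Suc N) / (1 - \<rho>)" using \<rho>1 unfolding sum_gp_strict by simp
    also have "\<dots> \<le> 1 / (1 - \<rho>)" using \<rho>0 \<rho>1 by (intro divide_right_mono) auto
    also have "\<dots> \<le> 1 / (1 - \<delta>)" using \<delta> by (intro divide_left_mono) auto
    finally show ?thesis .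
  qed
  have "\<bar>F \<bullet> b - expectation ?Y\<bar> = \<bar>\<Sum>j=1..N. w j\<bar> / real N" unfolding EY by (simp add: abs_mult)
  also have "\<dots> \<le> (\<Sum>j=1..N. k * (C0 + B) * \<rho> ^ j) / real N"
    by (intro divide_right_mono order_trans[OF sum_abs] sum_mono w) auto
  also have "\<dots> = k * (C0 + B) * (\<Sum>j=1..N. \<rho> ^ j) / real N" by (simp add: sum_distrib_left)
  also have "\<dots> \<le> k * (C0 + B) * (1 / (1 - \<delta>)) / real N"
    using k0 B0 C0_pos by (intro divide_right_mono mult_left_mono geo) auto
  finally have bias: "\<bar>F \<bullet> b - expectation ?Y\<bar> \<le> k * (C0 + B) / (1 - \<delta>) / real N" by simp
  have bias2: "(F \<bullet> b - expectation ?Y)\<^sup>2 \<le> (k * (C0 + B) / (1 - \<delta>))\<^sup>2 / real N"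
  proof -
    have "(F \<bullet> b - expectation ?Y)\<^sup>2 \<le> (k * (C0 + B) / (1 - \<delta>) / real N)\<^sup>2"
      using power_mono[OF bias abs_ge_zero, of 2] by simp
    also have "\<dots> = (k * (C0 + B) / (1 - \<delta>))\<^sup>2 / (real N)\<^sup>2" by (rule power_divide)
    \<comment> \<open>The squared bias is of order \<open>1 / N\<^sup>2\<close>; it is weakened to
      \<open>1 / N\<close> in order to be added to the variance.\<close>
    also have "\<dots> \<le> (k * (C0 + B) / (1 - \<delta>))\<^sup>2 / real N"
      using N by (intro divide_left_mono self_le_power) auto
    finally show ?thesis .
  qed
  have YY: "cov Pr ?Y ?Y = (1 / real N) * ((1 / real N) * cov Pr ?S ?S)"
  proof -
    have "cov Pr ?Y ?Y = (1 / real N) * cov Pr ?S ?Y" by (rule cov_cmult_left)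
    moreover have "cov Pr ?S ?Y = cov Pr ?Y ?S" by (rule cov_sym)
    moreover have "cov Pr ?Y ?S = (1 / real N) * cov Pr ?S ?S" by (rule cov_cmult_left)
    ultimately show ?thesis by (simp only:)
  qed
  have "cov Pr ?S ?S \<le> real N * ((C0 + 2) * k\<^sup>2 * (2 / (1 - \<rho>)))"
  proof (rule variance_sum_le[OF sqF \<rho>0 \<rho>1])
    fix j s
    have "\<bar>Q j (XT s F) F\<bar> \<le> (C0 + 2) * (dn F)\<^sup>2 * \<rho> ^ s" by (rule Q_le[OF F])
    also have "\<dots> \<le> (C0 + 2) * k\<^sup>2 * \<rho> ^ s"
      using C0_pos k dn_nonneg[OF F] \<rho>0 by (intro mult_right_mono mult_left_mono power_mono) auto
    finally show "\<bar>cov Pr (\<lambda>\<omega>. F \<bullet> \<theta> (j + s) \<omega>) (\<lambda>\<omega>. F \<bullet> \<theta> j \<omega>)\<bar> \<le> (C0 + 2) * k\<^sup>2 * \<rho> ^ s"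
      unfolding \<theta>_lag_cov[OF F F] .
  qed
  also have "real N * ((C0 + 2) * k\<^sup>2 * (2 / (1 - \<rho>))) \<le> real N * ((C0 + 2) * k\<^sup>2 * (2 / (1 - \<delta>)))"
    using C0_pos \<delta> by (intro mult_left_mono divide_left_mono) auto
  finally have SS: "cov Pr ?S ?S \<le> real N * ((C0 + 2) * k\<^sup>2 * (2 / (1 - \<delta>)))" .
  have "(1 / real N) * ((1 / real N) * cov Pr ?S ?S) \<le>
      (1 / real N) * ((1 / real N) * (real N * ((C0 + 2) * k\<^sup>2 * (2 / (1 - \<delta>)))))"
    by (intro mult_left_mono SS) auto
  then have var: "cov Pr ?Y ?Y \<le> (C0 + 2) * k\<^sup>2 * (2 / (1 - \<delta>)) / real N"
    unfolding YY using N0 by (simp add: mult.commute)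
  have "integral\<^sup>L Pr (\<lambda>\<omega>. \<bar>F \<bullet> b - ?Y \<omega>\<bar> ^ 2) = (F \<bullet> b - expectation ?Y)\<^sup>2 + cov Pr ?Y ?Y"
    by (rule mean_square_error_split[OF sqY])
  also have "\<dots> \<le> ((k * (C0 + B) / (1 - \<delta>))\<^sup>2 + (C0 + 2) * k\<^sup>2 * (2 / (1 - \<delta>))) / real N"
    unfolding add_divide_distrib by (rule add_mono[OF bias2 var])
  finally show ?thesis unfolding c real_sqrt_divide[symmetric] by (rule real_sqrt_le_mono)
qed

end

end

section \<open>Choice of the level-independent constants and conclusion\<close>

theorem theorem4p22:
  fixes DA V W :: "'h::{real_inner, complete_space} set"
    and \<A> S :: "'h \<Rightarrow> 'h"
    and normW :: "'h \<Rightarrow> real"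
    and \<chi> :: 'h
    and Obs :: "'h \<Rightarrow> rvec"
    and \<phi> :: "nat \<Rightarrow> nat \<Rightarrow> 'h"
    and n :: "nat \<Rightarrow> nat"
    and \<beta> \<nu> :: nat
    and \<Gamma> :: rmat
    and \<Phi> \<Psi> :: "nat \<Rightarrow> real"
    and C0 :: real
    and A B At Mt I X :: "nat \<Rightarrow> rmat"
    and F :: "nat \<Rightarrow> rvec"
  assumes separable: "separable_space (euclidean :: 'h topology)"
    and selfadj: "self_adjoint_op DA \<A>"
    and posdef: "positive_definite_op DA \<A>"
    and cptinv: "has_compact_inverse DA \<A>"
    and sqrtA: "is_sqrt_op V S DA \<A>"
    and basis: "\<And>l. is_level_basis \<phi> n l"
    and inV: "\<And>l. level_space \<phi> n l \<subseteq> V"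
    and nested: "\<And>l. level_space \<phi> n l \<subseteq> level_space \<phi> n (Suc l)"
    and Obs: "bounded_linear_obs \<beta> Obs"
    and Gamma: "pos_def \<beta> \<Gamma>"
    \<comment> \<open>matrices and vectors\<close>
    and A_eq: "A = stiffness_mat S \<phi> n"
    and B_eq: "B = obs_mat \<beta> Obs \<phi> n"
    and I_eq: "I = prolongation \<phi> n"
    and F_eq: "F = load_vec \<chi> \<phi> n"
    and At_eq: "At = (\<lambda>l. A l + B l * minv \<Gamma> * transpose_mat (B l))"
    and Mt_eq: "Mt = (\<lambda>l. sgs_update (A l) (B l * minv \<Gamma> * transpose_mat (B l)))"
    and X_eq: "X = mg_iteration_mat At Mt I (\<nu> div 2) (\<nu> div 2)"
    and nu: "even \<nu>" "0 < \<nu>"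
    \<comment> \<open>(A1)\<close>
    and Phi: "antimono \<Phi>" "\<And>l. 0 \<le> \<Phi> l"
    and A1: "\<exists>c1>0. \<exists>c2>0. \<forall>l. \<forall>x\<in>carrier_vec (n l).
               c1 * norm (recon \<phi> n l x) \<le> \<Phi> l * vnorm x \<and>
               \<Phi> l * vnorm x \<le> c2 * norm (recon \<phi> n l x)"
    \<comment> \<open>(A2)\<close>
    and W: "subspace W" "W \<subseteq> V" "norm_on W normW"
    and A2a: "\<exists>CA>0. \<forall>f. \<forall>u\<in>V. (\<forall>v\<in>V. energy S u v = inner f v) \<longrightarrow>
                u \<in> W \<and> normW u \<le> CA * norm f"
    and A2b: "\<And>l w. w \<in> W \<Longrightarrow>
                (INF v\<in>level_space \<phi> n l. energy_norm S (w - v)) \<le> sqrt (\<Psi> l) * normW w"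
    and Psi: "antimono \<Psi>" "\<And>l. 0 \<le> \<Psi> l" "\<Psi> \<longlonglongrightarrow> 0"
    \<comment> \<open>(A3)\<close>
    and A3a: "\<exists>CPsi>1. \<forall>l\<ge>1. \<Psi> (l - 1) \<le> CPsi * \<Psi> l"
    and A3b: "\<And>l v. v \<in> level_space \<phi> n l \<Longrightarrow> energy_norm S v \<le> norm v / sqrt (\<Psi> l)"
    \<comment> \<open>(A4)\<close>
    and A4: "\<exists>CM. \<forall>l. mnorm (sgs (A l)) \<le> CM * mnorm (A l)"
  shows "\<exists>C' :: real \<Rightarrow> real. (\<forall>t. 0 < C' t) \<and>
    (\<forall>y\<in>carrier_vec \<beta>. \<exists>C :: real. \<forall>L.
      let \<rho> = energy_mnorm (At L) (X L);
          f = B L *\<^sub>v (minv \<Gamma> *\<^sub>v y);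
          \<mu> = minv (A L) *\<^sub>v (B L *\<^sub>v (minv (\<Gamma> + transpose_mat (B L) * minv (A L) * B L) *\<^sub>v y))
      in
        (F L \<noteq> 0\<^sub>v (n L) \<longrightarrow>
           \<rho> < 1 \<and>
           summable (\<lambda>s. limit_autocorr (At L) (X L) (F L) (Suc s)) \<and>
           limit_iact (At L) (X L) (F L) \<le> (1 + \<rho>) / (1 - \<rho>)) \<and>
        (\<forall>(Pr :: 'w measure) \<theta>.
           mgmc_chain Pr n At Mt I (\<nu> div 2) (\<nu> div 2) L f \<theta> \<and>
           max (vnorm (msqrt (At L) *\<^sub>v mean_vec Pr (n L) (\<theta> 0)))
               (mnorm (msqrt (At L) * cov_mat Pr (n L) (\<theta> 0) * msqrt (At L))) < C0 \<longrightarrow>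
           (F L \<noteq> 0\<^sub>v (n L) \<longrightarrow>
              (\<forall>m\<ge>1.
                 cov Pr (\<lambda>\<omega>. F L \<bullet> \<theta> m \<omega>) (\<lambda>\<omega>. F L \<bullet> \<theta> m \<omega>) \<noteq> 0 \<and>
                 summable (\<lambda>s. autocorr Pr (F L) \<theta> m (Suc s)) \<and>
                 \<bar>iact Pr (F L) \<theta> m - limit_iact (At L) (X L) (F L)\<bar>
                   \<le> C * (\<rho> ^ (2 * m + 1) / ((1 - \<rho>) * (1 - \<rho> ^ (2 * m)))))) \<and>
           (\<forall>\<zeta> N. gaussian_rv Pr (n L) \<zeta> \<mu> (minv (At L)) \<and> 1 \<le> N \<longrightarrow>
              sqrt (integral\<^sup>L Pr (\<lambda>\<omega>.
                 \<bar>integral\<^sup>L Pr (\<lambda>\<omega>'. F L \<bullet> \<zeta> \<omega>') - (1 / real N) * (\<Sum>m=1..N. F L \<bullet> \<theta> m \<omega>)\<bar> ^ 2))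
                \<le> C' (vnorm y) / sqrt (real N))))"
proof -
  have V: "subspace V" "\<And>x y. x \<in> V \<Longrightarrow> y \<in> V \<Longrightarrow> S (x + y) = S x + S y"
    "\<And>c x. x \<in> V \<Longrightarrow> S (c *\<^sub>R x) = c *\<^sub>R S x" "\<And>h. \<exists>u\<in>V. S u = h"
    by (fact sqrt_op_props[OF sqrtA cptinv])+
  obtain K where K: "0 < K" "\<And>u. u \<in> V \<Longrightarrow> norm u \<le> K * norm (S u)"
    using sqrt_op_props(5)[OF sqrtA cptinv] by blast
  have Obs_lin: "\<And>u. Obs u \<in> carrier_vec \<beta>" "\<And>u v. Obs (u + v) = Obs u + Obs v" "\<And>c u. Obs (c *\<^sub>R u) = c \<cdot>\<^sub>v Obs u"
    using Obs by (auto simp: bounded_linear_obs_def)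
  note Obs_dim [simp] = carrier_vecD[OF Obs_lin(1)]
  obtain Ko0 where Ko0: "\<And>u. vnorm (Obs u) \<le> Ko0 * norm u" using Obs by (auto simp: bounded_linear_obs_def)
  define Ko where "Ko = max Ko0 0"
  have Ko: "0 \<le> Ko" "vnorm (Obs u) \<le> Ko * norm u" for u
    using Ko0[of u] mult_right_mono[of Ko0 Ko "norm u"] by (auto simp: Ko_def)
  define g where "g = mnorm (minv \<Gamma>)"
  have g0: "0 \<le> g" by (simp add: g_def mnorm_nonneg)
  note Gi = pos_def_minv_pos_def[OF Gamma]
  note Gi_dims [simp] = pos_defD(3,4)[OF Gi]
  have g: "vnorm (minv \<Gamma> *\<^sub>v x) \<le> g * vnorm x" if "dim_vec x = \<beta>" for x
    unfolding g_def using that by (intro vnorm_mult_le) simp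
  \<comment> \<open>Two factors for the observation map and one for the norm of
    \<open>\<Gamma>\<inverse>\<close>.\<close>
  define Kc where "Kc = Ko * g * Ko"
  interpret fem: multilevel_fem V S Obs \<Gamma> K Kc \<phi> n \<beta>
  proof unfold_locales
    show "\<bar>Obs x \<bullet> (minv \<Gamma> *\<^sub>v Obs y)\<bar> \<le> Kc * norm x * norm y" for x y
    proof -
      have "\<bar>Obs x \<bullet> (minv \<Gamma> *\<^sub>v Obs y)\<bar> \<le> vnorm (Obs x) * vnorm (minv \<Gamma> *\<^sub>v Obs y)"
        by (rule sp_cauchy_schwarz) simp
      also have "\<dots> \<le> (Ko * norm x) * (g * (Ko * norm y))"
        using Ko g0 by (intro mult_mono order_trans[OF g] mult_left_mono) auto
      finally show ?thesis by (simp add: Kc_def mult_ac)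
    qed
    show "Obs (x + y) \<bullet> (minv \<Gamma> *\<^sub>v Obs z) = Obs x \<bullet> (minv \<Gamma> *\<^sub>v Obs z) + Obs y \<bullet> (minv \<Gamma> *\<^sub>v Obs z)" for x y z
      unfolding Obs_lin by (rule sp_addl) simp_all
    show "Obs (r *\<^sub>R x) \<bullet> (minv \<Gamma> *\<^sub>v Obs z) = r * (Obs x \<bullet> (minv \<Gamma> *\<^sub>v Obs z))" for r x z
      unfolding Obs_lin by (rule sp_smultl) simp
    show "Obs x \<bullet> (minv \<Gamma> *\<^sub>v Obs y) = Obs y \<bullet> (minv \<Gamma> *\<^sub>v Obs x)" for x y
      by (rule sp_sym[OF pos_defD(2)[OF Gi]]) simp_all
    show "0 \<le> Obs x \<bullet> (minv \<Gamma> *\<^sub>v Obs x)" for x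
      by (rule pos_semidefD(5)[OF pos_def_imp_semidef[OF Gi] Obs_lin(1)])
    show "0 \<le> Kc" using Ko(1) g0 by (simp add: Kc_def)
  qed (fact V K basis inV nested Obs Gamma)+
  have AtM: "At = fem.At" and MtM: "Mt = fem.Mt" and IM: "I = fem.Il"
    by (simp_all add: At_eq Mt_eq A_eq B_eq I_eq)
  have AM: "A = fem.Al" and BM: "B = fem.Bl" by (simp_all add: A_eq B_eq)
  \<comment> \<open>At least one smoothing step on each side, as the contraction argument
    requires.\<close>
  obtain k where k: "\<nu> div 2 = Suc k" using nu by (cases "\<nu> div 2") (auto elim: evenE)
  interpret mg: mg_hierarchy n At Mt I "\<nu> div 2" "\<nu> div 2"
    unfolding AtM MtM IM by (rule fem.hierarchy)
  obtain c1 c2 where c12: "0 < c1" "0 < c2" and equiv: "\<And>l x. x \<in> carrier_vec (n l) \<Longrightarrow>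
      c1 * norm (recon \<phi> n l x) \<le> \<Phi> l * vnorm x \<and> \<Phi> l * vnorm x \<le> c2 * norm (recon \<phi> n l x)"
    using A1 by blast
  obtain CA where CA: "0 < CA" and reg: "\<And>f u. u \<in> V \<Longrightarrow> (\<And>v. v \<in> V \<Longrightarrow> energy S u v = inner f v) \<Longrightarrow>
      u \<in> W \<and> normW u \<le> CA * norm f" using A2a by blast
  obtain CP where CP: "1 < CP" "\<And>l. 1 \<le> l \<Longrightarrow> \<Psi> (l - 1) \<le> CP * \<Psi> l" using A3a by blast
  have CP': "\<Psi> l \<le> CP * \<Psi> (Suc l)" for l using CP(2)[of "Suc l"] by simp
  obtain CM0 where CM0: "\<And>l. mnorm (sgs (A l)) \<le> CM0 * mnorm (A l)" using A4 by blast
  \<comment> \<open>(A4) leaves the sign of its constant open, so it is replaced by its maximum with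
    0.\<close>
  have CM: "mnorm (sgs (fem.Al l)) \<le> max CM0 0 * mnorm (fem.Al l)" for l
    using CM0[of l] mult_right_mono[of CM0 "max CM0 0" "mnorm (A l)"] mnorm_nonneg[of "A l"] unfolding AM by auto
  define Cap where "Cap = max CM0 0 * (c2\<^sup>2 / c1\<^sup>2) * ((CA * (1 + Kc * K * K)\<^sup>2)\<^sup>2 * CP) + Kc * K * K"
  have Cap0: "0 \<le> Cap" unfolding Cap_def using CP(1) K(1) Ko(1) g0 by (simp add: Kc_def)
  have approx: "e \<bullet> (Mt (Suc l) *\<^sub>v e) \<le> Cap * (e \<bullet> (At (Suc l) *\<^sub>v e))"
    if e: "e \<in> carrier_vec (n (Suc l))" and orth: "transpose_mat (I (Suc l)) *\<^sub>v (At (Suc l) *\<^sub>v e) = 0\<^sub>v (n l)" for l e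
    unfolding AtM MtM Cap_def
    by (rule fem.approximation_property[where W = W and normW = normW and \<Psi> = \<Psi> and \<Phi> = \<Phi> and CA = CA
          and CP = CP and CM = "max CM0 0" and ?c1.0 = c1 and ?c2.0 = c2 and e = e and l = l])
      (fact CA, fact reg, fact A2b, fact Psi(2), use CP(1) in simp, fact CP', fact A3b, fact c12(1), fact c12(2),
        fact Phi(2), fact equiv, simp, fact CM, fact e, fact orth[unfolded AtM IM])
  define \<delta> where "\<delta> = Cap / (Cap + 1)"
  have \<delta>: "0 \<le> \<delta>" "\<delta> < 1" using Cap0 by (auto simp: \<delta>_def)
  have XM: "X = mg.X" by (simp add: X_eq)
  have em: "energy_matrix (n l) (At l)" for l by unfold_locales (rule mg.A_pd)
  have \<rho>\<delta>: "energy_mnorm (At l) (X l) \<le> \<delta>" for l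
    unfolding XM
  proof (rule energy_matrix.energy_mnorm_le[OF em mg.X_carrier \<delta>(1)])
    show "x \<bullet> (At l *\<^sub>v (mg.X l *\<^sub>v y)) = (mg.X l *\<^sub>v x) \<bullet> (At l *\<^sub>v y)" if "dim_vec x = n l" "dim_vec y = n l" for x y
      using mg.X_ip_sym[OF refl that] by (simp add: mg.ip_def)
    fix x :: rvec assume x: "dim_vec x = n l"
    note mg.vcycle_contraction[OF k k Cap0 approx x]
    then show "0 \<le> x \<bullet> (At l *\<^sub>v (mg.X l *\<^sub>v x))" "x \<bullet> (At l *\<^sub>v (mg.X l *\<^sub>v x)) \<le> \<delta> * (x \<bullet> (At l *\<^sub>v x))"
      by (auto simp: mg.ip_def \<delta>_def)
  qed
  then have \<rho>1: "energy_mnorm (At l) (X l) < 1" for l using \<delta>(2) by (meson le_less_trans)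
  have \<rho>0: "0 \<le> energy_mnorm (At l) (X l)" for l by (rule energy_matrix.energy_mnorm_nonneg[OF em])
  have F: "F l \<in> carrier_vec (n l)" for l by (simp add: F_eq load_vec_def)
  define kF where "kF = norm \<chi> * K"
  have dF: "dual_norm (At l) (F l) \<le> kF" for l
    unfolding AtM kF_def
  proof (rule fem.dual_norm_le[OF F])
    fix x :: rvec assume x: "x \<in> carrier_vec (n l)"
    have "F l \<bullet> x = inner \<chi> (recon \<phi> n l x)"
      using x by (simp add: F_eq load_vec_def recon_def scalar_prod_def inner_sum_right atLeast0LessThan inner_commute mult.commute)
    then show "F l \<bullet> x \<le> norm \<chi> * norm (recon \<phi> n l x)" using norm_cauchy_schwarz by simp
  qed simp
  define ky where "ky = g * Ko * K"
  have ky0: "0 \<le> ky" using g0 Ko(1) K(1) by (simp add: ky_def)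
  have dy: "dual_norm (At l) (B l *\<^sub>v (minv \<Gamma> *\<^sub>v y)) \<le> ky * vnorm y" if y: "y \<in> carrier_vec \<beta>" for l y
  proof -
    let ?z = "minv \<Gamma> *\<^sub>v y"
    have "dual_norm (fem.At l) (fem.Bl l *\<^sub>v ?z) \<le> (g * vnorm y * Ko) * K"
    proof (rule fem.dual_norm_le)
      fix x :: rvec assume x: "x \<in> carrier_vec (n l)"
      have dx: "dim_vec x = n l" using x by simp
      have "(fem.Bl l *\<^sub>v ?z) \<bullet> x = Obs (recon \<phi> n l x) \<bullet> ?z"
        using dx sp_comm[of "fem.Bl l *\<^sub>v ?z" x] sp_transpose[of x "fem.Bl l" ?z] by (simp add: fem.Bl_T_mv)
      also have "\<dots> \<le> vnorm (Obs (recon \<phi> n l x)) * vnorm ?z"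
        using sp_cauchy_schwarz[of "Obs (recon \<phi> n l x)" ?z] by simp
      also have "\<dots> \<le> (Ko * norm (recon \<phi> n l x)) * (g * vnorm y)"
        using Ko g[of y] y by (intro mult_mono) auto
      finally show "(fem.Bl l *\<^sub>v ?z) \<bullet> x \<le> g * vnorm y * Ko * norm (recon \<phi> n l x)" by (simp add: mult_ac)
    qed (use g0 Ko(1) in \<open>auto intro!: carrier_vecI\<close>)
    then show ?thesis unfolding AtM BM ky_def by (simp add: mult_ac)
  qed
  \<comment> \<open>\<open>\<bar>C0\<bar>\<close> and the added 1 make the value positive for every
    \<open>t\<close> and every \<open>C0\<close>; once a chain satisfies the initial bound,
    \<open>C0\<close> is itself positive.\<close>
  define C' where "C' t = sqrt ((kF * (\<bar>C0\<bar> + ky * \<bar>t\<bar>) / (1 - \<delta>))\<^sup>2 + (\<bar>C0\<bar> + 2) * kF\<^sup>2 * (2 / (1 - \<delta>))) + 1" for t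
  have A: "energy_mnorm (At L) (X L) < 1 \<and>
           summable (\<lambda>s. limit_autocorr (At L) (X L) (F L) (Suc s)) \<and>
           limit_iact (At L) (X L) (F L) \<le> (1 + energy_mnorm (At L) (X L)) / (1 - energy_mnorm (At L) (X L))"
    if FL: "F L \<noteq> 0\<^sub>v (n L)" for L
  proof -
    have "\<bar>limit_autocorr (At L) (X L) (F L) s\<bar> \<le> energy_mnorm (At L) (X L) ^ s" for s
      unfolding XM by (rule energy_matrix.limit_autocorr_le[OF em mg.X_carrier F FL])
    note s = autocorrelation_sum_bounds[OF \<rho>0 \<rho>1 this, of "limit_autocorr (At L) (X L) (F L)" 0]
    show ?thesis
      unfolding limit_iact_def using \<rho>1[of L] s(1,3) by simp
  qed
  have B: "(F L \<noteq> 0\<^sub>v (n L) \<longrightarrow>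
              (\<forall>m\<ge>1.
                 cov Pr (\<lambda>\<omega>. F L \<bullet> \<theta> m \<omega>) (\<lambda>\<omega>. F L \<bullet> \<theta> m \<omega>) \<noteq> 0 \<and>
                 summable (\<lambda>s. autocorr Pr (F L) \<theta> m (Suc s)) \<and>
                 \<bar>iact Pr (F L) \<theta> m - limit_iact (At L) (X L) (F L)\<bar>
                   \<le> 4 * (C0 + 1) * (energy_mnorm (At L) (X L) ^ (2 * m + 1) /
                     ((1 - energy_mnorm (At L) (X L)) * (1 - energy_mnorm (At L) (X L) ^ (2 * m)))))) \<and>
           (\<forall>\<zeta> N. gaussian_rv Pr (n L) \<zeta> (minv (A L) *\<^sub>v (B L *\<^sub>v (minv (\<Gamma> + transpose_mat (B L) * minv (A L) * B L) *\<^sub>v y))) (minv (At L)) \<and> 1 \<le> N \<longrightarrow>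
              sqrt (integral\<^sup>L Pr (\<lambda>\<omega>.
                 \<bar>integral\<^sup>L Pr (\<lambda>\<omega>'. F L \<bullet> \<zeta> \<omega>') - (1 / real N) * (\<Sum>m=1..N. F L \<bullet> \<theta> m \<omega>)\<bar> ^ 2))
                \<le> C' (vnorm y) / sqrt (real N))"
    if y: "y \<in> carrier_vec \<beta>" and H: "mgmc_chain Pr n At Mt I (\<nu> div 2) (\<nu> div 2) L (B L *\<^sub>v (minv \<Gamma> *\<^sub>v y)) \<theta> \<and>
           max (vnorm (msqrt (At L) *\<^sub>v mean_vec Pr (n L) (\<theta> 0)))
               (mnorm (msqrt (At L) * cov_mat Pr (n L) (\<theta> 0) * msqrt (At L))) < C0"
    for y L and Pr :: "'w measure" and \<theta>
  proof -
    let ?f = "B L *\<^sub>v (minv \<Gamma> *\<^sub>v y)"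
    from H have C0m: "vnorm (msqrt (At L) *\<^sub>v mean_vec Pr (n L) (\<theta> 0)) < C0"
      and C0c: "mnorm (msqrt (At L) * cov_mat Pr (n L) (\<theta> 0) * msqrt (At L)) < C0" by auto
    from H obtain Z \<mu>0 \<Sigma>0 where Pr: "prob_space Pr" and Z0: "Z Initial = \<theta> 0"
      and ZI: "gaussian_rv Pr (n L) (Z Initial) \<mu>0 \<Sigma>0"
      and ZC: "\<And>m. gaussian_rv Pr (n 0) (Z (Coarse m)) (0\<^sub>v (n 0)) (minv (At 0))"
      and ZS: "\<And>m l k. 1 \<le> l \<Longrightarrow> l \<le> L \<Longrightarrow> k < \<nu> div 2 + \<nu> div 2 \<Longrightarrow>
         gaussian_rv Pr (n l) (Z (Smooth m l k)) (0\<^sub>v (n l)) (Mt l + transpose_mat (Mt l) - At l)"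
      and ind: "prob_space.indep_vars Pr
         (\<lambda>s. Pi\<^sub>M {..<source_dim n L s} (\<lambda>_. borel))
         (\<lambda>s \<omega>. restrict (vec_index (Z s \<omega>)) {..<source_dim n L s})
         (sources L (\<nu> div 2 + \<nu> div 2))"
      and \<theta>S: "\<And>m \<omega>. \<omega> \<in> space Pr \<Longrightarrow> \<theta> (Suc m) \<omega> =
         mgmc At Mt I (\<nu> div 2) (\<nu> div 2) (Z (Coarse m) \<omega>) (\<lambda>l k. Z (Smooth m l k) \<omega>) L ?f (\<theta> m \<omega>)"
      unfolding mgmc_chain_def by blast
    define mm where "mm = (\<lambda>s. case s of Initial \<Rightarrow> \<mu>0 | Coarse m \<Rightarrow> 0\<^sub>v (n 0) | Smooth m l k \<Rightarrow> 0\<^sub>v (n l))"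
    define SS where "SS = (\<lambda>s. case s of Initial \<Rightarrow> \<Sigma>0 | Coarse m \<Rightarrow> minv (At 0) | Smooth m l k \<Rightarrow> Mt l + transpose_mat (Mt l) - At l)"
    define b where "b = minv (At L) *\<^sub>v ?f"
    have df: "dim_vec ?f = n L" by (simp add: BM)
    have Atb: "At L *\<^sub>v b = ?f" unfolding b_def by (rule mv_minv(1)[OF mg.A_pd df])
    interpret ch: mgmc_markov n At Mt I "\<nu> div 2" "\<nu> div 2" Pr L Z mm SS \<theta> b
    proof (intro mgmc_markov.intro mgmc_process.intro mgmc_markov_axioms.intro mgmc_process_axioms.intro
        gaussian_sources.intro gaussian_sources_axioms.intro)
      show "mg_hierarchy n At Mt I" by (rule mg.mg_hierarchy_axioms)
      show "gaussian_rv Pr (source_dim n L s) (Z s) (mm s) (SS s)" if "s \<in> sources L (\<nu> div 2 + \<nu> div 2)" for s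
        using that ZI ZC ZS by (auto simp: sources_def mm_def SS_def)
      show "b \<in> carrier_vec (n L)" unfolding b_def
        by (rule carrier_vecI) (simp only: dim_mult_mat_vec pos_defD(3)[OF pos_def_minv_pos_def[OF mg.A_pd]])
      show "\<theta> (Suc j) \<omega> = mgmc At Mt I (\<nu> div 2) (\<nu> div 2) (Z (Coarse j) \<omega>) (\<lambda>l k. Z (Smooth j l k) \<omega>) L (At L *\<^sub>v b) (\<theta> j \<omega>)"
        if "\<omega> \<in> space Pr" for \<omega> j unfolding Atb by (rule \<theta>S[OF that])
    qed (auto simp: mm_def SS_def Z0 Pr ind)
    have \<rho>1': "energy_mnorm (At L) (mg.X L) < 1" using \<rho>1[of L] unfolding XM .
    have \<rho>\<delta>': "energy_mnorm (At L) (mg.X L) \<le> \<delta>" using \<rho>\<delta>[of L] unfolding XM .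
    show ?thesis
    proof (intro conjI impI allI)
      fix m :: nat assume FL: "F L \<noteq> 0\<^sub>v (n L)" and m: "1 \<le> m"
      show "cov Pr (\<lambda>\<omega>. F L \<bullet> \<theta> m \<omega>) (\<lambda>\<omega>. F L \<bullet> \<theta> m \<omega>) \<noteq> 0"
        "summable (\<lambda>s. autocorr Pr (F L) \<theta> m (Suc s))"
        by (rule ch.iact_bound(1,2)[OF C0c \<rho>1' F FL m])+
      show "\<bar>iact Pr (F L) \<theta> m - limit_iact (At L) (X L) (F L)\<bar>
                 \<le> 4 * (C0 + 1) * (energy_mnorm (At L) (X L) ^ (2 * m + 1) /
                   ((1 - energy_mnorm (At L) (X L)) * (1 - energy_mnorm (At L) (X L) ^ (2 * m))))"
        unfolding XM by (rule ch.iact_bound(3)[OF C0c \<rho>1' F FL m])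
    next
      fix \<zeta> and N :: nat
      assume \<zeta>: "gaussian_rv Pr (n L) \<zeta> (minv (A L) *\<^sub>v (B L *\<^sub>v (minv (\<Gamma> + transpose_mat (B L) * minv (A L) * B L) *\<^sub>v y))) (minv (At L)) \<and> 1 \<le> N"
      have "minv (A L) *\<^sub>v (B L *\<^sub>v (minv (\<Gamma> + transpose_mat (B L) * minv (A L) * B L) *\<^sub>v y)) = b"
        unfolding b_def AtM AM BM by (rule fem.posterior_mean[OF y])
      then have \<zeta>b: "gaussian_rv Pr (n L) \<zeta> b (minv (At L))" and N: "1 \<le> N" using \<zeta> by auto
      have db: "dim_vec b = n L" by (simp add: b_def)
      \<comment> \<open>The energy norm of the posterior mean is the dual norm of the right-hand
        side; here the bound acquires its dependence on \<open>y\<close>.\<close>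
      have "(vnorm (msqrt (At L) *\<^sub>v b))\<^sup>2 = b \<bullet> (At L *\<^sub>v b)"
        unfolding vnorm_power2 using db by (simp add: ch.em.R_R flip: ch.em.R_sp)
      also have "\<dots> = (dual_norm (At L) ?f)\<^sup>2"
        unfolding Atb ch.em.dual_norm_sq[OF df] b_def[symmetric] using df db by (intro sp_comm) simp
      finally have "vnorm (msqrt (At L) *\<^sub>v b) = dual_norm (At L) ?f"
        using ch.em.dual_norm_nonneg[OF df] by simp
      then have B: "vnorm (msqrt (At L) *\<^sub>v b) \<le> ky * vnorm y" using dy[OF y, of L] by simp
      have C0p: "\<bar>C0\<bar> = C0" using mnorm_nonneg C0c by (metis abs_of_pos le_less_trans)
      have "sqrt (integral\<^sup>L Pr (\<lambda>\<omega>.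
               \<bar>integral\<^sup>L Pr (\<lambda>\<omega>'. F L \<bullet> \<zeta> \<omega>') - (1 / real N) * (\<Sum>m=1..N. F L \<bullet> \<theta> m \<omega>)\<bar> ^ 2))
          \<le> sqrt ((kF * (C0 + ky * vnorm y) / (1 - \<delta>))\<^sup>2 + (C0 + 2) * kF\<^sup>2 * (2 / (1 - \<delta>))) / sqrt (real N)"
        by (rule ch.mean_square_error_bound[OF C0c \<rho>1' C0m \<rho>\<delta>' \<delta>(2) F dF B \<zeta>b N])
      also have "\<dots> \<le> C' (vnorm y) / sqrt (real N)"
        unfolding C'_def C0p by (intro divide_right_mono) auto
      finally show "sqrt (integral\<^sup>L Pr (\<lambda>\<omega>.
               \<bar>integral\<^sup>L Pr (\<lambda>\<omega>'. F L \<bullet> \<zeta> \<omega>') - (1 / real N) * (\<Sum>m=1..N. F L \<bullet> \<theta> m \<omega>)\<bar> ^ 2))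
          \<le> C' (vnorm y) / sqrt (real N)" .
    qed
  qed
  have C'_pos: "0 < C' t" for t
    unfolding C'_def using \<delta>(2) by (intro add_nonneg_pos real_sqrt_ge_zero add_nonneg_nonneg) auto
  show ?thesis
    unfolding Let_def
    \<comment> \<open>Both constants are supplied before \<open>L\<close> is fixed;
      \<open>4 * (C0 + 1)\<close> is moreover the same for every \<open>y\<close>.\<close>
    by (rule exI[of _ C'], rule conjI, rule allI, rule C'_pos, rule ballI, rule exI[of _ "4 * (C0 + 1)"], rule allI,
        rule conjI, rule impI, erule A, intro allI impI, erule (1) B)
qed

end
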